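(* Let $A\in M^+(n,\mathbb{R})$ with trace $\alpha$, and let $\varphi:\mathbb{R}^n\to\mathbb{R}$ be a continuous positive $A$-homogeneous function. Given any $\delta>0$, $\varepsilon>0$ and $M>0$, there exists a positive $A$-homogeneous function $\psi\in C^0(\mathbb{R}^n)\cap C^\infty(\mathbb{R}^n\setminus\{0\})$ such that for each $x\in\mathbb{R}^n$ $$\varphi(x)\le\psi(x)\le(1+\varepsilon)\varphi(x),$$ but $$\sup_{|s-\alpha|=\delta}\bigl|\zeta(\psi,s)\bigr|\ge M.$$
   Context: $n$ is a positive integer. $M^+(n,\mathbb{R})$ is the set of real $n\times n$ matrices all of whose eigenvalues $\lambda$ satisfy $\operatorname{Re}\lambda>0$. For $t>0$, $t^A:=e^{(\log t)A}$. A function $\varphi:\mathbb{R}^n\to\mathbb{R}$ is $A$-homogeneous if $\varphi(t^Ax)=t\varphi(x)$ for all $t>0$ and $x\in\mathbb{R}^n$ (so $\varphi(0)=0$). An $A$-homogeneous function with values in $[0,+\infty)$ is positive if $\varphi(x)>0$ for all $x\neq0$. For a positive $A$-homogeneous $\psi\in C^0(\mathbb{R}^n)\cap C^\infty(\mathbb{R}^n\setminus\{0\})$, the series $\zeta(\psi,s)=\sum_{\omega\in\mathbb{Z}^n\setminus\{0\}}\psi(\omega)^{-s}$ converges for $\operatorname{Re}s>\alpha$ and extends to a holomorphic function on $\mathbb{C}\setminus\{\alpha\}$ (with a simple pole at $\alpha$); $\zeta(\psi,s)$ denotes this extension.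
   Formalization: The formal theorem assumes n ≥ 2; for n = 1 the claim is false, since ζ(ψ,s) = (c₊^{-s}+c₋^{-s})ζ_Riemann(s/α) with c₊, c₋ confined to compact intervals, so the supremum over the circle is bounded. *)

theory Defs
  imports "HOL-Analysis.Analysis" "HOL-Complex_Analysis.Complex_Analysis"
begin

text \<open>On \<^typ>\<open>real^'n^'n\<close> the library's \<open>*\<close>, \<open>^\<close> and \<open>1\<close> act componentwise, so
  matrix powers and exponentials are built from \<open>**\<close> and \<open>mat 1\<close>.\<close>

definition matrix_power :: "real^'n^'n \<Rightarrow> nat \<Rightarrow> real^'n^'n" where
  "matrix_power A k = (((**) A) ^^ k) (mat 1)"

definition matrix_exp :: "real^'n^'n \<Rightarrow> real^'n^'n" where
  "matrix_exp A = (\<Sum>k. (1 / fact k) *\<^sub>R matrix_power A k)"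

definition rpow_matrix :: "real \<Rightarrow> real^'n^'n \<Rightarrow> real^'n^'n" where
  "rpow_matrix t A = matrix_exp (ln t *\<^sub>R A)"

definition complex_eigenvalue :: "real^'n^'n \<Rightarrow> complex \<Rightarrow> bool" where
  "complex_eigenvalue A \<mu> \<longleftrightarrow>
     (\<exists>v :: complex^'n. v \<noteq> 0 \<and> map_matrix complex_of_real A *v v = \<mu> *s v)"

definition M_plus :: "(real^'n^'n) set" where
  "M_plus = {A. \<forall>\<mu>. complex_eigenvalue A \<mu> \<longrightarrow> Re \<mu> > 0}"

definition homogeneous :: "real^'n^'n \<Rightarrow> (real^'n \<Rightarrow> real) \<Rightarrow> bool" where
  "homogeneous A \<phi> \<longleftrightarrow> (\<forall>t>0. \<forall>x. \<phi> (rpow_matrix t A *v x) = t * \<phi> x)"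

definition positive_homogeneous :: "real^'n^'n \<Rightarrow> (real^'n \<Rightarrow> real) \<Rightarrow> bool" where
  "positive_homogeneous A \<phi> \<longleftrightarrow>
     homogeneous A \<phi> \<and> (\<forall>x. \<phi> x \<ge> 0) \<and> (\<forall>x. x \<noteq> 0 \<longrightarrow> \<phi> x > 0)"

text \<open>\<open>Ck_on k f U\<close> is meant for open \<open>U\<close>: all directional derivatives up to order \<open>k\<close>
  exist (as values of Frechet derivatives) and are continuous on \<open>U\<close>.\<close>

fun Ck_on :: "nat \<Rightarrow> ('a::euclidean_space \<Rightarrow> real) \<Rightarrow> 'a set \<Rightarrow> bool" where
  "Ck_on 0 f U \<longleftrightarrow> continuous_on U f"
| "Ck_on (Suc k) f U \<longleftrightarrow>
     (\<forall>x\<in>U. f differentiable (at x)) \<and>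
     (\<forall>v. Ck_on k (\<lambda>x. frechet_derivative f (at x) v) U)"

definition smooth_on :: "('a::euclidean_space \<Rightarrow> real) \<Rightarrow> 'a set \<Rightarrow> bool" where
  "smooth_on f U \<longleftrightarrow> (\<forall>k. Ck_on k f U)"

definition integer_lattice :: "(real^'n) set" where
  "integer_lattice = {\<omega>. \<forall>i. \<omega> $ i \<in> \<int>}"

definition is_zeta_extension ::
    "real \<Rightarrow> (real^'n \<Rightarrow> real) \<Rightarrow> (complex \<Rightarrow> complex) \<Rightarrow> bool" where
  "is_zeta_extension \<alpha> \<psi> Z \<longleftrightarrow>
     Z holomorphic_on (- {complex_of_real \<alpha>}) \<and>
     (\<forall>s. Re s > \<alpha> \<longrightarrow>
        ((\<lambda>\<omega>. complex_of_real (\<psi> \<omega>) powr (- s)) has_sum Z s) (integer_lattice - {0}))"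

text \<open>The extension is unique away from \<open>\<alpha>\<close>; the value at \<open>\<alpha>\<close> itself is
  meaningless.\<close>

definition zeta :: "real \<Rightarrow> (real^'n \<Rightarrow> real) \<Rightarrow> complex \<Rightarrow> complex" where
  "zeta \<alpha> \<psi> = (SOME Z. is_zeta_extension \<alpha> \<psi> Z)"

lemma is_zeta_extension_unique:
  assumes Z: "is_zeta_extension \<alpha> \<psi> Z" and W: "is_zeta_extension \<alpha> \<psi> W"
    and s: "s \<noteq> complex_of_real \<alpha>"
  shows "Z s = W s"
proof (rule analytic_continuation_open[where f = Z and g = W and z = s
      and s = "{s. Re s > \<alpha>}" and s' = "- {complex_of_real \<alpha>}"])
  show "s \<in> - {complex_of_real \<alpha>}" using s by simp
  show "Z holomorphic_on - {complex_of_real \<alpha>}" "W holomorphic_on - {complex_of_real \<alpha>}"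
    using Z W by (simp_all add: is_zeta_extension_def)
  show "open {s. Re s > \<alpha>}" by (rule open_halfspace_Re_gt)
  show "{s. Re s > \<alpha>} \<noteq> {}"
    by (auto intro!: exI[of _ "complex_of_real (\<alpha> + 1)"])
  show "connected (- {complex_of_real \<alpha>})"
    by (rule connected_punctured_universe) simp
  show "Z z = W z" if "z \<in> {s. Re s > \<alpha>}" for z
    using Z W that by (auto simp: is_zeta_extension_def intro: has_sum_unique)
qed auto

lemma zeta_eq_extension:
  assumes "is_zeta_extension \<alpha> \<psi> Z" and "s \<noteq> complex_of_real \<alpha>"
  shows "zeta \<alpha> \<psi> s = Z s"
  using is_zeta_extension_unique[OF _ assms] assms(1) someI
  unfolding zeta_def by metis

end

theory Submission
  imports Defs "HOL-Computational_Algebra.Fundamental_Theorem_Algebra"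
begin

text \<open>Let \<open>\<psi>\<close> be smooth, and let \<open>M\<close> bound its zeta function on the circle.  Multiply \<open>\<psi>\<close> by \<open>1 + \<eta>\<close> along the
  orbits through finitely many lattice points, and by a factor tending to \<open>1\<close> elsewhere.  These orbits are
  null sets since \<open>n \<ge> 2\<close>, so the residues, being integrals of \<open>\<psi>\<close>, converge to the original one.  If the
  bound \<open>M\<close> holds for all these functions, the maximum principle carries it (without the polar part) to the
  interior of the disc.  For real \<open>s > \<alpha>\<close> the difference of the two series then bounds
  \<open>(1 - (1 + \<eta>) powr (- s)) * (\<Sum>\<omega>\<in>W. \<psi> \<omega> powr (- s))\<close> independently of \<open>s\<close> and of the finite set \<open>W\<close>, which
  contradicts the pole at \<open>\<alpha>\<close>.

  For the continuation, \<open>\<psi> powr (- s)\<close> is cut into pieces of compact support along the flow of \<open>A\<close>.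
  Summed over the lattice, a piece at time \<open>v\<close> is \<open>exp (v * \<alpha>)\<close> times an integral, up to an error decaying
  faster than any prescribed exponential.  The main terms form a geometric series whose poles other than
  \<open>\<alpha>\<close> are pushed to infinity by refining the partition.\<close>

text \<open>For n = 1 the claim fails for large M: a positive homogeneous function on the line is
  fixed by its values at 1 and -1, so the bounds confine \<psi> to a compact family and zeta stays
  bounded on the circle. \<open>CARD('n) \<ge> 2\<close> excludes this case. The order of the limits
  matters. With W and the real point s = a fixed, the perturbation is first concentrated on its
  orbits, so that the polar parts r / (a - \<alpha>) cancel in the limit; only afterwards W grows
  and a tends to \<alpha>. Otherwise the difference of the residues would be divided by a vanishing
  quantity. Smooth coordinates along the flow need a hypersurface that every orbit crosses once and
  transversally. The Euclidean sphere can fail here, as x . Ax may be negative for some x; a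
  quadratic form that increases along the flow supplies an ellipsoid instead. Poisson summation is
  replaced by an elementary estimate for periodic functions of one variable. It uses finitely many
  derivatives, so the cut-offs are only of class C^k, with k chosen for the half-plane Re s > - N in
  question.\<close>

no_notation fps_nth (infixl "$" 75)

section \<open>Componentwise differentiation and matrix products\<close>

lemma has_vector_derivative_vecI:
  fixes f :: "real \<Rightarrow> 'a::euclidean_space^'n"
  assumes "\<And>i. ((\<lambda>t. f t $ i) has_vector_derivative f' $ i) (at x within S)"
  shows "(f has_vector_derivative f') (at x within S)"
proof -
  have "((\<lambda>t. f t \<bullet> b) has_derivative (\<lambda>h. (h *\<^sub>R f') \<bullet> b)) (at x within S)"
    if b: "b \<in> Basis" for b :: "'a^'n"
  proof -
    obtain i c where b: "b = axis i c" "c \<in> Basis" using b by (auto simp: Basis_vec_def)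
    have "((\<lambda>t. f t $ i \<bullet> c) has_derivative (\<lambda>h. (h *\<^sub>R f' $ i) \<bullet> c)) (at x within S)"
      using assms[of i] unfolding has_vector_derivative_def
      by (rule has_derivative_inner_left)
    then show ?thesis by (simp add: b inner_axis)
  qed
  then show ?thesis unfolding has_vector_derivative_def has_derivative_componentwise_within[of f]
    by blast
qed

lemma bounded_bilinear_matrix_vector_mult:
  "bounded_bilinear ((*v) :: 'a::{euclidean_space,real_algebra_1}^'n^'m \<Rightarrow> _)"
  by (auto simp: bilinear_conv_bounded_bilinear[symmetric] bilinear_def
      vec_eq_iff matrix_vector_mult_def scaleR_sum_right sum.distrib distrib_left distrib_right
      intro!: linearI)

lemma bounded_bilinear_matrix_matrix_mult:
  "bounded_bilinear ((**) :: real^'n^'m \<Rightarrow> real^'k^'n \<Rightarrow> _)"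
  by (auto simp: bilinear_conv_bounded_bilinear[symmetric] bilinear_def sum.distrib sum_distrib_left
      vec_eq_iff matrix_matrix_mult_def algebra_simps
      intro!: linearI)

subsection \<open>The flow of a matrix\<close>

text \<open>This is \<open>rpow_matrix t A\<close> in the additive parameter u = ln t: the dilations
  become a one-parameter group, and homogeneity reads \<phi>(flow u x) = e^u \<phi>(x).\<close>

definition flow :: "real^'n^'n \<Rightarrow> real \<Rightarrow> real^'n^'n" where
  "flow A u = matrix_exp (u *\<^sub>R A)"

text \<open>The entrywise l1 norm dominates every absolute row sum, which is what closes the
  induction over matrix powers.\<close>

definition entry_bound :: "real^'n^'n \<Rightarrow> real" where
  "entry_bound A = (\<Sum>i\<in>UNIV. \<Sum>j\<in>UNIV. \<bar>A $ i $ j\<bar>)"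

lemma entry_bound_nonneg: "entry_bound A \<ge> 0"
  by (auto simp: entry_bound_def intro!: sum_nonneg)

lemma matrix_power_0 [simp]: "matrix_power A 0 = mat 1"
  by (simp add: matrix_power_def)

lemma matrix_power_Suc: "matrix_power A (Suc k) = A ** matrix_power A k"
  by (simp add: matrix_power_def)

lemma matrix_power_commute: "A ** matrix_power A k = matrix_power A k ** A"
  by (induction k) (auto simp: matrix_power_Suc matrix_mul_assoc)

lemma matrix_power_scaleR: "matrix_power (u *\<^sub>R A) k = u ^ k *\<^sub>R matrix_power A k"
  by (induction k) (auto simp: matrix_power_Suc matrix_matrix_mult_def vec_eq_iff
    sum_distrib_left mult_ac)

lemma matrix_power_entry_le:
  fixes A :: "real^'n^'n"
  shows "\<bar>matrix_power A k $ i $ j\<bar> \<le> entry_bound A ^ k"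
proof (induction k arbitrary: i)
  case 0 then show ?case by (auto simp: mat_def)
next
  case (Suc k)
  have "\<bar>matrix_power A (Suc k) $ i $ j\<bar> \<le> (\<Sum>l\<in>UNIV. \<bar>A $ i $ l\<bar> * \<bar>matrix_power A k $ l $ j\<bar>)"
    by (auto simp: matrix_power_Suc matrix_matrix_mult_def abs_mult[symmetric] intro!: sum_abs)
  also have "\<dots> \<le> (\<Sum>l\<in>UNIV. \<bar>A $ i $ l\<bar> * entry_bound A ^ k)"
    by (intro sum_mono mult_left_mono Suc) auto
  also have "\<dots> = (\<Sum>l\<in>UNIV. \<bar>A $ i $ l\<bar>) * entry_bound A ^ k" by (simp add: sum_distrib_right)
  also have "(\<Sum>l\<in>UNIV. \<bar>A $ i $ l\<bar>) \<le> entry_bound A" unfolding entry_bound_def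
    by (rule member_le_sum) (auto intro!: sum_nonneg)
  finally show ?case by (simp add: mult_right_mono entry_bound_nonneg)
qed

lemma norm_matrix_le_entries:
  fixes A :: "real^'n^'m"
  shows "norm A \<le> (\<Sum>i\<in>UNIV. \<Sum>j\<in>UNIV. \<bar>A $ i $ j\<bar>)"
proof -
  have "norm A \<le> (\<Sum>i\<in>UNIV. norm (A $ i))" by (simp add: norm_vec_def L2_set_le_sum)
  also have "\<dots> \<le> (\<Sum>i\<in>UNIV. \<Sum>j\<in>UNIV. norm (A $ i $ j))"
    by (intro sum_mono) (simp add: norm_le_l1_cart)
  finally show ?thesis by simp
qed

text \<open>Each entry of the flow is an everywhere convergent scalar power series, so derivatives
  and growth bounds come from the scalar theory.\<close>

lemma flow_sums:
  fixes A :: "real^'n^'n"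
  shows "(\<lambda>k. (matrix_power A k $ i $ j / fact k) * u ^ k) sums (flow A u $ i $ j)"
proof -
  let ?M = "\<lambda>k. (1 / fact k) *\<^sub>R matrix_power (u *\<^sub>R A) k"
  let ?N = "real (CARD('n)) * real (CARD('n))"
  have b: "norm (?M k) \<le> ?N * (inverse (fact k) * (\<bar>u\<bar> * entry_bound A) ^ k)" for k
  proof -
    have "norm (matrix_power A k) \<le> (\<Sum>i\<in>(UNIV::'n set). \<Sum>j\<in>(UNIV::'n set). entry_bound A ^ k)"
      by (rule order_trans[OF norm_matrix_le_entries]) (intro sum_mono matrix_power_entry_le)
    then have "norm (matrix_power A k) \<le> ?N * entry_bound A ^ k" by simp
    then have "inverse (fact k) * \<bar>u\<bar> ^ k * norm (matrix_power A k)
       \<le> inverse (fact k) * \<bar>u\<bar> ^ k * (?N * entry_bound A ^ k)"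
      by (intro mult_left_mono) auto
    then show ?thesis
      by (simp add: matrix_power_scaleR power_abs power_mult_distrib divide_simps mult_ac)
  qed
  have "summable ?M"
    by (rule summable_norm_cancel, rule summable_comparison_test'[where N = 0,
       OF summable_mult[OF summable_exp]]) (use b in auto)
  then have "?M sums flow A u" by (simp add: flow_def matrix_exp_def summable_sums)
  moreover have "bounded_linear (\<lambda>B::real^'n^'n. B $ i $ j)"
    by (intro bounded_linear_compose[OF bounded_linear_vec_nth bounded_linear_vec_nth])
  ultimately have "(\<lambda>k. ?M k $ i $ j) sums (flow A u $ i $ j)"
    by (rule bounded_linear.sums[rotated])
  then show ?thesis by (simp add: matrix_power_scaleR mult_ac)
qed

lemma flow_entry_le:
  fixes A :: "real^'n^'n"
  shows "\<bar>flow A u $ i $ j\<bar> \<le> exp (entry_bound A * \<bar>u\<bar>)"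
proof -
  have s: "(\<lambda>k. inverse (fact k) * (entry_bound A * \<bar>u\<bar>) ^ k) sums exp (entry_bound A * \<bar>u\<bar>)"
    using exp_converges[of "entry_bound A * \<bar>u\<bar>"] by (simp add: divide_inverse mult_ac)
  have b: "norm ((matrix_power A k $ i $ j / fact k) * u ^ k) \<le>
      inverse (fact k) * (entry_bound A * \<bar>u\<bar>) ^ k" for k
    using matrix_power_entry_le[of A k i j]
    by (auto simp: abs_mult power_abs power_mult_distrib field_simps intro!: mult_left_mono)
  have "norm (\<Sum>k. (matrix_power A k $ i $ j / fact k) * u ^ k)
      \<le> (\<Sum>k. inverse (fact k) * (entry_bound A * \<bar>u\<bar>) ^ k)"
    by (rule norm_suminf_le[OF b sums_summable[OF s]])
  then show ?thesis
    by (simp only: sums_unique[OF s, symmetric] sums_unique[OF flow_sums, symmetric] real_norm_def)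
qed

lemma flow_0 [simp]: "flow A 0 = mat 1"
proof -
  have "flow A 0 $ i $ j = mat 1 $ i $ j" for i j
    using sums_unique2[OF flow_sums[of A i j 0] powser_sums_zero] by simp
  then show ?thesis by (simp add: vec_eq_iff)
qed

lemma flow_entry_deriv:
  fixes A :: "real^'n^'n"
  shows "((\<lambda>u. flow A u $ i $ j) has_real_derivative (A ** flow A u) $ i $ j) (at u)"
proof -
  let ?c = "\<lambda>i k. matrix_power A k $ i $ j / fact k"
  have eq: "flow A u $ i $ j = (\<Sum>k. ?c i k * u ^ k)" for u i using sums_unique[OF flow_sums] .
  have sm: "summable (\<lambda>k. ?c i k * u ^ k)" for u i using sums_summable[OF flow_sums] .
  have "((\<lambda>u. flow A u $ i $ j) has_real_derivative (\<Sum>k. diffs (?c i) k * u ^ k)) (at u)"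
    unfolding eq by (rule termdiffs_strong_converges_everywhere[OF sm])
  moreover have "diffs (?c i) k * u ^ k = (\<Sum>l\<in>UNIV. A $ i $ l * (?c l k * u ^ k))" for k
  proof -
    have "diffs (?c i) k = (\<Sum>l\<in>UNIV. A $ i $ l * ?c l k)"
    proof -
      have "diffs (?c i) k = real (Suc k) / fact (Suc k) * (\<Sum>l\<in>UNIV. A $ i $ l * matrix_power A k $ l $ j)"
        by (simp add: diffs_def matrix_power_Suc matrix_matrix_mult_def)
      also have "real (Suc k) / fact (Suc k) = (1 / fact k :: real)"
        by (simp add: field_simps del: of_nat_Suc)
      finally show ?thesis by (simp add: sum_distrib_left mult_ac)
    qed
    then show ?thesis by (simp only: sum_distrib_right mult.assoc)
  qed
  moreover have "(\<lambda>k. \<Sum>l\<in>UNIV. A $ i $ l * (?c l k * u ^ k)) sums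
      (\<Sum>l\<in>UNIV. A $ i $ l * flow A u $ l $ j)"
    by (intro sums_sum sums_mult flow_sums)
  ultimately show ?thesis using sums_unique by (fastforce simp: matrix_matrix_mult_def)
qed

lemma flow_has_vector_derivative:
  "(flow A has_vector_derivative (A ** flow A u)) (at u within S)"
  by (intro has_vector_derivative_vecI)
    (auto simp: has_real_derivative_iff_has_vector_derivative[symmetric]
      intro: has_field_derivative_at_within flow_entry_deriv)

lemma flow_entry_continuous: "continuous_on S (\<lambda>u. flow A u $ i $ j)"
  by (intro continuous_at_imp_continuous_on ballI DERIV_isCont[OF flow_entry_deriv])

lemma flow_continuous: "continuous_on S (flow A)"
  using flow_has_vector_derivative
  by (metis continuous_at_imp_continuous_on has_vector_derivative_continuous)

lemma flow_commute: "A ** flow A u = flow A u ** A" for A :: "real^'n^'n"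
proof -
  have "(A ** flow A u) $ i $ j = (flow A u ** A) $ i $ j" for i j
  proof -
    have "(\<lambda>k. \<Sum>l\<in>UNIV. A $ i $ l * ((matrix_power A k $ l $ j / fact k) * u ^ k))
        sums (A ** flow A u) $ i $ j"
      unfolding matrix_matrix_mult_def vec_lambda_beta by (intro sums_sum sums_mult flow_sums)
    moreover have "(\<lambda>k. \<Sum>l\<in>UNIV. ((matrix_power A k $ i $ l / fact k) * u ^ k) * A $ l $ j)
        sums (flow A u ** A) $ i $ j"
      unfolding matrix_matrix_mult_def vec_lambda_beta by (intro sums_sum sums_mult2 flow_sums)
    moreover have "(\<Sum>l\<in>UNIV. A $ i $ l * ((matrix_power A k $ l $ j / fact k) * u ^ k)) =
       (\<Sum>l\<in>UNIV. ((matrix_power A k $ i $ l / fact k) * u ^ k) * A $ l $ j)" for k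
    proof -
      have "(A ** matrix_power A k) $ i $ j * (u ^ k / fact k)
          = (matrix_power A k ** A) $ i $ j * (u ^ k / fact k)"
        by (simp add: matrix_power_commute)
      then show ?thesis by (simp add: matrix_matrix_mult_def sum_distrib_left sum_distrib_right
         sum_divide_distrib mult_ac)
    qed
    ultimately show ?thesis using sums_unique2 by fastforce
  qed
  then show ?thesis by (simp add: vec_eq_iff)
qed

text \<open>Since A commutes with its flow, the left side has derivative 0 in u and equals its value
  at u = 0. Invertibility and the group law are both instances.\<close>

lemma flow_minus_mult_flow_add: "flow A (- u) ** flow A (u + v) = flow A v" for A :: "real^'n^'n"
proof -
  let ?g = "\<lambda>u. flow A (- u) ** flow A (u + v)"
  have "(?g has_vector_derivative 0) (at u)" for u
  proof -
    have 1: "((\<lambda>u. flow A (- u)) has_vector_derivative - (A ** flow A (-u))) (at u)"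
      using vector_diff_chain_at[of uminus "-1" u "flow A", OF _ flow_has_vector_derivative]
      by (simp add: o_def has_vector_derivative_minus[OF has_vector_derivative_id])
    have 2: "((\<lambda>u. flow A (u + v)) has_vector_derivative (A ** flow A (u + v))) (at u)"
      using vector_diff_chain_at[of "\<lambda>u. u + v" "1" u "flow A", OF _ flow_has_vector_derivative]
      by (simp add: o_def has_vector_derivative_add_const)
    have "(?g has_vector_derivative
      (flow A (-u) ** (A ** flow A (u + v)) + (- (A ** flow A (-u))) ** flow A (u + v))) (at u)"
      by (rule bounded_bilinear.has_vector_derivative[OF bounded_bilinear_matrix_matrix_mult 1 2])
    moreover have "- (A ** flow A (-u)) ** flow A (u + v) = - (flow A (-u) ** (A ** flow A (u + v)))"
      by (simp add: flow_commute[of A "- u"] matrix_mul_assoc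
          bounded_bilinear.minus_left[OF bounded_bilinear_matrix_matrix_mult])
    ultimately show ?thesis by simp
  qed
  then obtain c where "\<And>u. ?g u = c"
    using has_derivative_zero_constant[of UNIV ?g] by (auto simp: has_vector_derivative_def)
  then have "?g u = ?g 0" by metis
  then show ?thesis by simp
qed

lemma flow_minus_inverse [simp]:
  "flow A (- u) ** flow A u = mat 1" "flow A u ** flow A (- u) = mat 1" for A :: "real^'n^'n"
  using flow_minus_mult_flow_add[of A u 0] flow_minus_mult_flow_add[of A "-u" 0] by auto

lemma flow_add: "flow A (u + v) = flow A u ** flow A v" for A :: "real^'n^'n"
proof -
  have "flow A u ** (flow A (-u) ** flow A (u + v)) = flow A u ** flow A v"
    by (simp only: flow_minus_mult_flow_add)
  then show ?thesis by (simp only: matrix_mul_assoc flow_minus_inverse matrix_mul_lid)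
qed

lemma flow_add_vec: "flow A u *v (flow A v *v x) = flow A (u + v) *v x" for A :: "real^'n^'n"
  by (simp add: flow_add matrix_vector_mul_assoc)

lemma flow_has_vector_derivative_vec:
  fixes A :: "real^'n^'n"
  shows "((\<lambda>u. flow A u *v x) has_vector_derivative (A *v (flow A u *v x))) (at u within S)"
proof -
  have "((\<lambda>M::real^'n^'n. M *v x) has_derivative (\<lambda>M. M *v x)) (at y within S)" for y S
    by (rule bounded_linear_imp_has_derivative)
      (rule bounded_bilinear.bounded_linear_left[OF bounded_bilinear_matrix_vector_mult])
  from vector_derivative_diff_chain_within[OF flow_has_vector_derivative this]
  show ?thesis by (simp add: o_def matrix_vector_mul_assoc)
qed

lemma norm_matrix_vector_le:
  fixes M :: "real^'n^'m"
  shows "norm (M *v x) \<le> (\<Sum>i\<in>UNIV. \<Sum>j\<in>UNIV. \<bar>M $ i $ j\<bar>) * norm x"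
proof -
  have "norm (M *v x) \<le> (\<Sum>i\<in>UNIV. \<bar>(M *v x) $ i\<bar>)" by (rule norm_le_l1_cart)
  also have "\<dots> \<le> (\<Sum>i\<in>UNIV. \<Sum>j\<in>UNIV. \<bar>M $ i $ j\<bar> * norm x)"
  proof (rule sum_mono)
    fix i
    have "\<bar>(M *v x) $ i\<bar> \<le> (\<Sum>j\<in>UNIV. \<bar>M $ i $ j\<bar> * \<bar>x $ j\<bar>)"
      by (auto simp: matrix_vector_mult_def abs_mult[symmetric] intro!: sum_abs)
    also have "\<dots> \<le> (\<Sum>j\<in>UNIV. \<bar>M $ i $ j\<bar> * norm x)"
      by (intro sum_mono mult_left_mono component_le_norm_cart) auto
    finally show "\<bar>(M *v x) $ i\<bar> \<le> (\<Sum>j\<in>UNIV. \<bar>M $ i $ j\<bar> * norm x)" .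
  qed
  finally show ?thesis by (simp add: sum_distrib_right)
qed

lemma norm_flow_vector_le:
  fixes A :: "real^'n^'n"
  shows "norm (flow A u *v x) \<le> real CARD('n) ^ 2 * exp (entry_bound A * \<bar>u\<bar>) * norm x"
proof -
  have "(\<Sum>i\<in>UNIV. \<Sum>j\<in>UNIV. \<bar>flow A u $ i $ j\<bar>)
     \<le> (\<Sum>i\<in>(UNIV::'n set). \<Sum>j\<in>(UNIV::'n set). exp (entry_bound A * \<bar>u\<bar>))"
    by (intro sum_mono flow_entry_le)
  also have "\<dots> = real CARD('n) ^ 2 * exp (entry_bound A * \<bar>u\<bar>)"
    by (simp add: power2_eq_square)
  finally show ?thesis
    by (rule order_trans[OF norm_matrix_vector_le mult_right_mono]) simp
qed

lemma permutes_eq_id_except_one: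
  assumes "p permutes UNIV" "\<And>j. j \<noteq> i \<Longrightarrow> p j = j"
  shows "p = id"
proof -
  have "p i = i"
  proof (rule ccontr)
    assume "p i \<noteq> i"
    then have "p (p i) = p i" using assms(2) by blast
    then show False using \<open>p i \<noteq> i\<close> permutes_inj[OF assms(1)] by (auto dest: injD)
  qed
  then show ?thesis using assms(2) by (auto simp: fun_eq_iff) metis
qed

text \<open>Jacobi's formula at the identity matrix. A permutation other than the identity moves at
  least two points, so after one factor of its Leibniz term has been differentiated, an off-diagonal
  factor 0 remains.\<close>

lemma det_flow_deriv_0:
  fixes A :: "real^'n^'n"
  shows "((\<lambda>u. det (flow A u)) has_real_derivative trace A) (at 0)"
proof -
  let ?P = "{p. p permutes (UNIV :: 'n set)}"
  have 1: "((\<lambda>u. flow A u $ i $ j) has_derivative (\<lambda>h. A $ i $ j * h)) (at 0)" for i j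
    using flow_entry_deriv[of A i j 0] by (simp add: has_field_derivative_def)
  have "((\<lambda>u. det (flow A u)) has_derivative
     (\<lambda>h. \<Sum>p\<in>?P. of_int (sign p) *
        (\<Sum>i\<in>UNIV. (A $ i $ p i * h) * (\<Prod>j\<in>UNIV-{i}. flow A 0 $ j $ p j)))) (at 0)"
    unfolding det_def
    by (intro has_derivative_sum has_derivative_mult_right has_derivative_prod 1)
  moreover have "(\<Sum>p\<in>?P. of_int (sign p) *
        (\<Sum>i\<in>UNIV. (A $ i $ p i * h) * (\<Prod>j\<in>UNIV-{i}. flow A 0 $ j $ p j))) = trace A * h" for h
  proof -
    have "of_int (sign p) * (\<Sum>i\<in>UNIV. (A $ i $ p i * h) * (\<Prod>j\<in>UNIV-{i}. flow A 0 $ j $ p j))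
      = (if p = id then trace A * h else 0)" if "p \<in> ?P" for p
    proof (cases "p = id")
      case True then show ?thesis by (simp add: trace_def mat_def sum_distrib_right)
    next
      case False
      have z: "(\<Prod>j\<in>UNIV-{i}. flow A 0 $ j $ p j) = 0" for i
      proof -
        obtain j where "j \<noteq> i" "p j \<noteq> j"
          using permutes_eq_id_except_one[of p i] False \<open>p \<in> ?P\<close> by auto
        then show ?thesis by (intro prod_zero) (auto simp: mat_def intro!: bexI[of _ j])
      qed
      show ?thesis using False by (simp only: z mult_zero_right sum.neutral_const if_False)
    qed
    then have "(\<Sum>p\<in>?P. of_int (sign p) *
        (\<Sum>i\<in>UNIV. (A $ i $ p i * h) * (\<Prod>j\<in>UNIV-{i}. flow A 0 $ j $ p j)))
        = (\<Sum>p\<in>?P. if p = id then trace A * h else 0)" by (intro sum.cong) auto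
    then show ?thesis by (simp add: permutes_id finite_permutations)
  qed
  ultimately show ?thesis by (simp add: has_field_derivative_def)
qed

text \<open>The group law reduces the derivative at u to the one at 0, which gives the linear
  equation D' = trace A * D.\<close>

lemma det_flow:
  fixes A :: "real^'n^'n"
  shows "det (flow A u) = exp (u * trace A)"
proof -
  let ?D = "\<lambda>u. det (flow A u)"
  have D: "(?D has_real_derivative trace A * ?D u) (at u)" for u
  proof -
    have "((\<lambda>v. ?D u * ?D (v - u)) has_real_derivative ?D u * trace A) (at u)"
    proof (rule DERIV_cmult)
      have "((\<lambda>v. v - u) has_real_derivative 1) (at u)" by (auto intro!: derivative_eq_intros)
      then show "((\<lambda>v. ?D (v - u)) has_real_derivative trace A) (at u)"
        using DERIV_chain2[of ?D "trace A" "\<lambda>v. v - u" u 1 UNIV] det_flow_deriv_0[of A] by simp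
    qed
    moreover have "?D u * ?D (v - u) = ?D v" for v
      by (simp add: det_mul[symmetric] flow_add[symmetric])
    ultimately show ?thesis by (simp add: mult.commute)
  qed
  have "((\<lambda>u. ?D u * exp (- u * trace A)) has_real_derivative 0) (at u)" for u
    by (auto intro!: derivative_eq_intros D)
  then have "?D u * exp (- u * trace A) = ?D 0 * exp (- 0 * trace A)"
    using DERIV_isconst_all[of "\<lambda>u. ?D u * exp (- u * trace A)" u 0] by blast
  then show ?thesis by (simp add: exp_minus field_simps)
qed

subsection \<open>Exponential decay for eigenvalues in the right half-plane\<close>

definition cflow :: "real^'n^'n \<Rightarrow> real \<Rightarrow> complex^'n \<Rightarrow> complex^'n" where
  "cflow A u v = map_matrix complex_of_real (flow A u) *v v"

text \<open>The constant and the rate belong to a single vector, so that an induction over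
  polynomial factors may lower the rate at each step.\<close>

definition decays :: "real^'n^'n \<Rightarrow> complex^'n \<Rightarrow> bool" where
  "decays A v \<longleftrightarrow> (\<exists>C c. c > 0 \<and> (\<forall>u\<ge>0. norm (cflow A (- u) v) \<le> C * exp (- c * u)))"

lemma map_matrix_of_real_mult:
  "map_matrix complex_of_real A ** map_matrix complex_of_real B = map_matrix complex_of_real (A ** B)"
  by (simp add: vec_eq_iff map_matrix_def matrix_matrix_mult_def)

lemma cflow_deriv:
  fixes A :: "real^'n^'n"
  shows "((\<lambda>u. cflow A (- u) v) has_vector_derivative
      - cflow A (- u) (map_matrix complex_of_real A *v v)) (at u)"
proof (rule has_vector_derivative_vecI)
  fix i
  have 1: "((\<lambda>u. flow A (- u) $ i $ j) has_real_derivative - (A ** flow A (- u)) $ i $ j) (at u)"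
    for j using DERIV_chain2[OF flow_entry_deriv DERIV_minus[OF DERIV_ident], of A i j u]
    by simp
  have "((\<lambda>u. \<Sum>j\<in>UNIV. complex_of_real (flow A (- u) $ i $ j) * v $ j) has_vector_derivative
      (\<Sum>j\<in>UNIV. complex_of_real (- (A ** flow A (- u)) $ i $ j) * v $ j)) (at u)"
    by (intro has_vector_derivative_sum has_vector_derivative_mult_left has_vector_derivative_of_real)
      (use 1 in \<open>simp add: has_real_derivative_iff_has_vector_derivative\<close>)
  moreover have "(\<Sum>j\<in>UNIV. complex_of_real (- (A ** flow A (- u)) $ i $ j) * v $ j)
     = (- cflow A (- u) (map_matrix complex_of_real A *v v)) $ i"
    unfolding flow_commute[of A "-u"]
    by (simp add: cflow_def matrix_vector_mul_assoc map_matrix_of_real_mult sum_negf)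
      (simp add: matrix_vector_mult_def map_matrix_def)
  ultimately show "((\<lambda>t. cflow A (- t) v $ i) has_vector_derivative
      (- cflow A (- u) (map_matrix complex_of_real A *v v)) $ i) (at u)"
    by (simp add: cflow_def matrix_vector_mult_def map_matrix_def)
qed

text \<open>Put w = (B - \<mu>) v. Then z(u) = e^(\<mu> u) y(u), with y the backward orbit of v, has
  derivative - e^(\<mu> u) times the backward orbit of w. The decay of w bounds the growth of z by a
  rate below Re \<mu>, and dividing by e^(\<mu> u) leaves decay.\<close>

lemma decays_step:
  assumes "decays A (map_matrix complex_of_real A *v v - \<mu> *s v)" and \<mu>: "Re \<mu> > 0"
  shows "decays A v"
proof -
  let ?B = "map_matrix complex_of_real A"
  let ?w = "?B *v v - \<mu> *s v"
  from assms(1) obtain C c where c: "c > 0" and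
    C: "\<And>u. u \<ge> 0 \<Longrightarrow> norm (cflow A (- u) ?w) \<le> C * exp (- c * u)"
    unfolding decays_def by blast
  have C0: "C \<ge> 0" using order_trans[OF norm_ge_zero C[of 0]] by simp
  \<comment> \<open>Strictly below both rates: Re \<mu> - d > 0 lets the comparison exponential
    grow, and d < c avoids the factor u that appears when the two rates coincide.\<close>
  define d where "d = min c (Re \<mu>) / 2"
  have d: "d > 0" "d < c" "d < Re \<mu>" using c \<mu> by (auto simp: d_def min_def)
  let ?y = "\<lambda>u. cflow A (- u) v"
  let ?z = "\<lambda>u::real. exp (\<mu> * complex_of_real u) *s ?y u"
  have w: "cflow A u ?w = cflow A u (?B *v v) - \<mu> *s cflow A u v" for u
    unfolding cflow_def by (simp add: matrix_vector_mult_diff_distrib vector_scalar_commute)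
  have z': "(?z has_vector_derivative - (exp (\<mu> * complex_of_real u) *s cflow A (- u) ?w)) (at u)" for u
  proof (rule has_vector_derivative_vecI)
    fix i
    have y: "((\<lambda>u. ?y u $ i) has_vector_derivative - cflow A (- u) (?B *v v) $ i) (at u)"
      using bounded_linear.has_vector_derivative[OF bounded_linear_vec_nth cflow_deriv] by simp
    have e: "((\<lambda>u::real. exp (\<mu> * complex_of_real u)) has_vector_derivative \<mu> * exp (\<mu> * of_real u)) (at u)"
      by (rule has_vector_derivative_real_field) (auto intro!: derivative_eq_intros)
    have "((\<lambda>u. exp (\<mu> * complex_of_real u) * ?y u $ i) has_vector_derivative
        (exp (\<mu> * of_real u) * (- cflow A (- u) (?B *v v) $ i) + \<mu> * exp (\<mu> * of_real u) * ?y u $ i)) (at u)"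
      by (rule has_vector_derivative_mult[OF e y])
    then show "((\<lambda>t. ?z t $ i) has_vector_derivative
        (- (exp (\<mu> * complex_of_real u) *s cflow A (- u) ?w)) $ i) (at u)"
      by (simp add: w algebra_simps)
  qed
  have nz: "norm (a *s (x :: complex^'b)) = norm a * norm x" for a x
    by (simp add: norm_vec_def L2_set_def norm_mult power_mult_distrib sum_distrib_left[symmetric]
        real_sqrt_mult)
  have bound: "norm (?y u) \<le> (norm (?y 0) + C / (Re \<mu> - d)) * exp (- d * u)" if u: "u \<ge> 0" for u
  proof -
    have zb: "norm (?z u - ?z 0) \<le> C / (Re \<mu> - d) * exp ((Re \<mu> - d) * u) - C / (Re \<mu> - d) * exp ((Re \<mu> - d) * 0)"
    proof (cases "u = 0")
      case False
      then have "0 < u" using u by simp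
      then show ?thesis
      proof (rule differentiable_bound_general)
        show "continuous_on {0..u} ?z"
          by (intro continuous_at_imp_continuous_on ballI)
            (use z' has_vector_derivative_continuous in blast)
        show "continuous_on {0..u} (\<lambda>u. C / (Re \<mu> - d) * exp ((Re \<mu> - d) * u))"
          by (intro continuous_intros)
        show "(?z has_vector_derivative - (exp (\<mu> * complex_of_real x) *s cflow A (- x) ?w)) (at x)" for x
          by (rule z')
        show "((\<lambda>u. C / (Re \<mu> - d) * exp ((Re \<mu> - d) * u)) has_vector_derivative
          C * exp ((Re \<mu> - d) * x)) (at x)" for x
          unfolding has_real_derivative_iff_has_vector_derivative[symmetric]
          using d by (auto intro!: derivative_eq_intros)
        show "norm (- (exp (\<mu> * complex_of_real x) *s cflow A (- x) ?w)) \<le> C * exp ((Re \<mu> - d) * x)"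
          if "0 < x" for x
        proof -
          have "norm (- (exp (\<mu> * complex_of_real x) *s cflow A (- x) ?w)) \<le>
             exp (Re \<mu> * x) * (C * exp (- c * x))"
            using C[of x] that by (simp add: nz)
          also have "\<dots> \<le> exp (Re \<mu> * x) * (C * exp (- d * x))"
            using d C0 that by (intro mult_left_mono) auto
          also have "\<dots> = C * exp ((Re \<mu> - d) * x)"
            by (simp add: algebra_simps exp_diff exp_minus divide_inverse)
          finally show ?thesis .
        qed
      qed
    qed simp
    have "exp (Re \<mu> * u) * norm (?y u) = norm (?z u)" by (simp add: nz)
    also have "\<dots> \<le> norm (?z 0) + norm (?z u - ?z 0)" by (rule norm_triangle_sub)
    also have "\<dots> \<le> norm (?y 0) * exp ((Re \<mu> - d) * u) + C / (Re \<mu> - d) * exp ((Re \<mu> - d) * u)"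
    proof (rule add_mono)
      have "norm (?y 0) * 1 \<le> norm (?y 0) * exp ((Re \<mu> - d) * u)"
        using d u by (intro mult_left_mono) auto
      then show "norm (?z 0) \<le> norm (?y 0) * exp ((Re \<mu> - d) * u)" by (simp add: nz)
      have "0 \<le> C / (Re \<mu> - d) * exp ((Re \<mu> - d) * 0)" using C0 d by simp
      then show "norm (?z u - ?z 0) \<le> C / (Re \<mu> - d) * exp ((Re \<mu> - d) * u)" using zb by linarith
    qed
    also have "\<dots> = exp (Re \<mu> * u) * ((norm (?y 0) + C / (Re \<mu> - d)) * exp (- d * u))"
      by (simp add: algebra_simps exp_diff exp_minus divide_inverse)
    finally show ?thesis by simp
  qed
  then show ?thesis unfolding decays_def using d(1) by blast
qed

section \<open>Polynomials of a matrix acting on a vector\<close>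

definition poly_apply :: "complex^'n^'n \<Rightarrow> complex poly \<Rightarrow> complex^'n \<Rightarrow> complex^'n" where
  "poly_apply B p v = (\<Sum>i\<le>degree p. coeff p i *s ((*v) B ^^ i) v)"

lemma poly_apply_0 [simp]: "poly_apply B 0 v = 0"
  by (simp add: poly_apply_def)

lemma poly_apply_pCons [simp]: "poly_apply B (pCons a p) v = a *s v + poly_apply B p (B *v v)"
proof (cases "p = 0")
  case True then show ?thesis by (simp add: poly_apply_def)
next
  case False
  then show ?thesis
    by (simp add: poly_apply_def sum.atMost_Suc_shift funpow_Suc_right
        del: funpow.simps(2) sum.atMost_Suc)
qed

lemma poly_apply_add: "poly_apply B (p + q) v = poly_apply B p v + poly_apply B q v"
  by (induction p q arbitrary: v rule: poly_induct2) (auto simp: vector_sadd_rdistrib)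

lemma poly_apply_smult: "poly_apply B (smult a p) v = a *s poly_apply B p v"
  by (induction p arbitrary: v) (auto simp: vector_add_ldistrib vector_smult_assoc)

lemma poly_apply_diff_vec: "poly_apply B p (v - w) = poly_apply B p v - poly_apply B p w"
  by (induction p arbitrary: v w)
    (auto simp: matrix_vector_mult_diff_distrib vector_ssub_ldistrib)

lemma poly_apply_scale_vec: "poly_apply B p (a *s v) = a *s poly_apply B p v"
  by (induction p arbitrary: v)
    (auto simp: vector_add_ldistrib vector_smult_assoc mult.commute vector_scalar_commute)

lemma poly_apply_commute: "B *v poly_apply B p v = poly_apply B p (B *v v)"
  by (induction p arbitrary: v)
    (auto simp: matrix_vector_right_distrib vector_scalar_commute[symmetric])

lemma poly_apply_linear_factor:
  "poly_apply B ([:- \<mu>, 1:] * q) v = poly_apply B q (B *v v - \<mu> *s v)"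
proof -
  have "poly_apply B ([:- \<mu>, 1:] * q) v = - \<mu> *s poly_apply B q v + poly_apply B q (B *v v)"
  proof -
    have "[:- \<mu>, 1:] * q = smult (- \<mu>) q + pCons 0 q" by simp
    then show ?thesis by (simp only: poly_apply_add poly_apply_smult poly_apply_pCons) simp
  qed
  then show ?thesis by (simp add: poly_apply_diff_vec poly_apply_scale_vec)
qed

text \<open>The iterates v, Bv, B^2 v, ... up to the real dimension outnumber it by one, so they
  satisfy a nontrivial relation, even with real coefficients.\<close>

lemma exists_annihilating_poly:
  fixes B :: "complex^'n^'n"
  shows "\<exists>p. p \<noteq> 0 \<and> poly_apply B p v = 0"
proof -
  let ?v = "\<lambda>i. ((*v) B ^^ i) v"
  let ?N = "DIM(complex^'n)"
  have reduce: "\<exists>p. p \<noteq> 0 \<and> poly_apply B p v = 0"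
    if "(\<Sum>i\<le>?N. of_real (c i) *s ?v i) = 0" and "i0 \<le> ?N" "c i0 \<noteq> 0" for c :: "nat \<Rightarrow> real" and i0
  proof -
    define p where "p = (\<Sum>i\<le>?N. monom (complex_of_real (c i)) i)"
    have ap: "poly_apply B (monom a i) w = a *s ((*v) B ^^ i) w" for a i w
      by (induction i arbitrary: w) (auto simp: monom_0 monom_Suc funpow_Suc_right simp del: funpow.simps(2))
    have "poly_apply B (\<Sum>i\<in>S. monom (complex_of_real (c i)) i) v = (\<Sum>i\<in>S. of_real (c i) *s ?v i)"
      if "finite S" for S using that
      by (induction S rule: finite_induct) (auto simp: poly_apply_add ap)
    then have "poly_apply B p v = 0" using that by (simp add: p_def)
    moreover have "coeff p i0 = of_real (c i0)" using that by (simp add: p_def coeff_sum)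
    ultimately show ?thesis using \<open>c i0 \<noteq> 0\<close> by (intro exI[of _ p]) auto
  qed
  \<comment> \<open>\<open>dependent\<close> refers to a set of vectors, so repeated iterates need a
    case of their own; there the polynomial is x^i - x^j.\<close>
  show ?thesis
  proof (cases "inj_on ?v {..?N}")
    case False
    then obtain i j where ij: "i \<le> ?N" "j \<le> ?N" "i \<noteq> j" "?v i = ?v j" by (auto simp: inj_on_def)
    show ?thesis
    proof (rule reduce[of "\<lambda>k. if k = i then 1 else if k = j then - 1 else 0" i])
      have "(\<Sum>k\<le>?N. of_real (if k = i then 1 else if k = j then - 1 else 0) *s ?v k)
          = (\<Sum>k\<le>?N. (if k = i then ?v i else 0) - (if k = j then ?v j else 0))"
        using ij by (intro sum.cong) (auto simp: vector_sneg_minus1[symmetric])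
      then show "(\<Sum>k\<le>?N. of_real (if k = i then 1 else if k = j then - 1 else 0) *s ?v k) = 0"
        using ij by (simp add: sum_subtractf)
    qed (use ij in auto)
  next
    case True
    have "dependent (?v ` {..?N})"
      by (rule dependent_biggerset, subst card_image[OF True]) simp
    then obtain u x where ux: "x \<in> ?v ` {..?N}" "u x \<noteq> 0" "(\<Sum>x\<in>?v ` {..?N}. u x *\<^sub>R x) = 0"
      by (auto simp: dependent_finite)
    then obtain i0 where "i0 \<le> ?N" "u (?v i0) \<noteq> 0" by auto
    moreover have "(\<Sum>i\<le>?N. of_real (u (?v i)) *s ?v i) = 0"
    proof -
      have sc: "complex_of_real a *s w = a *\<^sub>R w" for a and w :: "complex^'n"
        by (simp add: vec_eq_iff del: of_real_eq_iff) (simp add: scaleR_conv_of_real)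
      show ?thesis using ux(3) unfolding sc sum.reindex[OF True] o_def .
    qed
    ultimately show ?thesis by (intro reduce[of "\<lambda>i. u (?v i)"])
  qed
qed

text \<open>Induction on the degree of an annihilating polynomial with root \<mu>. If \<mu> is an
  eigenvalue, its real part is positive and \<open>decays_step\<close> lifts decay from (B - \<mu>)
  v to v. If not, B - \<mu> is injective and the factor can be cancelled. This takes the place of
  the Jordan form.\<close>

lemma M_plus_decays:
  fixes A :: "real^'n^'n"
  assumes "A \<in> M_plus"
  shows "decays A v"
proof -
  let ?B = "map_matrix complex_of_real A"
  have "decays A v" if "poly_apply ?B p v = 0" "p \<noteq> 0" for p v
    using that
  proof (induction "degree p" arbitrary: p v)
    case 0
    then obtain a where "p = [:a:]" "a \<noteq> 0" by (metis degree_0_id pCons_eq_0_iff coeff_pCons_0 degree_eq_zeroE)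
    then have "v = 0" using 0 by (simp add: vector_mul_eq_0)
    then show ?case by (auto simp: decays_def cflow_def intro!: exI[of _ 0] exI[of _ 1])
  next
    case (Suc n)
    then have "\<not> constant (poly p)" by (simp add: constant_degree)
    then obtain \<mu> where "poly p \<mu> = 0" using Fundamental_Theorem_Algebra.fundamental_theorem_of_algebra by blast
    then obtain q where p: "p = [:- \<mu>, 1:] * q" by (auto simp: poly_eq_0_iff_dvd)
    have q: "q \<noteq> 0" using p Suc by auto
    have "degree p = Suc (degree q)" using q by (simp add: p degree_mult_eq del: mult_pCons_left)
    then have n: "n = degree q" using Suc by simp
    have eq: "poly_apply ?B q (?B *v v - \<mu> *s v) = 0"
      using Suc(3) by (simp only: p poly_apply_linear_factor)
    show ?case
    proof (cases "complex_eigenvalue A \<mu>")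
      case True
      then have "Re \<mu> > 0" using assms by (auto simp: M_plus_def)
      then show ?thesis using Suc(1)[OF n eq q] by (rule decays_step[rotated])
    next
      case False
      have "?B *v poly_apply ?B q v = \<mu> *s poly_apply ?B q v"
        using eq by (simp add: poly_apply_diff_vec poly_apply_scale_vec poly_apply_commute)
      then have "poly_apply ?B q v = 0" using False by (auto simp: complex_eigenvalue_def)
      then show ?thesis using Suc(1)[OF n _ q] by blast
    qed
  qed
  then show ?thesis using exists_annihilating_poly by blast
qed

lemma flow_decay_entries:
  fixes A :: "real^'n^'n"
  assumes "A \<in> M_plus"
  shows "\<exists>C c. c > 0 \<and> (\<forall>u\<ge>0. \<forall>i j. \<bar>flow A (- u) $ i $ j\<bar> \<le> C * exp (- c * u))"
proof -
  have "\<forall>j. \<exists>C c. c > 0 \<and> (\<forall>u\<ge>0. norm (cflow A (- u) (axis j 1)) \<le> C * exp (- c * u))"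
    using M_plus_decays[OF assms] unfolding decays_def by blast
  then obtain C c where c: "\<And>j. c j > 0" and
    C: "\<And>j u. u \<ge> 0 \<Longrightarrow> norm (cflow A (- u) (axis j 1)) \<le> C j * exp (- c j * u)"
    by metis
  have entry: "\<bar>flow A (- u) $ i $ j\<bar> \<le> C j * exp (- c j * u)" if "u \<ge> 0" for u i j
  proof -
    have "cflow A (- u) (axis j 1) $ i = complex_of_real (flow A (- u) $ i $ j)"
      by (simp add: cflow_def matrix_vector_mult_def map_matrix_def axis_def if_distrib cong: if_cong)
    then have "\<bar>flow A (- u) $ i $ j\<bar> = norm (cflow A (- u) (axis j 1) $ i)" by simp
    also have "\<dots> \<le> norm (cflow A (- u) (axis j 1))" by (rule Finite_Cartesian_Product.norm_nth_le)
    finally show ?thesis using C[OF that, of j] by linarith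
  qed
  have C0: "C j \<ge> 0" for j using order_trans[OF norm_ge_zero C[of 0 j]] by simp
  define m where "m = Min (range c)"
  let ?C = "\<Sum>j\<in>UNIV. C j"
  have "\<bar>flow A (- u) $ i $ j\<bar> \<le> ?C * exp (- m * u)" if "u \<ge> 0" for u i j
  proof -
    have "m * u \<le> c j * u" using that unfolding m_def by (intro mult_right_mono Min_le) auto
    then have "C j * exp (- c j * u) \<le> ?C * exp (- m * u)"
      using C0 by (intro mult_mono member_le_sum sum_nonneg) auto
    then show ?thesis using entry[OF that, of i j] by linarith
  qed
  moreover have "m > 0" using c by (simp add: m_def)
  ultimately show ?thesis by blast
qed

lemma flow_decay:
  fixes A :: "real^'n^'n"
  assumes "A \<in> M_plus"
  obtains C c where "C > 0" "c > 0" "\<And>u x. u \<ge> 0 \<Longrightarrow> norm (flow A (- u) *v x) \<le> C * exp (- c * u) * norm x"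
proof -
  obtain C c where c: "c > 0" and C: "\<And>u i j. u \<ge> 0 \<Longrightarrow> \<bar>flow A (- u) $ i $ j\<bar> \<le> C * exp (- c * u)"
    using flow_decay_entries[OF assms] by blast
  let ?C = "real CARD('n) ^ 2 * \<bar>C\<bar> + 1"
  have "norm (flow A (- u) *v x) \<le> ?C * exp (- c * u) * norm x" if "u \<ge> 0" for u x
  proof -
    have "norm (flow A (- u) *v x) \<le> (\<Sum>i\<in>UNIV. \<Sum>j\<in>UNIV. \<bar>flow A (- u) $ i $ j\<bar>) * norm x"
      by (rule norm_matrix_vector_le)
    also have "\<dots> \<le> (\<Sum>i\<in>(UNIV::'n set). \<Sum>j\<in>(UNIV::'n set). \<bar>C\<bar> * exp (- c * u)) * norm x"
      by (intro mult_right_mono sum_mono order_trans[OF C[OF that]]) auto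
    also have "\<dots> = (real CARD('n) ^ 2 * \<bar>C\<bar>) * exp (- c * u) * norm x"
      by (simp add: power2_eq_square)
    also have "\<dots> \<le> ?C * exp (- c * u) * norm x" by (intro mult_right_mono) auto
    finally show ?thesis .
  qed
  moreover have "?C > 0" by (smt (verit) abs_ge_zero mult_nonneg_nonneg zero_le_power of_nat_0_le_iff)
  ultimately show ?thesis using c that by blast
qed

text \<open>The entries of the backward flow tend to 0, hence so does its determinant e^(- u trace
  A); a trace \<le> 0 would keep it at least 1.\<close>

lemma trace_pos:
  fixes A :: "real^'n^'n"
  assumes "A \<in> M_plus"
  shows "trace A > 0"
proof (rule ccontr)
  assume tr: "\<not> trace A > 0"
  obtain C c where c: "c > 0" and C: "\<And>u i j. u \<ge> 0 \<Longrightarrow> \<bar>flow A (- u) $ i $ j\<bar> \<le> C * exp (- c * u)"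
    using flow_decay_entries[OF assms] by blast
  have lim: "((\<lambda>u. C * exp (- c * u)) \<longlongrightarrow> C * 0) at_top"
    using c by (intro tendsto_mult tendsto_const filterlim_compose[OF exp_at_bot])
      (simp add: filterlim_uminus_at_top[symmetric]
        filterlim_tendsto_pos_mult_at_top[OF tendsto_const _ filterlim_ident])
  have "((\<lambda>u. flow A (- u) $ i $ j) \<longlongrightarrow> 0) at_top" for i j
  proof (rule Lim_null_comparison)
    show "\<forall>\<^sub>F u in at_top. norm (flow A (- u) $ i $ j) \<le> C * exp (- c * u)"
      using C by (intro eventually_mono[OF eventually_ge_at_top[of 0]]) auto
  qed (use lim in simp)
  then have "((\<lambda>u. flow A (- u)) \<longlongrightarrow> 0) at_top"
    by (auto intro!: vec_tendstoI)
  moreover have "continuous_on UNIV (det :: real^'n^'n \<Rightarrow> real)"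
    unfolding det_def by (intro continuous_intros)
  ultimately have "((\<lambda>u. det (flow A (- u))) \<longlongrightarrow> det (0 :: real^'n^'n)) at_top"
    by (auto simp: continuous_on_eq_continuous_at intro: isCont_tendsto_compose)
  moreover have "det (0 :: real^'n^'n) = 0"
    by (rule det_zero_row) (simp add: row_def vec_eq_iff)
  moreover have "\<forall>\<^sub>F u in at_top. det (flow A (- u)) \<ge> 1"
    using tr by (intro eventually_mono[OF eventually_ge_at_top[of 0]])
      (auto simp: det_flow mult_nonneg_nonpos)
  ultimately have "(0::real) \<ge> 1" by (metis tendsto_lowerbound trivial_limit_at_top_linorder)
  then show False by simp
qed

text \<open>Lyapunov's integral of F^T F, with F = flow A (- v), taken over a finite time only. The
  derivative of x . P0 x along the flow integrates to |x|^2 - |F_T x|^2, which is positive once F_T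
  halves norms.\<close>

lemma lyapunov_form:
  fixes A :: "real^'n^'n"
  assumes "A \<in> M_plus"
  shows "\<exists>P :: real^'n^'n. (\<forall>x. (norm x)\<^sup>2 \<le> x \<bullet> (P *v x)) \<and>
    (\<forall>x. x \<noteq> 0 \<longrightarrow> (A *v x) \<bullet> (P *v x) + x \<bullet> (P *v (A *v x)) > 0)"
proof -
  obtain C c where C: "C > 0" and c: "c > 0" and
    decay: "\<And>u x. u \<ge> 0 \<Longrightarrow> norm (flow A (- u) *v x) \<le> C * exp (- c * u) * norm x"
    using flow_decay[OF assms] by blast
  \<comment> \<open>Chosen so that C e^(- c T) \<le> 1/2; the maximum with 1 keeps T positive when C
    is small.\<close>
  define T where "T = max 1 (ln (2 * C) / c)"
  have T: "T > 0" by (simp add: T_def)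
  have "C * exp (- c * T) \<le> 1 / 2"
  proof -
    have "ln (2 * C) \<le> c * T" using c by (simp add: T_def max_def field_simps)
    then have "exp (ln (2 * C)) \<le> exp (c * T)" by simp
    then have "2 * C \<le> exp (c * T)" using C by simp
    then show ?thesis by (simp add: exp_minus field_simps)
  qed
  then have half: "norm (flow A (- T) *v x) \<le> 1 / 2 * norm x" for x
    using T by (intro order_trans[OF decay[of T x] mult_right_mono]) auto
  let ?F = "\<lambda>v. flow A (- v)"
  have contF: "continuous_on S ?F" for S
    by (rule continuous_on_compose2[OF flow_continuous[of UNIV]]) (auto intro!: continuous_intros)
  have contFx: "continuous_on S (\<lambda>v. ?F v *v x)" for S x
    by (rule bounded_bilinear.continuous_on[OF bounded_bilinear_matrix_vector_mult contF continuous_on_const])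
  define P0 where "P0 = integral {0..T} (\<lambda>v. transpose (?F v) ** ?F v)"
  have tr: "bounded_linear (transpose :: real^'n^'n \<Rightarrow> _)"
    by (auto simp: linear_conv_bounded_linear[symmetric] transpose_def vec_eq_iff intro!: linearI)
  have P0: "x \<bullet> (P0 *v y) = integral {0..T} (\<lambda>v. (?F v *v x) \<bullet> (?F v *v y))" for x y
  proof -
    have "bounded_linear (\<lambda>M::real^'n^'n. x \<bullet> (M *v y))"
      by (rule bounded_linear_inner_right_comp)
        (rule bounded_bilinear.bounded_linear_left[OF bounded_bilinear_matrix_vector_mult])
    moreover have "(\<lambda>v. transpose (?F v) ** ?F v) integrable_on {0..T}"
      by (intro integrable_continuous_interval
          bounded_bilinear.continuous_on[OF bounded_bilinear_matrix_matrix_mult] contF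
          bounded_linear.continuous_on[OF tr])
    ultimately have "integral {0..T} ((\<lambda>M. x \<bullet> (M *v y)) \<circ> (\<lambda>v. transpose (?F v) ** ?F v)) = x \<bullet> (P0 *v y)"
      unfolding P0_def by (intro integral_linear)
    moreover have "x \<bullet> ((transpose M ** M) *v y) = (M *v x) \<bullet> (M *v y)" for M :: "real^'n^'n"
      by (metis dot_lmul_matrix matrix_vector_mul_assoc vector_transpose_matrix transpose_transpose)
    ultimately show ?thesis by (simp add: o_def)
  qed
  have int: "(\<lambda>v. (?F v *v x) \<bullet> (?F v *v y)) integrable_on {0..T}" for x y
    by (intro integrable_continuous_interval continuous_intros contFx)
  \<comment> \<open>D bounds the norm of \<open>flow A v\<close> for 0 \<le> v \<le> T, hence |x| /
    D \<le> |F_v x|.\<close>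
  define D where "D = real CARD('n) ^ 2 * exp (entry_bound A * T)"
  have D: "D > 0" by (simp add: D_def)
  have lower: "T * ((norm x)\<^sup>2 / D\<^sup>2) \<le> x \<bullet> (P0 *v x)" for x
  proof -
    have "(norm x)\<^sup>2 / D\<^sup>2 \<le> (?F v *v x) \<bullet> (?F v *v x)" if "v \<in> {0..T}" for v
    proof -
      have "norm x = norm (flow A v *v (?F v *v x))" by (simp add: flow_add_vec)
      also have "\<dots> \<le> real CARD('n) ^ 2 * exp (entry_bound A * \<bar>v\<bar>) * norm (?F v *v x)"
        by (rule norm_flow_vector_le)
      also have "\<dots> \<le> D * norm (?F v *v x)" unfolding D_def
        using that by (intro mult_right_mono mult_left_mono) (auto intro: mult_left_mono entry_bound_nonneg)
      finally have "norm x / D \<le> norm (?F v *v x)" using D by (simp add: field_simps)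
      then have "(norm x / D)\<^sup>2 \<le> (norm (?F v *v x))\<^sup>2"
        using D by (intro power_mono) auto
      then show ?thesis by (simp add: power_divide power2_norm_eq_inner)
    qed
    then have "integral {0..T} (\<lambda>v. (norm x)\<^sup>2 / D\<^sup>2) \<le> integral {0..T} (\<lambda>v. (?F v *v x) \<bullet> (?F v *v x))"
      by (intro integral_le int integrable_const_ivl) auto
    then show ?thesis using T by (simp add: P0)
  qed
  have deriv: "(A *v x) \<bullet> (P0 *v x) + x \<bullet> (P0 *v (A *v x)) = (norm x)\<^sup>2 - (norm (?F T *v x))\<^sup>2" for x
  proof -
    have "((\<lambda>v. (?F v *v x) \<bullet> (?F v *v x)) has_vector_derivative
       - ((?F v *v (A *v x)) \<bullet> (?F v *v x) + (?F v *v x) \<bullet> (?F v *v (A *v x)))) (at v within S)" for v S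
    proof -
      have "((\<lambda>v. ?F v *v x) has_vector_derivative - (?F v *v (A *v x))) (at v within S)"
      proof -
        have "((\<lambda>v. flow A v *v x) \<circ> uminus has_vector_derivative (- 1) *\<^sub>R (A *v (?F v *v x))) (at v)"
          by (rule vector_diff_chain_at[OF _ flow_has_vector_derivative_vec])
            (rule has_vector_derivative_minus[OF has_vector_derivative_id])
        moreover have "A *v (?F v *v x) = ?F v *v (A *v x)"
          by (simp add: matrix_vector_mul_assoc flow_commute)
        ultimately show ?thesis by (simp add: o_def has_vector_derivative_at_within)
      qed
      from bounded_bilinear.has_vector_derivative[OF bounded_bilinear_inner this this]
      show ?thesis by (simp add: add.commute)
    qed
    from fundamental_theorem_of_calculus[OF _ this, of 0 T]
    have "((\<lambda>v. - ((?F v *v (A *v x)) \<bullet> (?F v *v x) + (?F v *v x) \<bullet> (?F v *v (A *v x)))) has_integral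
       (norm (?F T *v x))\<^sup>2 - (norm x)\<^sup>2) {0..T}" using T by (simp add: power2_norm_eq_inner)
    from has_integral_neg[OF this]
    have "integral {0..T} (\<lambda>v. (?F v *v (A *v x)) \<bullet> (?F v *v x) + (?F v *v x) \<bullet> (?F v *v (A *v x)))
       = (norm x)\<^sup>2 - (norm (?F T *v x))\<^sup>2"
      by (simp only: minus_minus minus_diff_eq integral_unique)
    then show ?thesis by (simp add: P0 integral_add[OF int int])
  qed
  have pos: "(A *v x) \<bullet> (P0 *v x) + x \<bullet> (P0 *v (A *v x)) > 0" if "x \<noteq> 0" for x
  proof -
    have "norm x > 0" using that by simp
    then have "norm (?F T *v x) < norm x" using half[of x] by linarith
    then show ?thesis unfolding deriv by (simp add: power_strict_mono)
  qed
  \<comment> \<open>This factor turns the constant in \<open>lower\<close> into 1. The ellipsoid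
    then lies in the unit ball, and nonzero lattice points lie on or outside the ellipsoid.\<close>
  let ?k = "D\<^sup>2 / T"
  have k: "?k > 0" using D T by simp
  have scale: "(?k *\<^sub>R P0) *v x = ?k *\<^sub>R (P0 *v x)" for x
    by (simp add: scaleR_matrix_vector_assoc)
  have 1: "(norm x)\<^sup>2 \<le> x \<bullet> ((?k *\<^sub>R P0) *v x)" for x
    using lower[of x] D T unfolding scale by (simp add: field_simps)
  have 2: "(A *v x) \<bullet> ((?k *\<^sub>R P0) *v x) + x \<bullet> ((?k *\<^sub>R P0) *v (A *v x)) > 0" if "x \<noteq> 0" for x
    using mult_pos_pos[OF k pos[OF that]] unfolding scale by (simp add: distrib_left)
  show ?thesis using 1 2 by blast
qed

section \<open>Calculus of functions of class C^k\<close>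

lemma Ck_on_cong:
  assumes "open U" "\<And>x. x \<in> U \<Longrightarrow> f x = g x" "Ck_on k f U"
  shows "Ck_on k g U"
  using assms(2,3)
proof (induction k arbitrary: f g)
  case 0 then show ?case by (simp cong: continuous_on_cong)
next
  case (Suc k)
  have d: "(g has_derivative frechet_derivative f (at x)) (at x)" if "x \<in> U" for x
  proof -
    have "(f has_derivative frechet_derivative f (at x)) (at x)"
      using Suc.prems(2) that by (simp add: frechet_derivative_works)
    then show ?thesis
      by (rule has_derivative_transform_within_open[OF _ \<open>open U\<close> that]) (use Suc in auto)
  qed
  then have eq: "frechet_derivative f (at x) v = frechet_derivative g (at x) v" if "x \<in> U" for x v
    using that frechet_derivative_at by metis
  have "Ck_on k (\<lambda>x. frechet_derivative g (at x) v) U" for v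
    by (rule Suc.IH[of "\<lambda>x. frechet_derivative f (at x) v"]) (use eq Suc.prems in auto)
  then show ?case using d by (auto simp: differentiable_def)
qed

lemma Ck_on_SucI:
  assumes "open U" "\<And>x. x \<in> U \<Longrightarrow> (f has_derivative f' x) (at x)"
    "\<And>v. Ck_on k (\<lambda>x. f' x v) U"
  shows "Ck_on (Suc k) f U"
proof -
  have "Ck_on k (\<lambda>x. frechet_derivative f (at x) v) U" for v
  proof (rule Ck_on_cong[OF assms(1) _ assms(3)[of v]])
    fix x assume "x \<in> U"
    then show "f' x v = frechet_derivative f (at x) v"
      using frechet_derivative_at[OF assms(2)] by auto
  qed
  then show ?thesis using assms(2) by (auto simp: differentiable_def)
qed

lemma Ck_on_Suc_has_derivative:
  "Ck_on (Suc k) f U \<Longrightarrow> x \<in> U \<Longrightarrow> (f has_derivative frechet_derivative f (at x)) (at x)"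
  by (simp add: frechet_derivative_works)

lemma Ck_on_imp_continuous_on: "Ck_on k f U \<Longrightarrow> continuous_on U f"
  by (cases k) (auto intro!: continuous_at_imp_continuous_on differentiable_imp_continuous_within)

lemma Ck_on_SucD: "Ck_on (Suc k) f U \<Longrightarrow> Ck_on k f U"
proof (induction k arbitrary: f)
  case 0 then show ?case using Ck_on_imp_continuous_on by (simp only: Ck_on.simps(1)) blast
next
  case (Suc k) then show ?case by (metis Ck_on.simps(2))
qed

lemma Ck_on_le: "Ck_on k f U \<Longrightarrow> j \<le> k \<Longrightarrow> Ck_on j f U"
proof (induction k)
  case (Suc k) then show ?case using Ck_on_SucD le_Suc_eq by metis
qed simp

lemma Ck_on_subset: "Ck_on k f U \<Longrightarrow> V \<subseteq> U \<Longrightarrow> Ck_on k f V"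
  by (induction k arbitrary: f) (auto intro: continuous_on_subset)

lemma Ck_on_Un: "open U \<Longrightarrow> open V \<Longrightarrow> Ck_on k f U \<Longrightarrow> Ck_on k f V \<Longrightarrow> Ck_on k f (U \<union> V)"
  by (induction k arbitrary: f) (auto intro: continuous_on_open_Un)

lemma Ck_on_const: "Ck_on k (\<lambda>x. c) U"
  by (induction k arbitrary: c) auto

lemma Ck_on_bounded_linear:
  assumes "bounded_linear f"
  shows "Ck_on k f U"
proof (cases k)
  case 0 then show ?thesis using assms by (simp add: linear_continuous_on)
next
  case (Suc j)
  then show ?thesis
    using assms bounded_linear_imp_differentiable
    by (auto simp: frechet_derivative_at[OF bounded_linear_imp_has_derivative, symmetric] Ck_on_const)
qed

lemma Ck_on_add:
  assumes "open U" "Ck_on k f U" "Ck_on k g U"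
  shows "Ck_on k (\<lambda>x. f x + g x) U"
  using assms(2,3)
proof (induction k arbitrary: f g)
  case 0 then show ?case by (auto intro: continuous_intros)
next
  case (Suc k)
  show ?case
  proof (rule Ck_on_SucI[OF assms(1)])
    show "((\<lambda>x. f x + g x) has_derivative (\<lambda>v. frechet_derivative f (at x) v
        + frechet_derivative g (at x) v)) (at x)" if "x \<in> U" for x
      by (rule has_derivative_add[OF Ck_on_Suc_has_derivative[OF Suc.prems(1) that]
            Ck_on_Suc_has_derivative[OF Suc.prems(2) that]])
    show "Ck_on k (\<lambda>x. frechet_derivative f (at x) v + frechet_derivative g (at x) v) U" for v
      by (rule Suc.IH) (use Suc.prems in auto)
  qed
qed

lemma Ck_on_mult:
  assumes "open U" "Ck_on k f U" "Ck_on k g U"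
  shows "Ck_on k (\<lambda>x. f x * g x) U"
  using assms(2,3)
proof (induction k arbitrary: f g)
  case 0 then show ?case by (auto intro: continuous_intros)
next
  case (Suc k)
  have fg: "Ck_on k f U" "Ck_on k g U" using Suc.prems Ck_on_SucD by blast+
  show ?case
  proof (rule Ck_on_SucI[OF assms(1)])
    show "((\<lambda>x. f x * g x) has_derivative (\<lambda>v. f x * frechet_derivative g (at x) v
        + frechet_derivative f (at x) v * g x)) (at x)" if "x \<in> U" for x
      by (rule has_derivative_mult[OF Ck_on_Suc_has_derivative[OF Suc.prems(1) that]
            Ck_on_Suc_has_derivative[OF Suc.prems(2) that]])
    show "Ck_on k (\<lambda>x. f x * frechet_derivative g (at x) v + frechet_derivative f (at x) v * g x) U" for v
      by (intro Ck_on_add assms(1) Suc.IH fg) (use Suc.prems in auto)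
  qed
qed

lemma Ck_on_cmult: "open U \<Longrightarrow> Ck_on k f U \<Longrightarrow> Ck_on k (\<lambda>x. c * f x) U"
  by (intro Ck_on_mult Ck_on_const)

lemma Ck_on_minus: "open U \<Longrightarrow> Ck_on k f U \<Longrightarrow> Ck_on k (\<lambda>x. - f x) U"
  using Ck_on_cmult[of U k f "-1"] by simp

lemma Ck_on_diff: "open U \<Longrightarrow> Ck_on k f U \<Longrightarrow> Ck_on k g U \<Longrightarrow> Ck_on k (\<lambda>x. f x - g x) U"
  using Ck_on_add[of U k f "\<lambda>x. - g x"] Ck_on_minus[of U k g] by simp

lemma Ck_on_sum: "open U \<Longrightarrow> (\<And>i. i \<in> I \<Longrightarrow> Ck_on k (f i) U) \<Longrightarrow> Ck_on k (\<lambda>x. \<Sum>i\<in>I. f i x) U"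
  by (induction I rule: infinite_finite_induct) (auto intro: Ck_on_const Ck_on_add)

lemma Ck_on_prod: "open U \<Longrightarrow> (\<And>i. i \<in> I \<Longrightarrow> Ck_on k (f i) U) \<Longrightarrow> Ck_on k (\<lambda>x. \<Prod>i\<in>I. f i x) U"
  by (induction I rule: infinite_finite_induct) (auto intro: Ck_on_const Ck_on_mult)

lemma Ck_on_power: "open U \<Longrightarrow> Ck_on k f U \<Longrightarrow> Ck_on k (\<lambda>x. f x ^ m) U"
  by (induction m) (auto intro: Ck_on_const Ck_on_mult)

text \<open>With a function of one real variable outside, the chain rule is a product of f' and h' o
  f. The induction keeps f and generalises over h, since h' is again composed with f.\<close>

lemma Ck_on_compose:
  assumes "open U" "open T" "Ck_on k f U" "Ck_on k h T" "f ` U \<subseteq> T"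
  shows "Ck_on k (\<lambda>x. h (f x)) U"
  using assms(3-5)
proof (induction k arbitrary: h)
  case 0 then show ?case by (auto intro: continuous_on_compose2)
next
  case (Suc k)
  let ?h' = "\<lambda>y. frechet_derivative h (at y) 1"
  have lin: "frechet_derivative h (at y) v = v * ?h' y" if "y \<in> T" for y v
  proof -
    have "linear (frechet_derivative h (at y))"
      using Suc.prems that by (simp add: linear_frechet_derivative)
    from linear_scale[OF this, of v 1] show ?thesis by simp
  qed
  have "((\<lambda>x. h (f x)) has_derivative (\<lambda>v. frechet_derivative f (at x) v * ?h' (f x))) (at x)"
    if "x \<in> U" for x
  proof -
    have "f x \<in> T" using Suc.prems that by auto
    have "((\<lambda>x. h (f x)) has_derivative
        (\<lambda>v. frechet_derivative h (at (f x)) (frechet_derivative f (at x) v))) (at x)"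
      by (intro has_derivative_compose[OF Ck_on_Suc_has_derivative[OF Suc.prems(1) that]
          Ck_on_Suc_has_derivative[OF Suc.prems(2)]] \<open>f x \<in> T\<close>)
    moreover have "(\<lambda>v. frechet_derivative h (at (f x)) (frechet_derivative f (at x) v))
        = (\<lambda>v. frechet_derivative f (at x) v * ?h' (f x))"
      by (rule ext) (rule lin[OF \<open>f x \<in> T\<close>])
    ultimately show ?thesis by simp
  qed
  moreover have "Ck_on k (\<lambda>x. frechet_derivative f (at x) v * ?h' (f x)) U" for v
  proof (rule Ck_on_mult[OF assms(1)])
    show "Ck_on k (\<lambda>x. frechet_derivative f (at x) v) U" using Suc.prems(1) by simp
    have "Ck_on k ?h' T" using Suc.prems(2) by simp
    then show "Ck_on k (\<lambda>x. ?h' (f x)) U"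
      by (rule Suc.IH[OF Ck_on_SucD[OF Suc.prems(1)] _ Suc.prems(3)])
  qed
  ultimately show ?case by (rule Ck_on_SucI[OF assms(1)])
qed

lemma Ck_on_compose_linear:
  assumes "open U" "bounded_linear l" "Ck_on k f V" "l ` U \<subseteq> V"
  shows "Ck_on k (\<lambda>x. f (l x)) U"
  using assms(3)
proof (induction k arbitrary: f)
  case 0 then show ?case using assms(4)
    by (auto intro: continuous_on_compose2[OF _ linear_continuous_on[OF assms(2)]])
next
  case (Suc k)
  show ?case
  proof (rule Ck_on_SucI[OF assms(1)])
    show "((\<lambda>x. f (l x)) has_derivative (\<lambda>v. frechet_derivative f (at (l x)) (l v))) (at x)"
      if "x \<in> U" for x
      by (rule has_derivative_compose[OF bounded_linear_imp_has_derivative[OF assms(2)]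
            Ck_on_Suc_has_derivative[OF Suc.prems]]) (use assms(4) that in auto)
    show "Ck_on k (\<lambda>x. frechet_derivative f (at (l x)) (l v)) U" for v
      by (rule Suc.IH) (use Suc.prems in auto)
  qed
qed

lemma Ck_on_real_SucI:
  fixes f :: "real \<Rightarrow> real"
  assumes "open U" "\<And>x. x \<in> U \<Longrightarrow> (f has_real_derivative f' x) (at x)" "Ck_on k f' U"
  shows "Ck_on (Suc k) f U"
proof (rule Ck_on_SucI[OF assms(1)])
  show "(f has_derivative (\<lambda>v. f' x * v)) (at x)" if "x \<in> U" for x
    using assms(2)[OF that] by (simp add: has_field_derivative_def)
  show "Ck_on k (\<lambda>x. f' x * v) U" for v by (intro Ck_on_mult assms Ck_on_const)
qed

lemma Ck_on_ident: "Ck_on k (\<lambda>x::real. x) U"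
  by (rule Ck_on_bounded_linear) (rule bounded_linear_ident)

lemma Ck_on_exp: "Ck_on k (exp :: real \<Rightarrow> real) UNIV"
  by (induction k) (auto intro!: Ck_on_real_SucI[of UNIV] continuous_intros DERIV_exp simp del: Ck_on.simps(2))

lemma Ck_on_inverse: "Ck_on k (inverse :: real \<Rightarrow> real) {x. x \<noteq> 0}"
proof (induction k)
  case 0 then show ?case by (auto intro!: continuous_intros)
next
  case (Suc k)
  have o: "open {x::real. x \<noteq> 0}" by (rule open_Collect_neq) auto
  show ?case
    by (rule Ck_on_real_SucI[OF o DERIV_inverse]) (auto intro!: Ck_on_minus Ck_on_mult Ck_on_power o Suc)
qed

lemma Ck_on_ln: "Ck_on k (ln :: real \<Rightarrow> real) {0<..}"
proof (cases k)
  case 0 then show ?thesis by (auto intro!: continuous_intros)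
next
  case (Suc j)
  have "Ck_on j (inverse :: real \<Rightarrow> real) {0<..}"
    by (rule Ck_on_subset[OF Ck_on_inverse]) auto
  then show ?thesis unfolding Suc
    by (intro Ck_on_real_SucI[of _ ln inverse]) (auto intro!: derivative_eq_intros simp: inverse_eq_divide)
qed

lemma Ck_on_sin_cos: "Ck_on k (sin :: real \<Rightarrow> real) UNIV \<and> Ck_on k (cos :: real \<Rightarrow> real) UNIV"
proof (induction k)
  case 0 then show ?case by (auto intro!: continuous_intros)
next
  case (Suc k)
  then show ?case
    by (auto intro!: Ck_on_real_SucI[of UNIV] DERIV_sin DERIV_cos Ck_on_minus simp del: Ck_on.simps)
qed

text \<open>The cut-off \<open>bump k\<close> is only of class \<open>C\<^sup>k\<close>; its integer translates add up to \<open>1\<close> by telescoping.\<close>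

definition smooth_step :: "nat \<Rightarrow> real \<Rightarrow> real" where
  "smooth_step k x = max 0 x ^ Suc k / (max 0 x ^ Suc k + max 0 (1 - x) ^ Suc k)"

definition bump :: "nat \<Rightarrow> real \<Rightarrow> real" where
  "bump k x = smooth_step k (x + 1) - smooth_step k x"

text \<open>At the corner 0 the exponent is at least 2, so the difference quotient is bounded by
  |h|^(k+1) and tends to 0.\<close>

lemma pos_part_power_deriv:
  fixes x :: real
  shows "((\<lambda>x. max 0 x ^ Suc (Suc k)) has_real_derivative real (Suc (Suc k)) * max 0 x ^ Suc k) (at x)"
proof -
  consider "x < 0" | "x = 0" | "x > 0" by linarith
  then show ?thesis
  proof cases
    case 1
    have "((\<lambda>x::real. 0) has_real_derivative real (Suc (Suc k)) * max 0 x ^ Suc k) (at x)" using 1 by simp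
    then show ?thesis by (rule has_field_derivative_transform_within_open[of _ _ _ "{..<0}"])
      (use 1 in auto)
  next
    case 2
    have "((\<lambda>h. max 0 h ^ Suc (Suc k) / h) \<longlongrightarrow> 0) (at (0::real))"
    proof (rule Lim_null_comparison)
      show "\<forall>\<^sub>F h in at (0::real). norm (max 0 h ^ Suc (Suc k) / h) \<le> \<bar>h\<bar> ^ Suc k"
      proof (intro always_eventually allI)
        fix h :: real
        show "norm (max 0 h ^ Suc (Suc k) / h) \<le> \<bar>h\<bar> ^ Suc k"
          by (cases "h > 0") (auto simp: max_def intro!: mult_nonpos_nonneg)
      qed
      have "((\<lambda>h::real. \<bar>h\<bar> ^ Suc k) \<longlongrightarrow> \<bar>0\<bar> ^ Suc k) (at 0)" by (intro tendsto_intros)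
      then show "((\<lambda>h::real. \<bar>h\<bar> ^ Suc k) \<longlongrightarrow> 0) (at 0)" by simp
    qed
    then show ?thesis using 2 by (simp add: DERIV_def)
  next
    case 3
    have "((\<lambda>x::real. x ^ Suc (Suc k)) has_real_derivative real (Suc (Suc k)) * max 0 x ^ Suc k) (at x)"
      using DERIV_pow[of "Suc (Suc k)" x UNIV] 3 by (simp del: power_Suc of_nat_Suc)
    then show ?thesis by (rule has_field_derivative_transform_within_open[of _ _ _ "{0<..}"])
      (use 3 in auto)
  qed
qed

lemma Ck_on_pos_part_power: "Ck_on k (\<lambda>x::real. max 0 x ^ Suc k) UNIV"
proof (induction k)
  case 0 then show ?case by (auto intro!: continuous_intros)
next
  case (Suc k)
  show ?case
    by (rule Ck_on_real_SucI[OF open_UNIV pos_part_power_deriv]) (intro Ck_on_cmult open_UNIV Suc)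
qed

lemma smooth_step_denominator_pos: "max 0 x ^ Suc k + max 0 (1 - x) ^ Suc k > (0::real)"
proof (cases "x > 0")
  case True then show ?thesis by (intro add_pos_nonneg) auto
next
  case False then show ?thesis by (intro add_nonneg_pos) auto
qed

lemma Ck_on_smooth_step: "Ck_on k (smooth_step k) UNIV"
proof -
  have a: "Ck_on k (\<lambda>x::real. max 0 (1 - x) ^ Suc k) UNIV"
    by (rule Ck_on_compose[OF open_UNIV open_UNIV _ Ck_on_pos_part_power])
      (auto intro!: Ck_on_diff Ck_on_const Ck_on_ident simp del: Ck_on.simps)
  have "Ck_on k (\<lambda>x. max 0 x ^ Suc k * inverse (max 0 x ^ Suc k + max 0 (1 - x) ^ Suc k)) UNIV"
    by (intro Ck_on_mult open_UNIV Ck_on_pos_part_power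
        Ck_on_compose[OF open_UNIV _ Ck_on_add[OF open_UNIV Ck_on_pos_part_power a] Ck_on_inverse])
      (use smooth_step_denominator_pos in \<open>auto intro!: open_Collect_neq simp: less_imp_neq[symmetric] simp del: power_Suc\<close>)
  then show ?thesis unfolding smooth_step_def divide_inverse .
qed

lemma smooth_step_0: "x \<le> 0 \<Longrightarrow> smooth_step k x = 0"
  by (simp add: smooth_step_def)

lemma smooth_step_1: "x \<ge> 1 \<Longrightarrow> smooth_step k x = 1"
  by (simp add: smooth_step_def)

lemma smooth_step_mono:
  assumes "x \<le> y"
  shows "smooth_step k x \<le> smooth_step k y"
proof -
  define a where "a = max 0 x ^ Suc k"
  define b where "b = max 0 (1 - x) ^ Suc k"
  define c where "c = max 0 y ^ Suc k"
  define d where "d = max 0 (1 - y) ^ Suc k"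
  have "a \<le> c" "d \<le> b" unfolding a_def b_def c_def d_def using assms by (intro power_mono; simp)+
  moreover have "a \<ge> 0" "d \<ge> 0" by (auto simp: a_def d_def)
  ultimately have "a * d \<le> c * b" by (intro mult_mono) auto
  moreover have "a + b > 0" "c + d > 0"
    using smooth_step_denominator_pos[of x k] smooth_step_denominator_pos[of y k]
    by (simp_all only: a_def b_def c_def d_def)
  ultimately have "a / (a + b) \<le> c / (c + d)" by (simp add: field_simps)
  then show ?thesis by (simp only: smooth_step_def a_def b_def c_def d_def)
qed

lemma Ck_on_bump: "Ck_on k (bump k) UNIV"
proof -
  have "Ck_on k (\<lambda>x. smooth_step k (x + 1)) UNIV"
    by (rule Ck_on_compose[OF open_UNIV open_UNIV _ Ck_on_smooth_step])
      (auto intro!: Ck_on_add Ck_on_const Ck_on_ident simp del: Ck_on.simps)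
  then show ?thesis unfolding bump_def by (intro Ck_on_diff Ck_on_smooth_step open_UNIV)
qed

lemma bump_nonneg: "bump k x \<ge> 0"
  unfolding bump_def using smooth_step_mono[of x "x + 1"] by simp

lemma bump_eq_0: "\<bar>x\<bar> \<ge> 1 \<Longrightarrow> bump k x = 0"
  by (auto simp: bump_def abs_real_def smooth_step_0 smooth_step_1 split: if_splits)

lemma bump_0: "bump k 0 = 1"
  by (simp add: bump_def smooth_step_0 smooth_step_1)

text \<open>Only translates by natural numbers are summed, so the telescoping sum is smooth_step (x
  + 1), which is 1 because x \<ge> 0. Levels of nonzero lattice points satisfy this.\<close>

lemma bump_sums:
  assumes "x \<ge> 0"
  shows "((\<lambda>m. bump k (x - real m)) has_sum 1) UNIV"
proof -
  have "(\<Sum>m<n. bump k (x - real m)) = smooth_step k (x + 1) - smooth_step k (x + 1 - real n)" for n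
    by (induction n) (auto simp: bump_def algebra_simps)
  moreover obtain n :: nat where n: "real n > x + 1" using reals_Archimedean2 by blast
  moreover have "((\<lambda>m. bump k (x - real m)) has_sum (\<Sum>m<n. bump k (x - real m))) UNIV"
    by (rule has_sum_finite_neutralI) (use n in \<open>auto intro!: bump_eq_0\<close>)
  ultimately show ?thesis using assms by (simp add: smooth_step_0 smooth_step_1)
qed

subsection \<open>The level function of a dilation group\<close>

lemma Ck_on_inner:
  fixes f g :: "'a::euclidean_space \<Rightarrow> real^'n"
  assumes "open U" "\<And>i. Ck_on k (\<lambda>x. f x $ i) U" "\<And>i. Ck_on k (\<lambda>x. g x $ i) U"
  shows "Ck_on k (\<lambda>x. f x \<bullet> g x) U"
  unfolding inner_vec_def inner_real_def by (intro Ck_on_sum Ck_on_mult assms)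

lemma Ck_on_matrix_vector_mult:
  fixes M :: "'a::euclidean_space \<Rightarrow> real^'n^'m"
  assumes "open U" "\<And>i j. Ck_on k (\<lambda>x. M x $ i $ j) U" "\<And>i. Ck_on k (\<lambda>x. f x $ i) U"
  shows "Ck_on k (\<lambda>x. (M x *v f x) $ i) U"
  unfolding matrix_vector_mult_def vec_lambda_beta by (intro Ck_on_sum Ck_on_mult assms)

lemma Ck_on_vec_nth: "Ck_on k (\<lambda>x::real^'n. x $ i) U"
  by (rule Ck_on_bounded_linear) (rule bounded_linear_vec_nth)

lemma open_nonzero: "open (UNIV - {0 :: 'a::real_normed_vector})"
  by (simp add: open_delete)

lemma Ck_on_flow_entry: "Ck_on k (\<lambda>u. flow A (- u) $ i $ j) UNIV" for A :: "real^'n^'n"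
proof (induction k arbitrary: i)
  case 0
  show ?case unfolding Ck_on.simps(1)
    by (rule continuous_on_compose2[OF flow_entry_continuous[of UNIV A i j]])
      (auto intro: continuous_intros)
next
  case (Suc k)
  show ?case
  proof (rule Ck_on_real_SucI[OF open_UNIV])
    show "((\<lambda>u. flow A (- u) $ i $ j) has_real_derivative - (A ** flow A (- u)) $ i $ j) (at u)" for u
      using DERIV_chain2[OF flow_entry_deriv DERIV_minus[OF DERIV_ident], of A i j u] by simp
    show "Ck_on k (\<lambda>u. - (A ** flow A (- u)) $ i $ j) UNIV"
      unfolding matrix_matrix_mult_def vec_lambda_beta
      by (intro Ck_on_minus Ck_on_sum Ck_on_cmult Suc open_UNIV)
  qed
qed

lemma flow_vec_eq_0_iff [simp]: "flow A u *v x = 0 \<longleftrightarrow> x = 0" for A :: "real^'n^'n"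
proof
  assume "flow A u *v x = 0"
  then have "flow A (- u) *v (flow A u *v x) = 0" by simp
  then show "x = 0" unfolding flow_add_vec by simp
qed simp

lemma flow_cancel [simp]:
  "flow A (- u) *v (flow A u *v x) = x" "flow A u *v (flow A (- u) *v x) = x"
  for A :: "real^'n^'n"
  by (simp_all add: flow_add_vec)

lemma rpow_matrix_exp: "rpow_matrix (exp u) A = flow A u"
  by (simp add: rpow_matrix_def flow_def)

lemma homogeneous_iff_flow:
  fixes A :: "real^'n^'n"
  shows "homogeneous A \<phi> \<longleftrightarrow> (\<forall>u x. \<phi> (flow A u *v x) = exp u * \<phi> x)"
proof
  assume "homogeneous A \<phi>"
  then show "\<forall>u x. \<phi> (flow A u *v x) = exp u * \<phi> x"
    by (metis homogeneous_def rpow_matrix_exp exp_gt_zero)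
next
  assume "\<forall>u x. \<phi> (flow A u *v x) = exp u * \<phi> x"
  then show "homogeneous A \<phi>"
    by (auto simp: homogeneous_def rpow_matrix_def flow_def[symmetric])
qed

text \<open>P is a form as supplied by \<open>lyapunov_form\<close>. By \<open>quad_deriv\<close> it
  increases strictly along every orbit other than 0, so its unit ellipsoid is a cross-section of the
  flow.\<close>

locale dilation =
  fixes A P :: "real^'n^'n"
  assumes A_M_plus: "A \<in> M_plus"
    and quad_lower: "(norm x)\<^sup>2 \<le> x \<bullet> (P *v x)"
    and quad_deriv: "x \<noteq> 0 \<Longrightarrow> (A *v x) \<bullet> (P *v x) + x \<bullet> (P *v (A *v x)) > 0"
begin

definition quad :: "real^'n \<Rightarrow> real" where "quad x = x \<bullet> (P *v x)"

definition speed :: "real^'n \<Rightarrow> real" where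
  "speed x = (A *v x) \<bullet> (P *v x) + x \<bullet> (P *v (A *v x))"

definition orbit_quad :: "real \<Rightarrow> real^'n \<Rightarrow> real" where
  "orbit_quad u x = quad (flow A (- u) *v x)"

lemma speed_pos: "x \<noteq> 0 \<Longrightarrow> speed x > 0"
  using quad_deriv by (simp add: speed_def)

lemma quad_has_derivative:
  "(quad has_derivative (\<lambda>w. w \<bullet> (P *v x) + x \<bullet> (P *v w))) (at x within S)"
  unfolding quad_def
  by (rule has_derivative_eq_rhs, rule has_derivative_inner[OF has_derivative_ident
     bounded_linear_imp_has_derivative]) (auto simp: add.commute)

lemma continuous_on_quad: "continuous_on S quad"
  using quad_has_derivative by (auto intro!: has_derivative_continuous_on)

lemma quad_scaleR: "quad (r *\<^sub>R x) = r\<^sup>2 * quad x"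
  by (simp add: quad_def matrix_vector_mult_scaleR power2_eq_square)

lemma orbit_map_has_derivative:
  "((\<lambda>p. flow A (- fst p) *v snd p) has_derivative
     (\<lambda>h. flow A (- u) *v snd h - fst h *\<^sub>R (A *v (flow A (- u) *v x)))) (at (u, x))"
proof -
  have 1: "((\<lambda>p. flow A (- fst p)) has_derivative (\<lambda>h. (- fst h) *\<^sub>R (A ** flow A (- u)))) (at (u, x))"
  proof -
    have "((\<lambda>p. - fst p) has_derivative (\<lambda>h. - fst h)) (at (u, x))"
      by (auto intro!: derivative_eq_intros)
    moreover have "(flow A has_derivative (\<lambda>h. h *\<^sub>R (A ** flow A (- u)))) (at (- fst (u, x)))"
      using flow_has_vector_derivative[of A "-u" UNIV] by (simp add: has_vector_derivative_def)
    ultimately show ?thesis by (rule has_derivative_compose)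
  qed
  have "((\<lambda>p. flow A (- fst p) *v snd p) has_derivative
    (\<lambda>h. flow A (- fst (u, x)) *v snd h + ((- fst h) *\<^sub>R (A ** flow A (- u))) *v snd (u, x))) (at (u, x))"
    by (rule bounded_bilinear.FDERIV[OF bounded_bilinear_matrix_vector_mult 1])
      (auto intro!: derivative_eq_intros)
  then show ?thesis
    by (simp add: scaleR_matrix_vector_assoc[symmetric] matrix_vector_mul_assoc
      bounded_bilinear.minus_left[OF bounded_bilinear_matrix_vector_mult])
qed

lemma orbit_quad_has_derivative:
  assumes "y = flow A (- u) *v x"
  shows "((\<lambda>p. orbit_quad (fst p) (snd p)) has_derivative
     (\<lambda>h. (flow A (- u) *v snd h) \<bullet> (P *v y) + y \<bullet> (P *v (flow A (- u) *v snd h)) - fst h * speed y))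
     (at (u, x))"
proof -
  have "((\<lambda>p. quad (flow A (- fst p) *v snd p)) has_derivative
    (\<lambda>h. (flow A (- u) *v snd h - fst h *\<^sub>R (A *v y)) \<bullet> (P *v y) +
         y \<bullet> (P *v (flow A (- u) *v snd h - fst h *\<^sub>R (A *v y))))) (at (u, x))"
    unfolding assms
    using has_derivative_compose[OF orbit_map_has_derivative, of quad _ u x,
        OF quad_has_derivative[of "flow A (- fst (u, x)) *v snd (u, x)" UNIV]]
    by simp
  then show ?thesis unfolding orbit_quad_def speed_def
    by (simp add: matrix_vector_mult_diff_distrib matrix_vector_mult_scaleR inner_diff_left
        inner_diff_right algebra_simps)
qed

lemma orbit_quad_deriv:
  "((\<lambda>u. orbit_quad u x) has_real_derivative - speed (flow A (- u) *v x)) (at u)"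
proof -
  have "((\<lambda>u. orbit_quad (fst (u, x)) (snd (u, x))) has_derivative
     (\<lambda>h. - h * speed (flow A (- u) *v x))) (at u)"
  proof -
    have "((\<lambda>u. (u, x)) has_derivative (\<lambda>h. (h, 0))) (at u)"
      by (auto intro!: derivative_eq_intros)
    from has_derivative_compose[OF this orbit_quad_has_derivative[OF refl, of u x]]
    show ?thesis by simp
  qed
  then show ?thesis unfolding has_field_derivative_def fst_conv snd_conv
    by (rule has_derivative_eq_rhs) (auto simp: fun_eq_iff)
qed

lemma continuous_orbit_map: "continuous_on S (\<lambda>p. flow A (fst p) *v snd p)"
  by (intro bounded_bilinear.continuous_on[OF bounded_bilinear_matrix_vector_mult]
      continuous_on_compose2[OF flow_continuous[of UNIV]] continuous_intros) auto

lemma continuous_on_orbit_quad: "continuous_on S (orbit_quad u)"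
  unfolding orbit_quad_def
  by (rule continuous_on_compose2[OF continuous_on_quad[of UNIV]])
    (auto intro!: linear_continuous_on)

lemma orbit_quad_strict_antimono:
  assumes "x \<noteq> 0" "u < v"
  shows "orbit_quad v x < orbit_quad u x"
  by (rule DERIV_neg_imp_decreasing[OF assms(2)])
    (use orbit_quad_deriv speed_pos assms in fastforce)

lemma orbit_quad_less_iff: "x \<noteq> 0 \<Longrightarrow> orbit_quad v x < orbit_quad u x \<longleftrightarrow> u < v"
  using orbit_quad_strict_antimono by (metis linorder_neqE_linordered_idom order_less_asym order_less_irrefl)

text \<open>Backwards the orbit shrinks to 0. Forwards, the decay estimate applied to
  \<open>flow A w *v x\<close> makes its norm at least 1 for large w, and \<open>quad_lower\<close>
  passes this on to the form. The intermediate value theorem does the rest.\<close>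

lemma orbit_quad_1_exists:
  assumes "x \<noteq> 0"
  shows "\<exists>u. orbit_quad u x = 1"
proof -
  obtain C c where C: "C > 0" and c: "c > 0" and
    decay: "\<And>u x. u \<ge> 0 \<Longrightarrow> norm (flow A (- u) *v x) \<le> C * exp (- c * u) * norm x"
    using flow_decay[OF A_M_plus] by blast
  have "((\<lambda>u. C * exp (- c * u)) \<longlongrightarrow> C * 0) at_top"
    using c by (intro tendsto_mult tendsto_const filterlim_compose[OF exp_at_bot])
      (simp add: filterlim_uminus_at_top[symmetric]
        filterlim_tendsto_pos_mult_at_top[OF tendsto_const _ filterlim_ident])
  then have lim: "((\<lambda>u. C * exp (- c * u)) \<longlongrightarrow> 0) at_top" by simp
  have "((\<lambda>u. flow A (- u) *v x) \<longlongrightarrow> 0) at_top"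
  proof (rule Lim_null_comparison)
    show "\<forall>\<^sub>F u in at_top. norm (flow A (- u) *v x) \<le> C * exp (- c * u) * norm x"
      using decay by (intro eventually_mono[OF eventually_ge_at_top[of 0]]) auto
  qed (use tendsto_mult_right_zero[OF lim] tendsto_mult_left_zero[OF lim] in auto)
  then have "((\<lambda>u. orbit_quad u x) \<longlongrightarrow> quad 0) at_top"
    unfolding orbit_quad_def using continuous_on_quad[of UNIV]
    by (auto simp: continuous_on_eq_continuous_at intro: isCont_tendsto_compose)
  then have "((\<lambda>u. orbit_quad u x) \<longlongrightarrow> 0) at_top" by (simp add: quad_def)
  then have "\<forall>\<^sub>F u in at_top. orbit_quad u x < 1" by (rule order_tendstoD) simp
  then obtain v where v: "orbit_quad v x < 1" by (auto simp: eventually_at_top_linorder)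
  have "\<forall>\<^sub>F w in at_top. C * exp (- c * w) < norm x"
    using order_tendstoD(2)[OF lim, of "norm x"] assms by simp
  then have "\<forall>\<^sub>F w in at_top. C * exp (- c * w) < norm x \<and> w \<ge> 0"
    using eventually_ge_at_top[of 0] by (rule eventually_conj)
  then obtain w where w: "C * exp (- c * w) < norm x" "w \<ge> 0" by (auto simp: eventually_at_top_linorder)
  have u: "orbit_quad (- w) x \<ge> 1"
  proof -
    have "norm x \<le> C * exp (- c * w) * norm (flow A w *v x)"
      using decay[OF w(2), of "flow A w *v x"] by simp
    also have "\<dots> \<le> norm x * norm (flow A w *v x)" using w by (intro mult_right_mono) auto
    finally have "1 \<le> norm (flow A w *v x)" using assms by simp
    then have "1 \<le> (norm (flow A w *v x))\<^sup>2" by simp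
    also have "\<dots> \<le> quad (flow A w *v x)" unfolding quad_def by (rule quad_lower)
    finally show ?thesis by (simp add: orbit_quad_def)
  qed
  have "- w \<le> v" using orbit_quad_less_iff[OF assms, of v "-w"] u v by linarith
  then have "\<exists>t\<ge>-w. t \<le> v \<and> orbit_quad t x = 1"
    using orbit_quad_deriv[of x] u v by (intro IVT2) (auto intro: DERIV_isCont)
  then show ?thesis by blast
qed

text \<open>The time at which the flow, started on the ellipsoid, reaches x: the logarithm of a
  homogeneous norm. The value at 0 is unspecified, and 0 is excluded or treated apart wherever it
  matters.\<close>

definition level :: "real^'n \<Rightarrow> real" where "level x = (THE u. orbit_quad u x = 1)"

lemma level_eqI: "x \<noteq> 0 \<Longrightarrow> orbit_quad u x = 1 \<Longrightarrow> level x = u"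
  unfolding level_def
  by (rule the_equality) (metis orbit_quad_less_iff linorder_neqE_linordered_idom order_less_irrefl)+

lemma orbit_quad_level: "x \<noteq> 0 \<Longrightarrow> orbit_quad (level x) x = 1"
  using orbit_quad_1_exists level_eqI by metis

lemma level_flow: "x \<noteq> 0 \<Longrightarrow> level (flow A t *v x) = level x + t"
  by (rule level_eqI) (auto simp: orbit_quad_def flow_add_vec orbit_quad_level[unfolded orbit_quad_def])

lemma level_less_iff: "x \<noteq> 0 \<Longrightarrow> level x < u \<longleftrightarrow> orbit_quad u x < 1"
  using orbit_quad_less_iff[of x u "level x"] orbit_quad_level[of x] by simp

lemma less_level_iff: "x \<noteq> 0 \<Longrightarrow> u < level x \<longleftrightarrow> orbit_quad u x > 1"
  using orbit_quad_less_iff[of x "level x" u] orbit_quad_level[of x] by simp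

text \<open>By \<open>level_less_iff\<close> and \<open>less_level_iff\<close>, bounds on the level
  are strict inequalities for the continuous functions \<open>orbit_quad u\<close>, hence open
  conditions.\<close>

lemma continuous_on_level: "continuous_on (UNIV - {0}) level"
proof -
  have lim: "(level \<longlongrightarrow> level x) (at x)" if "x \<noteq> 0" for x
  proof -
    have nz: "\<forall>\<^sub>F y in at x. y \<noteq> 0" using eventually_neq_at_within[of 0 x UNIV] by (simp add: eventually_neq_at_within)
    have lim: "(orbit_quad u \<longlongrightarrow> orbit_quad u x) (at x)" for u
      using continuous_on_orbit_quad[of UNIV u] by (simp add: continuous_on_def)
    show ?thesis
    proof (rule order_tendstoI)
      fix a assume "a < level x"
      then have "orbit_quad a x > 1" using that less_level_iff by blast
      from order_tendstoD(1)[OF lim this] nz show "\<forall>\<^sub>F y in at x. a < level y"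
        by eventually_elim (simp add: less_level_iff)
    next
      fix a assume "a > level x"
      then have "orbit_quad a x < 1" using that level_less_iff by blast
      from order_tendstoD(2)[OF lim this] nz show "\<forall>\<^sub>F y in at x. a > level y"
        by eventually_elim (simp add: level_less_iff)
    qed
  qed
  show ?thesis by (intro continuous_at_imp_continuous_on ballI) (simp add: isCont_def lim)
qed

definition proj :: "real^'n \<Rightarrow> real^'n" where "proj x = flow A (- level x) *v x"

lemma proj_eq_0_iff [simp]: "proj x = 0 \<longleftrightarrow> x = 0"
  by (simp add: proj_def)

text \<open>The formula of implicit differentiation: quad (flow A (- u) x) = 1 is differentiated in
  x and in u, and solved for the change of u. The speed at \<open>proj x\<close> is the coefficient
  of the latter.\<close>

definition level_deriv :: "real^'n \<Rightarrow> real^'n \<Rightarrow> real" where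
  "level_deriv x v = ((flow A (- level x) *v v) \<bullet> (P *v proj x) + proj x \<bullet> (P *v (flow A (- level x) *v v)))
     / speed (proj x)"

text \<open>The map \<open>(u, x) \<mapsto> (orbit_quad u x, x)\<close> is inverted by \<open>(c, x) \<mapsto> (level (x / sqrt c), x)\<close>, so the
  level function inherits differentiability from it.\<close>

lemma level_has_derivative:
  assumes "x \<noteq> 0"
  shows "(level has_derivative level_deriv x) (at x)"
proof -
  let ?T = "{p :: real \<times> (real^'n). fst p > 0 \<and> snd p \<noteq> 0}"
  let ?f = "\<lambda>p. (orbit_quad (fst p) (snd p), snd p)"
  let ?g = "\<lambda>p. (level ((1 / sqrt (fst p)) *\<^sub>R snd p), snd p)"
  let ?y = "proj x" and ?F = "flow A (- level x)"
  let ?L = "\<lambda>v. (?F *v v) \<bullet> (P *v ?y) + ?y \<bullet> (P *v (?F *v v))"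
  have s: "speed ?y \<noteq> 0" using speed_pos[of ?y] assms by simp
  have linL: "bounded_linear ?L"
    by (intro bounded_linear_add bounded_linear_inner_left_comp bounded_linear_inner_right_comp
      bounded_linear_compose[OF matrix_vector_mul_bounded_linear] matrix_vector_mul_bounded_linear)
  have "open ?T" by (intro open_Collect_conj open_Collect_less open_Collect_neq continuous_intros)
  have "(?g has_derivative (\<lambda>h. ((?L (snd h) - fst h) / speed ?y, snd h))) (at (1, x))"
  proof (rule has_derivative_inverse_basic[where f = ?f and T = ?T])
    show "(?f has_derivative (\<lambda>h. (?L (snd h) - fst h * speed ?y, snd h))) (at (?g (1, x)))"
      using orbit_quad_has_derivative[of ?y "level x" x]
      by (auto intro!: has_derivative_Pair derivative_eq_intros simp: proj_def)
    show "bounded_linear (\<lambda>h. ((?L (snd h) - fst h) / speed ?y, snd h))"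
      by (intro bounded_linear_Pair bounded_linear_divide[THEN bounded_linear_compose]
        bounded_linear_sub bounded_linear_compose[OF linL] bounded_linear_snd bounded_linear_fst)
    show "(\<lambda>h. ((?L (snd h) - fst h) / speed ?y, snd h)) \<circ> (\<lambda>h. (?L (snd h) - fst h * speed ?y, snd h)) = id"
      using s by (auto simp: fun_eq_iff)
    have "continuous_on ?T (\<lambda>p. level ((1 / sqrt (fst p)) *\<^sub>R snd p))"
      by (rule continuous_on_compose2[OF continuous_on_level]) (auto intro!: continuous_intros)
    then have "continuous_on ?T ?g" by (intro continuous_intros)
    then show "continuous (at (1, x)) ?g"
      using \<open>open ?T\<close> assms by (auto simp: continuous_on_eq_continuous_at)
    show "open ?T" by fact
    show "(1, x) \<in> ?T" using assms by simp
    show "?f (?g z) = z" if "z \<in> ?T" for z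
    proof -
      obtain c w where "z = (c, w)" by (cases z)
      then have z: "z = (c, w)" "c > 0" "w \<noteq> 0" using that by auto
      let ?r = "1 / sqrt c"
      have "orbit_quad (level (?r *\<^sub>R w)) (?r *\<^sub>R w) = 1" using z by (intro orbit_quad_level) auto
      moreover have "orbit_quad u (?r *\<^sub>R w) = orbit_quad u w / c" for u
        using z by (simp add: orbit_quad_def matrix_vector_mult_scaleR quad_scaleR power_divide)
      ultimately show ?thesis using z by simp
    qed
  qed
  then have "((\<lambda>p. fst (?g p)) has_derivative (\<lambda>h. fst ((?L (snd h) - fst h) / speed ?y, snd h))) (at (1, x))"
    by (rule has_derivative_fst)
  then have g: "((\<lambda>p. fst (?g p)) has_derivative (\<lambda>h. (?L (snd h) - fst h) / speed ?y)) (at (1, x))"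
    by simp
  have "((\<lambda>z. (1 :: real, z)) has_derivative (\<lambda>v. (0, v))) (at x)"
    by (auto intro!: derivative_eq_intros)
  from has_derivative_compose[OF this, of "\<lambda>p. fst (?g p)", OF g]
  have "((\<lambda>z. level z) has_derivative (\<lambda>v. ?L v / speed ?y)) (at x)" by simp
  then show ?thesis unfolding level_deriv_def by simp
qed

lemma Ck_on_proj_of_level:
  assumes "Ck_on k level (UNIV - {0})"
  shows "Ck_on k (\<lambda>x. flow A (- level x) $ i $ j) (UNIV - {0})" "Ck_on k (\<lambda>x. proj x $ i) (UNIV - {0})"
proof -
  show f: "Ck_on k (\<lambda>x. flow A (- level x) $ i $ j) (UNIV - {0})" for i j
    by (rule Ck_on_compose[OF open_nonzero open_UNIV assms Ck_on_flow_entry]) simp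
  show "Ck_on k (\<lambda>x. proj x $ i) (UNIV - {0})"
    unfolding proj_def by (intro Ck_on_matrix_vector_mult open_nonzero f Ck_on_vec_nth)
qed

text \<open>Bootstrapping: the derivative contains the level only through \<open>proj\<close> and
  \<open>flow A (- level x)\<close>, which are as smooth as the level itself, so each round gains
  one order.\<close>

lemma Ck_on_level: "Ck_on k level (UNIV - {0})"
proof (induction k)
  case 0 then show ?case by (simp add: continuous_on_level)
next
  case (Suc k)
  note pf = Ck_on_proj_of_level[OF Suc]
  have Fv: "Ck_on k (\<lambda>x. (flow A (- level x) *v v) $ i) (UNIV - {0})" for v i
    by (intro Ck_on_matrix_vector_mult open_nonzero pf Ck_on_const)
  have lin: "Ck_on k (\<lambda>x. (M *v f x) $ i) (UNIV - {0})"
    if "\<And>i. Ck_on k (\<lambda>x. f x $ i) (UNIV - {0})" for M :: "real^'n^'n" and f :: "real^'n \<Rightarrow> real^'n" and i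
    by (intro Ck_on_matrix_vector_mult open_nonzero Ck_on_const that)
  have sp: "Ck_on k (\<lambda>x. inverse (speed (proj x))) (UNIV - {0})"
    unfolding speed_def
    by (rule Ck_on_compose[OF open_nonzero _ _ Ck_on_inverse])
      (use quad_deriv in \<open>auto intro!: Ck_on_add Ck_on_inner open_nonzero lin pf open_Collect_neq
        simp: less_imp_neq[symmetric]\<close>)
  have "Ck_on k (\<lambda>x. level_deriv x v) (UNIV - {0})" for v
    unfolding level_deriv_def divide_inverse
    by (intro Ck_on_mult Ck_on_add Ck_on_inner open_nonzero lin pf sp Fv)
  then show ?case by (intro Ck_on_SucI[OF open_nonzero level_has_derivative]) auto
qed

lemmas Ck_on_proj = Ck_on_proj_of_level(2)[OF Ck_on_level]

lemma quad_proj: "x \<noteq> 0 \<Longrightarrow> quad (proj x) = 1"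
  using orbit_quad_level by (simp add: orbit_quad_def proj_def)

lemma proj_flow: "x \<noteq> 0 \<Longrightarrow> proj (flow A t *v x) = proj x"
  by (simp add: proj_def level_flow flow_add_vec)

lemma flow_level_proj [simp]: "flow A (level x) *v proj x = x"
  by (simp add: proj_def)

lemma compact_quad_sphere: "compact {x. quad x = 1}"
proof -
  have "closed {x. quad x = 1}"
    using continuous_on_quad[of UNIV] by (intro closed_Collect_eq continuous_on_const)
  moreover have "norm x \<le> 1" if "quad x = 1" for x
    using quad_lower[of x] that power2_le_imp_le[of "norm x" 1] by (simp add: quad_def)
  ultimately show ?thesis by (auto simp: compact_eq_bounded_closed bounded_iff)
qed

lemma quad_0 [simp]: "quad 0 = 0"
  by (simp add: quad_def)

lemma level_quad_1: "quad x = 1 \<Longrightarrow> level x = 0"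
  by (rule level_eqI) (auto simp: orbit_quad_def)

text \<open>The strip lies in the image of the compact set [-a, a] x ellipsoid under the flow, which
  does not contain 0. Cut-offs in the level are thus compactly supported and vanish near 0.\<close>

lemma level_strip_bounds:
  obtains r R where "r > 0" "R > 0" "\<And>x. x \<noteq> 0 \<Longrightarrow> \<bar>level x\<bar> \<le> a \<Longrightarrow> r \<le> norm x \<and> norm x \<le> R"
proof -
  let ?K = "(\<lambda>p. flow A (fst p) *v snd p) ` ({-a..a} \<times> {x. quad x = 1})"
  have "compact ?K"
    by (intro compact_continuous_image continuous_orbit_map compact_Times compact_quad_sphere) auto
  have mem: "x \<in> ?K" if "x \<noteq> 0" "\<bar>level x\<bar> \<le> a" for x
    using that by (intro image_eqI[of _ _ "(level x, proj x)"]) (auto simp: quad_proj)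
  have "0 \<notin> ?K" by auto
  have "bounded ?K" using \<open>compact ?K\<close> by (rule compact_imp_bounded)
  then obtain R where R: "R > 0" "\<And>x. x \<in> ?K \<Longrightarrow> norm x \<le> R"
    unfolding bounded_pos by blast
  have "closed ?K" using \<open>compact ?K\<close> by (rule compact_imp_closed)
  from separate_point_closed[OF this \<open>0 \<notin> ?K\<close>]
  obtain r where r: "r > 0" "\<And>x. x \<in> ?K \<Longrightarrow> r \<le> dist 0 x" by blast
  show ?thesis by (rule that[OF r(1) R(1)]) (use mem r R in fastforce)
qed

lemma homogeneous_eq_proj:
  assumes "homogeneous A \<phi>"
  shows "\<phi> x = exp (level x) * \<phi> (proj x)"
proof -
  have "\<phi> x = \<phi> (flow A (level x) *v proj x)" by simp
  also have "\<dots> = exp (level x) * \<phi> (proj x)" using assms by (simp add: homogeneous_iff_flow del: flow_level_proj)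
  finally show ?thesis .
qed

lemma integer_lattice_norm_ge_1:
  assumes "\<omega> \<in> integer_lattice - {0 :: real^'n}"
  shows "norm \<omega> \<ge> 1"
proof -
  from assms obtain i where i: "\<omega> $ i \<in> \<int>" "\<omega> $ i \<noteq> 0" by (auto simp: integer_lattice_def vec_eq_iff)
  then have "1 \<le> \<bar>\<omega> $ i\<bar>" by (rule Ints_nonzero_abs_ge1)
  also have "\<dots> \<le> norm \<omega>" by (rule component_le_norm_cart)
  finally show ?thesis .
qed

text \<open>Here the constant 1 in \<open>quad_lower\<close> pays off: the norm of a nonzero lattice
  point is at least 1, hence so is its quadratic form.\<close>

lemma level_lattice_nonneg:
  assumes "\<omega> \<in> integer_lattice - {0}"
  shows "level \<omega> \<ge> 0"
proof -
  have "1 \<le> (norm \<omega>)\<^sup>2" using integer_lattice_norm_ge_1[OF assms] by simp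
  also have "\<dots> \<le> orbit_quad 0 \<omega>" using quad_lower by (simp add: orbit_quad_def quad_def)
  finally show ?thesis using level_less_iff[of \<omega> 0] assms by auto
qed

end

subsection \<open>Integrals of compactly supported functions\<close>

lemma compact_support_has_integral:
  fixes f :: "'a::euclidean_space \<Rightarrow> real"
  assumes "continuous_on UNIV f" "\<And>x. x \<notin> cbox a b \<Longrightarrow> f x = 0"
  shows "(f has_integral integral (cbox a b) f) UNIV"
  by (rule has_integral_on_superset[OF integrable_integral])
    (use assms in \<open>auto intro!: integrable_continuous intro: continuous_on_subset\<close>)

definition cube :: "real \<Rightarrow> (real^'n) set" where "cube R = cbox (\<chi> i. - R) (\<chi> i. R)"

lemma norm_le_imp_mem_cube: "norm x \<le> R \<Longrightarrow> x \<in> cube R"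
proof -
  assume "norm x \<le> R"
  then have "\<bar>x $ i\<bar> \<le> R" for i using component_le_norm_cart[of x i] by linarith
  then show ?thesis by (auto simp: cube_def mem_box_cart abs_le_iff minus_le_iff)
qed

text \<open>Differentiation under the integral sign is carried out on one fixed box for a whole
  range of parameters, hence the freedom to take any T \<ge> R.\<close>

lemma integral_UNIV_eq_cube:
  assumes "continuous_on UNIV f" "\<And>x. norm x > R \<Longrightarrow> f x = (0::real)" "R \<le> T"
  shows "integral UNIV f = integral (cube T) f"
proof -
  have "f x = 0" if "x \<notin> cube T" for x
    using that norm_le_imp_mem_cube[of x T] assms(2)[of x] assms(3) by fastforce
  then show ?thesis unfolding cube_def
    using compact_support_has_integral[OF assms(1)] integral_unique unfolding cube_def by blast
qed

lemma integral_UNIV_translate: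
  fixes f :: "real^'n \<Rightarrow> real"
  assumes "continuous_on UNIV f" "\<And>x. norm x > R \<Longrightarrow> f x = 0"
  shows "integral UNIV (\<lambda>x. f (x + c)) = integral UNIV f"
proof -
  let ?a = "(\<chi> i. - R) :: real^'n" and ?b = "(\<chi> i. R) :: real^'n"
  have z: "f x = 0" if "x \<notin> cbox ?a ?b" for x
    using that norm_le_imp_mem_cube[of x R] assms(2)[of x] unfolding cube_def by fastforce
  have "continuous_on UNIV (\<lambda>x. f (x + c))"
    by (rule continuous_on_compose2[OF assms(1)]) (auto intro!: continuous_intros)
  moreover have "f (x + c) = 0" if "x \<notin> cbox (?a - c) (?b - c)" for x
    by (rule z) (use that in \<open>auto simp: mem_box_cart algebra_simps\<close>)
  ultimately have "integral UNIV (\<lambda>x. f (x + c)) = integral (cbox (?a - c) (?b - c)) (\<lambda>x. f (x + c))"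
    by (intro integral_unique compact_support_has_integral)
  also have "\<dots> = integral (cbox ?a ?b) f" by (rule integral_shift_cbox)
  also have "\<dots> = integral UNIV f"
    by (rule integral_unique[OF compact_support_has_integral[OF assms(1) z], symmetric])
  finally show ?thesis .
qed

lemma frechet_derivative_cart_sum:
  fixes f :: "real^'n \<Rightarrow> real"
  assumes "f differentiable (at x)"
  shows "frechet_derivative f (at x) v = (\<Sum>i\<in>UNIV. v $ i * frechet_derivative f (at x) (axis i 1))"
proof -
  have lin: "linear (frechet_derivative f (at x))" using assms by (rule linear_frechet_derivative)
  have "frechet_derivative f (at x) v = frechet_derivative f (at x) (\<Sum>i\<in>UNIV. v $ i *\<^sub>R axis i 1)"
    by (simp add: basis_expansion scalar_mult_eq_scaleR[symmetric])
  then show ?thesis by (simp add: linear_sum[OF lin] linear_scale[OF lin])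
qed

lemma frechet_derivative_zero_outside:
  assumes "\<And>x. norm x > R \<Longrightarrow> f x = (0::real)" "norm (x :: 'a::real_normed_vector) > R"
  shows "frechet_derivative f (at x) v = 0"
proof -
  have "((\<lambda>_. 0) has_derivative (\<lambda>_. 0)) (at x)" by simp
  then have "(f has_derivative (\<lambda>_. 0)) (at x)"
    by (rule has_derivative_transform_within_open[of _ _ _ _ "{x. norm x > R}"])
      (use assms in \<open>auto intro!: open_Collect_less continuous_intros\<close>)
  then show ?thesis by (simp add: frechet_derivative_at[symmetric])
qed

lemma C1_has_derivative:
  assumes "Ck_on (Suc 0) f UNIV"
  shows "(f has_derivative frechet_derivative f (at x)) (at x)"
  using Ck_on_Suc_has_derivative[OF assms] by simp

lemma C1_continuous_deriv: "Ck_on (Suc 0) f UNIV \<Longrightarrow> continuous_on UNIV (\<lambda>x. frechet_derivative f (at x) v)"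
  by simp

text \<open>By translation invariance the integral of f (x + t v) does not depend on t; its
  derivative at t = 0 is the integral in question. The cube of size R + |v| contains the supports of
  all translates with |t| \<le> 1.\<close>

lemma integral_directional_derivative_eq_0:
  fixes f :: "real^'n \<Rightarrow> real"
  assumes f: "Ck_on (Suc 0) f UNIV" and supp: "\<And>x. norm x > R \<Longrightarrow> f x = 0"
  shows "integral UNIV (\<lambda>x. frechet_derivative f (at x) v) = 0"
proof -
  let ?T = "R + norm v"
  let ?J = "\<lambda>t::real. integral (cube ?T) (\<lambda>x. f (x + t *\<^sub>R v))"
  have c: "continuous_on UNIV f" using f by (rule Ck_on_imp_continuous_on)
  have line: "((\<lambda>t. f (x + t *\<^sub>R v)) has_real_derivative frechet_derivative f (at (x + t *\<^sub>R v)) v)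
      (at t within S)" for x t S
  proof -
    have "((\<lambda>t. x + t *\<^sub>R v) has_derivative (\<lambda>h. h *\<^sub>R v)) (at t within S)"
      by (auto intro!: derivative_eq_intros)
    from has_derivative_compose[OF this C1_has_derivative[OF f]]
    have "((\<lambda>t. f (x + t *\<^sub>R v)) has_derivative
        (\<lambda>h. frechet_derivative f (at (x + t *\<^sub>R v)) (h *\<^sub>R v))) (at t within S)" .
    moreover have "linear (frechet_derivative f (at (x + t *\<^sub>R v)))"
      using f by (intro linear_frechet_derivative) auto
    ultimately show ?thesis
      by (simp add: has_field_derivative_def linear_scale mult_commute_abs)
  qed
  have "(?J has_real_derivative integral (cube ?T) (\<lambda>x. frechet_derivative f (at (x + 0 *\<^sub>R v)) v))
      (at 0 within {-1..1})"
    unfolding cube_def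
  proof (rule leibniz_rule_field_derivative[where fx = "\<lambda>t x. frechet_derivative f (at (x + t *\<^sub>R v)) v"])
    show "(\<lambda>x. f (x + t *\<^sub>R v)) integrable_on cbox a b" for t a b
      by (rule integrable_continuous)
        (rule continuous_on_compose2[OF c], auto intro!: continuous_intros)
    show "continuous_on ({-1..1} \<times> cbox (\<chi> i. - ?T) (\<chi> i. ?T))
        (\<lambda>(t, x). frechet_derivative f (at (x + t *\<^sub>R v)) v)"
      unfolding case_prod_beta
      by (rule continuous_on_compose2[OF C1_continuous_deriv[OF f]]) (auto intro!: continuous_intros)
  qed (auto intro: line)
  moreover have "?J t = integral UNIV f" if "t \<in> {-1..1}" for t
  proof -
    have "integral UNIV (\<lambda>x. f (x + t *\<^sub>R v)) = ?J t"
    proof (rule integral_UNIV_eq_cube)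
      show "continuous_on UNIV (\<lambda>x. f (x + t *\<^sub>R v))"
        by (rule continuous_on_compose2[OF c]) (auto intro!: continuous_intros)
      show "f (x + t *\<^sub>R v) = 0" if "norm x > ?T" for x
      proof (rule supp)
        have "norm (t *\<^sub>R v) \<le> norm v" using \<open>t \<in> _\<close> by (auto simp: mult_left_le_one_le abs_le_iff)
        then show "R < norm (x + t *\<^sub>R v)" using that norm_diff_ineq[of x "t *\<^sub>R v"] by linarith
      qed
    qed simp
    then show ?thesis using integral_UNIV_translate[OF c supp, of R "t *\<^sub>R v"] by simp
  qed
  then have "(?J has_real_derivative 0) (at 0 within {-1..1})"
    by (intro has_field_derivative_transform_within[OF DERIV_const[of "integral UNIV f"] zero_less_one]) auto
  ultimately have "integral (cube ?T) (\<lambda>x. frechet_derivative f (at x) v) = 0"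
    using has_field_derivative_unique[of ?J _ 0 "{-1..1}" 0] by (simp add: trivial_limit_within)
  then show ?thesis
    using integral_UNIV_eq_cube[of "\<lambda>x. frechet_derivative f (at x) v" R ?T]
      C1_continuous_deriv[OF f] frechet_derivative_zero_outside[of R f, OF supp] by simp
qed

lemma compact_support_integrable:
  fixes f :: "real^'n \<Rightarrow> real"
  assumes "continuous_on UNIV f" "\<And>x. norm x > R \<Longrightarrow> f x = 0"
  shows "f integrable_on UNIV"
proof -
  have "f x = 0" if "x \<notin> cbox (\<chi> i. - R) (\<chi> i. R)" for x
    using that norm_le_imp_mem_cube[of x R] assms(2)[of x] unfolding cube_def by fastforce
  from compact_support_has_integral[OF assms(1) this] show ?thesis by blast
qed

text \<open>The library's change of variables for linear maps asks for a well-ordered index type.  The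
  Jacobian of the flow is obtained instead from the divergence of the linear vector field \<open>A\<close>.\<close>

lemma integral_divergence:
  fixes A :: "real^'n^'n" and g :: "real^'n \<Rightarrow> real"
  assumes g: "Ck_on (Suc 0) g UNIV" and supp: "\<And>x. norm x > R \<Longrightarrow> g x = 0"
  shows "integral UNIV (\<lambda>x. frechet_derivative g (at x) (A *v x)) = - trace A * integral UNIV g"
proof -
  let ?h = "\<lambda>i x. (A *v x) $ i * g x"
  let ?d = "\<lambda>i x. A $ i $ i * g x + (A *v x) $ i * frechet_derivative g (at x) (axis i 1)"
  have Ax: "bounded_linear (\<lambda>x. (A *v x) $ i)" for i
    by (rule bounded_linear_compose[OF bounded_linear_vec_nth matrix_vector_mul_bounded_linear])
  have h: "Ck_on (Suc 0) (?h i) UNIV" for i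
    by (intro Ck_on_mult open_UNIV g Ck_on_bounded_linear Ax)
  have fr: "frechet_derivative (?h i) (at x) (axis i 1) = ?d i x" for i x
  proof -
    have "(?h i has_derivative (\<lambda>v. (A *v x) $ i * frechet_derivative g (at x) v + (A *v v) $ i * g x)) (at x)"
      by (rule has_derivative_mult[OF bounded_linear_imp_has_derivative[OF Ax] C1_has_derivative[OF g]])
    then have "frechet_derivative (?h i) (at x) = (\<lambda>v. (A *v x) $ i * frechet_derivative g (at x) v + (A *v v) $ i * g x)"
      by (rule frechet_derivative_at[symmetric])
    then show ?thesis by (simp add: matrix_vector_mult_basis column_def)
  qed
  have cg: "continuous_on UNIV g" using g by (rule Ck_on_imp_continuous_on)
  have int_g: "g integrable_on UNIV" by (rule compact_support_integrable[OF cg supp])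
  let ?k = "\<lambda>i x. (A *v x) $ i * frechet_derivative g (at x) (axis i 1)"
  have int_k: "?k i integrable_on UNIV" for i
  proof (rule compact_support_integrable[where R = R])
    show "continuous_on UNIV (?k i)"
      by (rule continuous_on_mult[OF linear_continuous_on[OF Ax] C1_continuous_deriv[OF g]])
    show "?k i x = 0" if "norm x > R" for x
      using frechet_derivative_zero_outside[of R g, OF supp that] by simp
  qed
  have "integral UNIV (?d i) = 0" for i
    using integral_directional_derivative_eq_0[OF h, of R i "axis i 1"] supp by (simp add: fr)
  then have eq: "integral UNIV (?k i) = - (A $ i $ i) * integral UNIV g" for i
    using integral_add[OF integrable_on_cmult_left[OF int_g, of "A $ i $ i"] int_k[of i]] by simp
  have "integral UNIV (\<lambda>x. frechet_derivative g (at x) (A *v x)) = integral UNIV (\<lambda>x. \<Sum>i\<in>UNIV. ?k i x)"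
    by (rule integral_cong, rule frechet_derivative_cart_sum) (use g in auto)
  also have "\<dots> = (\<Sum>i\<in>UNIV. integral UNIV (?k i))" by (rule integral_sum) (auto intro: int_k)
  also have "\<dots> = - trace A * integral UNIV g" by (simp add: eq trace_def sum_distrib_right sum_negf)
  finally show ?thesis .
qed

text \<open>Differentiating under the integral produces the field A applied to f o flow, so
  \<open>integral_divergence\<close> yields J' = - trace A * J, and e^(u trace A) J(u) is
  constant.\<close>

lemma integral_flow:
  fixes A :: "real^'n^'n" and f :: "real^'n \<Rightarrow> real"
  assumes f: "Ck_on (Suc 0) f UNIV" and supp: "\<And>x. norm x > R \<Longrightarrow> f x = 0" and R: "R > 0"
  shows "integral UNIV (\<lambda>x. f (flow A u *v x)) = exp (- u * trace A) * integral UNIV f"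
proof -
  \<comment> \<open>From outside this radius the ball of radius R cannot be reached within time T,
    so one cube serves all parameters v with |v| \<le> |u|.\<close>
  let ?N = "\<lambda>T. real CARD('n) ^ 2 * exp (entry_bound A * T) * R"
  have c: "continuous_on UNIV f" using f by (rule Ck_on_imp_continuous_on)
  have supp': "f (flow A u *v x) = 0" if "norm x > ?N T" "\<bar>u\<bar> \<le> T" for x u T
  proof (rule supp, rule ccontr)
    assume "\<not> norm (flow A u *v x) > R"
    then have le: "norm (flow A u *v x) \<le> R" by simp
    have "norm x = norm (flow A (- u) *v (flow A u *v x))" by simp
    also have "\<dots> \<le> real CARD('n) ^ 2 * exp (entry_bound A * \<bar>-u\<bar>) * norm (flow A u *v x)"
      by (rule norm_flow_vector_le)
    also have "\<dots> \<le> ?N T"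
      using that(2) le R by (intro mult_mono) (auto intro!: mult_left_mono entry_bound_nonneg)
    finally show False using that(1) by simp
  qed
  have cont_u: "continuous_on UNIV (\<lambda>x. f (flow A u *v x))" for u
    by (rule continuous_on_compose2[OF c]) (auto intro!: linear_continuous_on)
  let ?J = "\<lambda>u. integral UNIV (\<lambda>x. f (flow A u *v x))"
  let ?T = "\<bar>u\<bar>"
  have J: "?J v = integral (cube (?N ?T)) (\<lambda>x. f (flow A v *v x))" if "\<bar>v\<bar> \<le> ?T" for v
    by (rule integral_UNIV_eq_cube[OF cont_u supp'[OF _ that]]) auto
  have der_u: "((\<lambda>u. f (flow A u *v x)) has_real_derivative
      frechet_derivative f (at (flow A v *v x)) (A *v (flow A v *v x))) (at v within S)" for x v S
  proof -
    have "((\<lambda>u. flow A u *v x) has_derivative (\<lambda>h. h *\<^sub>R (A *v (flow A v *v x)))) (at v within S)"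
      using flow_has_vector_derivative_vec by (simp add: has_vector_derivative_def)
    from has_derivative_compose[OF this C1_has_derivative[OF f]]
    have "((\<lambda>u. f (flow A u *v x)) has_derivative (\<lambda>h. frechet_derivative f (at (flow A v *v x))
       (h *\<^sub>R (A *v (flow A v *v x))))) (at v within S)" .
    moreover have "linear (frechet_derivative f (at (flow A v *v x)))"
      using f by (intro linear_frechet_derivative) auto
    ultimately show ?thesis
      by (simp add: has_field_derivative_def linear_scale mult_commute_abs)
  qed
  have deriv: "(?J has_real_derivative - trace A * ?J v) (at v within {-?T..?T})" if v: "v \<in> {-?T..?T}" for v
  proof -
    have "((\<lambda>u. integral (cube (?N ?T)) (\<lambda>x. f (flow A u *v x))) has_real_derivative
      integral (cube (?N ?T)) (\<lambda>x. frechet_derivative f (at (flow A v *v x)) (A *v (flow A v *v x))))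
      (at v within {-?T..?T})"
      unfolding cube_def
    proof (rule leibniz_rule_field_derivative[where fx =
          "\<lambda>u x. frechet_derivative f (at (flow A u *v x)) (A *v (flow A u *v x))"])
      show "(\<lambda>x. f (flow A u *v x)) integrable_on cbox a b" for u a b
        by (rule integrable_continuous) (rule continuous_on_subset[OF cont_u], simp)
      have orb: "continuous_on S (\<lambda>p. flow A (fst p) *v snd p)" for S
        by (intro bounded_bilinear.continuous_on[OF bounded_bilinear_matrix_vector_mult]
          continuous_on_compose2[OF flow_continuous[of UNIV]] continuous_intros) auto
      have eq: "frechet_derivative f (at (flow A u *v x)) (A *v (flow A u *v x)) =
        (\<Sum>i\<in>UNIV. (A *v (flow A u *v x)) $ i * frechet_derivative f (at (flow A u *v x)) (axis i 1))" for u x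
        by (rule frechet_derivative_cart_sum) (use f in auto)
      have o2: "continuous_on S (\<lambda>p. A *v (flow A (fst p) *v snd p))" for S
        by (rule linear_continuous_on_compose[OF orb]) simp
      have "continuous_on S (\<lambda>p. \<Sum>i\<in>UNIV. (A *v (flow A (fst p) *v snd p)) $ i *
        frechet_derivative f (at (flow A (fst p) *v snd p)) (axis i 1))" for S
        by (intro continuous_intros continuous_on_compose2[OF C1_continuous_deriv[OF f] orb] o2) auto
      then show "continuous_on ({-?T..?T} \<times> cbox a b)
          (\<lambda>(u, x). frechet_derivative f (at (flow A u *v x)) (A *v (flow A u *v x)))" for a b
        by (simp add: eq case_prod_beta)
    qed (use v in \<open>auto intro: der_u\<close>)
    moreover have "integral (cube (?N ?T)) (\<lambda>x. frechet_derivative f (at (flow A v *v x)) (A *v (flow A v *v x)))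
        = - trace A * ?J v"
    proof -
      let ?g = "\<lambda>x. f (flow A v *v x)"
      have g: "Ck_on (Suc 0) ?g UNIV" by (rule Ck_on_compose_linear[OF open_UNIV _ f]) auto
      have vT: "\<bar>v\<bar> \<le> ?T" using v by (auto simp: abs_le_iff)
      have fr: "frechet_derivative ?g (at x) w = frechet_derivative f (at (flow A v *v x)) (flow A v *v w)" for x w
      proof -
        have "(?g has_derivative (\<lambda>w. frechet_derivative f (at (flow A v *v x)) (flow A v *v w))) (at x)"
          by (rule has_derivative_compose[OF _ C1_has_derivative[OF f]])
            (intro bounded_linear_imp_has_derivative matrix_vector_mul_bounded_linear)
        then show ?thesis by (simp add: frechet_derivative_at[symmetric])
      qed
      have comm: "A *v (flow A v *v x) = flow A v *v (A *v x)" for x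
        by (simp add: matrix_vector_mul_assoc flow_commute)
      let ?k = "\<lambda>x. frechet_derivative ?g (at x) (A *v x)"
      have "continuous_on UNIV (\<lambda>x. \<Sum>i\<in>UNIV. (A *v x) $ i * frechet_derivative ?g (at x) (axis i 1))"
        by (intro continuous_intros C1_continuous_deriv g linear_continuous_on) auto
      moreover have "?k = (\<lambda>x. \<Sum>i\<in>UNIV. (A *v x) $ i * frechet_derivative ?g (at x) (axis i 1))"
        by (rule ext, rule frechet_derivative_cart_sum) (use g in auto)
      ultimately have "continuous_on UNIV ?k" by (simp only:)
      then have "integral UNIV ?k = integral (cube (?N ?T)) ?k"
        by (rule integral_UNIV_eq_cube[where R = "?N ?T"])
          (auto intro: frechet_derivative_zero_outside[of "?N ?T"] supp'[OF _ vT])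
      then show ?thesis
        using integral_divergence[OF g supp'[OF _ vT], where A = A] by (simp add: fr comm)
    qed
    ultimately have "((\<lambda>u. integral (cube (?N ?T)) (\<lambda>x. f (flow A u *v x))) has_real_derivative
       - trace A * ?J v) (at v within {-?T..?T})" by simp
    then show ?thesis
      by (rule has_field_derivative_transform_within[OF _ zero_less_one v]) (use J in \<open>auto simp: abs_le_iff\<close>)
  qed
  have "((\<lambda>u. exp (u * trace A) * ?J u) has_real_derivative 0) (at v within {-?T..?T})"
    if "v \<in> {-?T..?T}" for v
    by (rule derivative_eq_intros deriv that refl | simp)+
  then obtain k where "\<And>v. v \<in> {-?T..?T} \<Longrightarrow> exp (v * trace A) * ?J v = k"
    using has_field_derivative_zero_constant[of "{-?T..?T}" "\<lambda>u. exp (u * trace A) * ?J u"] by auto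
  then have "exp (u * trace A) * ?J u = exp (0 * trace A) * ?J 0"
    by (metis abs_ge_self abs_ge_zero abs_minus_cancel atLeastAtMost_iff minus_le_iff neg_le_0_iff_le)
  then show ?thesis by (simp add: exp_minus field_simps)
qed

subsection \<open>Lattice sums of compactly supported functions\<close>

text \<open>A derivative of a periodic function has a zero on each period, so it is bounded by the next
  derivative; hence all of them are bounded by the highest one.\<close>

lemma periodic_oscillation:
  fixes d :: "nat \<Rightarrow> real \<Rightarrow> real"
  assumes deriv: "\<And>k t. k < p \<Longrightarrow> (d k has_real_derivative d (Suc k) t) (at t)"
    and per: "\<And>k. k < p \<Longrightarrow> d k 1 = d k 0"
    and bound: "\<And>t. t \<in> {0..1} \<Longrightarrow> \<bar>d p t\<bar> \<le> B" and p: "p \<ge> 1" and t: "t \<in> {0..1}"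
  shows "\<bar>d 0 t - d 0 0\<bar> \<le> B"
proof -
  have B: "B \<ge> 0" using bound[of 0] by (meson abs_ge_zero order_trans atLeastAtMost_iff order_refl zero_le_one)
  have mvt: "\<bar>d k x - d k y\<bar> \<le> B" if k: "k < p" and next_: "\<And>t. t \<in> {0..1} \<Longrightarrow> \<bar>d (Suc k) t\<bar> \<le> B"
    and "x \<in> {0..1}" "y \<in> {0..1}" for k x y
  proof -
    have "norm (d k x - d k y) \<le> B * norm (x - y)"
      by (rule field_differentiable_bound[of "{0..1}" "d k" "d (Suc k)"])
        (use that in \<open>auto intro: has_field_derivative_at_within deriv\<close>)
    also have "\<dots> \<le> B * 1" using that B by (intro mult_left_mono) auto
    finally show ?thesis by simp
  qed
  \<comment> \<open>Rolle's theorem provides a zero of \<open>d k\<close> only where it is the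
    derivative of \<open>d (k - 1)\<close>, hence the restriction to k \<ge> 1 in this downward
    induction.\<close>
  have "k \<ge> 1 \<longrightarrow> (\<forall>t\<in>{0..1}. \<bar>d k t\<bar> \<le> B)" if "k \<le> p" for k
    using that
  proof (induction rule: inc_induct)
    case base then show ?case using bound by blast
  next
    case (step k)
    then have next_: "\<And>t. t \<in> {0..1} \<Longrightarrow> \<bar>d (Suc k) t\<bar> \<le> B" by simp
    show ?case
    proof (intro impI ballI)
      fix t :: real assume k: "1 \<le> k" and t: "t \<in> {0..1}"
      then obtain j where j: "k = Suc j" "j < p" using step by (cases k) auto
      have "\<exists>z>0. z < 1 \<and> DERIV (d j) z :> 0"
        using deriv[OF j(2)] per[OF j(2)]
        by (intro Rolle) (auto intro!: continuous_at_imp_continuous_on DERIV_isCont simp: real_differentiable_def)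
      then obtain z where z: "z \<in> {0..1}" "DERIV (d j) z :> 0" by (auto intro: less_imp_le)
      then have "d k z = 0" using DERIV_unique[OF z(2) deriv[OF j(2), of z]] j by simp
      then show "\<bar>d k t\<bar> \<le> B" using mvt[OF _ next_ t z(1)] step by simp
    qed
  qed
  then show ?thesis using mvt[of 0 t 0] p t by auto
qed

definition lattice_ball :: "real \<Rightarrow> (real^'n) set" where
  "lattice_ball \<rho> = {\<omega> \<in> integer_lattice. norm \<omega> \<le> \<rho>}"

lemma finite_card_lattice_ball:
  assumes "\<rho> \<ge> 0"
  shows "finite (lattice_ball \<rho> :: (real^'n) set)"
    "real (card (lattice_ball \<rho> :: (real^'n) set)) \<le> (2 * \<rho> + 1) ^ CARD('n)"
proof -
  let ?S = "real_of_int ` {- \<lfloor>\<rho>\<rfloor>..\<lfloor>\<rho>\<rfloor>}" and ?L = "lattice_ball \<rho> :: (real^'n) set"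
  have sub: "vec_nth ` ?L \<subseteq> PiE UNIV (\<lambda>_. ?S)"
  proof (rule image_subsetI)
    fix \<omega> :: "real^'n" assume "\<omega> \<in> ?L"
    then have w: "\<omega> $ i \<in> \<int>" "\<bar>\<omega> $ i\<bar> \<le> \<rho>" for i
      using component_le_norm_cart[of \<omega> i] by (auto simp: lattice_ball_def integer_lattice_def intro: order_trans)
    have "\<omega> $ i \<in> ?S" for i
    proof -
      obtain m where m: "\<omega> $ i = of_int m" using w(1) by (auto elim: Ints_cases)
      then have "m \<le> \<lfloor>\<rho>\<rfloor>" "- m \<le> \<lfloor>\<rho>\<rfloor>" using w(2)[of i] by (auto simp: le_floor_iff)
      then show ?thesis using m by auto
    qed
    then show "vec_nth \<omega> \<in> PiE UNIV (\<lambda>_. ?S)" by auto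
  qed
  have fin: "finite (PiE (UNIV :: 'n set) (\<lambda>_. ?S))" by (intro finite_PiE) auto
  have inj: "inj_on vec_nth ?L" by (auto intro!: inj_onI simp: vec_eq_iff)
  show "finite ?L" using finite_imageD[OF finite_subset[OF sub fin] inj] .
  have "card ?L \<le> card (PiE (UNIV :: 'n set) (\<lambda>_. ?S))"
    using card_mono[OF fin sub] by (simp add: card_image[OF inj])
  also have "\<dots> = card ?S ^ CARD('n)" by (simp add: card_PiE)
  also have "card ?S = nat (2 * \<lfloor>\<rho>\<rfloor> + 1)" by (subst card_image) (auto simp: inj_on_def)
  finally have "real (card ?L) \<le> real (nat (2 * \<lfloor>\<rho>\<rfloor> + 1)) ^ CARD('n)"
    by (metis of_nat_le_iff of_nat_power)
  also have "\<dots> \<le> (2 * \<rho> + 1) ^ CARD('n)"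
    using assms by (intro power_mono) auto
  finally show "real (card ?L) \<le> (2 * \<rho> + 1) ^ CARD('n)" .
qed

lemma integer_lattice_add: "x \<in> integer_lattice \<Longrightarrow> y \<in> integer_lattice \<Longrightarrow> x + y \<in> integer_lattice"
  by (auto simp: integer_lattice_def)

lemma integer_lattice_axis: "axis i 1 \<in> integer_lattice" "- axis i 1 \<in> integer_lattice"
  by (auto simp: integer_lattice_def axis_def)

lemma norm_unit_cube_le:
  fixes y :: "real^'n"
  assumes "\<And>i. y $ i \<in> {0..1}"
  shows "norm y \<le> real CARD('n)"
proof -
  have "norm y \<le> (\<Sum>i\<in>UNIV. \<bar>y $ i\<bar>)" by (rule norm_le_l1_cart)
  also have "\<dots> \<le> (\<Sum>i\<in>(UNIV::'n set). 1)" using assms by (intro sum_mono) auto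
  finally show ?thesis by simp
qed

text \<open>Unfolding: the lattice translates of the unit cube tile the space.\<close>

lemma integral_unfold:
  fixes h :: "real^'n \<Rightarrow> real"
  assumes h: "continuous_on UNIV h" and supp: "\<And>x. norm x > R \<Longrightarrow> h x = 0" and R: "R \<ge> 0"
  defines "\<rho> \<equiv> R + real CARD('n)"
  shows "integral (cbox 0 (\<chi> i. 1)) (\<lambda>y. \<Sum>\<omega>\<in>lattice_ball \<rho>. h (y + \<omega>)) = integral UNIV h"
proof -
  let ?Q = "\<lambda>\<omega>::real^'n. cbox \<omega> (\<omega> + (\<chi> i. 1))"
  have fin: "finite (lattice_ball \<rho> :: (real^'n) set)" using R by (intro finite_card_lattice_ball) (simp add: \<rho>_def)
  have int: "h integrable_on cbox a b" for a b
    by (rule integrable_continuous) (rule continuous_on_subset[OF h], simp)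
  have "(h has_integral (\<Sum>\<omega>\<in>lattice_ball \<rho>. integral (?Q \<omega>) h)) (\<Union>\<omega>\<in>lattice_ball \<rho>. ?Q \<omega>)"
  proof (rule has_integral_UN[OF fin])
    show "(h has_integral integral (?Q \<omega>) h) (?Q \<omega>)" for \<omega> by (rule integrable_integral[OF int])
    \<comment> \<open>Distinct lattice points differ by at least 1 in some coordinate, so their unit
      cubes meet at most in a hyperplane.\<close>
    have neg: "negligible (?Q \<omega> \<inter> ?Q \<nu>)" if "\<omega> $ i < \<nu> $ i" "\<omega> \<in> integer_lattice" "\<nu> \<in> integer_lattice" for \<omega> \<nu> i
    proof (rule negligible_subset)
      show "negligible {x :: real^'n. x $ i = \<nu> $ i}"
        using negligible_hyperplane[of "axis i 1 :: real^'n" "\<nu> $ i"]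
        by (simp add: inner_axis' axis_eq_0_iff)
      have "\<omega> $ i \<in> \<int>" "\<nu> $ i \<in> \<int>" using that by (auto simp: integer_lattice_def)
      then have "\<omega> $ i + 1 \<le> \<nu> $ i" using that(1) by (auto elim!: Ints_cases)
      then show "?Q \<omega> \<inter> ?Q \<nu> \<subseteq> {x. x $ i = \<nu> $ i}"
        by (auto simp: mem_box_cart) (meson order_antisym order_trans)
    qed
    show "pairwise (\<lambda>\<omega> \<nu>. negligible (?Q \<omega> \<inter> ?Q \<nu>)) (lattice_ball \<rho>)"
    proof (rule pairwiseI)
      fix \<omega> \<nu> :: "real^'n" assume *: "\<omega> \<in> lattice_ball \<rho>" "\<nu> \<in> lattice_ball \<rho>" "\<omega> \<noteq> \<nu>"
      then obtain i where "\<omega> $ i \<noteq> \<nu> $ i" by (auto simp: vec_eq_iff)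
      then consider "\<omega> $ i < \<nu> $ i" | "\<nu> $ i < \<omega> $ i" by linarith
      then show "negligible (?Q \<omega> \<inter> ?Q \<nu>)"
        using neg[of \<omega> i \<nu>] neg[of \<nu> i \<omega>] * by cases (auto simp: lattice_ball_def Int_commute)
    qed
  qed
  then have "(h has_integral (\<Sum>\<omega>\<in>lattice_ball \<rho>. integral (?Q \<omega>) h)) UNIV"
  proof (rule has_integral_on_superset)
    fix x :: "real^'n" assume x: "x \<notin> (\<Union>\<omega>\<in>lattice_ball \<rho>. ?Q \<omega>)"
    let ?\<omega> = "(\<chi> i. of_int \<lfloor>x $ i\<rfloor>) :: real^'n"
    show "h x = 0"
    proof (rule supp, rule ccontr)
      assume "\<not> norm x > R"
      have "norm (x - ?\<omega>) \<le> real CARD('n)"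
      proof (rule norm_unit_cube_le)
        show "(x - ?\<omega>) $ i \<in> {0..1}" for i
          using floor_correct[of "x $ i"] by (auto simp: algebra_simps intro: less_imp_le)
      qed
      then have "norm ?\<omega> \<le> \<rho>"
        using \<open>\<not> norm x > R\<close> norm_triangle_ineq2[of ?\<omega> x] unfolding \<rho>_def by (simp add: norm_minus_commute)
      then have "?\<omega> \<in> lattice_ball \<rho>" by (simp add: lattice_ball_def integer_lattice_def)
      moreover have "x \<in> ?Q ?\<omega>"
        using floor_correct by (auto simp: mem_box_cart intro: less_imp_le)
      ultimately show False using x by blast
    qed
  qed simp
  then have "integral UNIV h = (\<Sum>\<omega>\<in>lattice_ball \<rho>. integral (?Q \<omega>) h)" by (rule integral_unique)
  also have "\<dots> = (\<Sum>\<omega>\<in>lattice_ball \<rho>. integral (cbox 0 (\<chi> i. 1)) (\<lambda>y. h (y + \<omega>)))"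
    using integral_shift_cbox[of "\<omega>" "\<omega>" "\<omega> + (\<chi> i. 1)" h for \<omega>] by simp
  also have "\<dots> = integral (cbox 0 (\<chi> i. 1)) (\<lambda>y. \<Sum>\<omega>\<in>lattice_ball \<rho>. h (y + \<omega>))"
    by (rule integral_sum[symmetric, OF fin], rule integrable_continuous,
        rule continuous_on_compose2[OF h]) (auto intro!: continuous_intros)
  finally show ?thesis by simp
qed

text \<open>A sum over a fixed ball is not visibly periodic. But points of the unit cube have norm
  at most \<open>CARD('n)\<close>, so the radius \<rho> captures every nonzero term both for y and
  for its translate, and the shift is a mere reindexing.\<close>

lemma lattice_sum_translate:
  fixes g :: "real^'n \<Rightarrow> real"
  assumes supp: "\<And>x. norm x > R \<Longrightarrow> g x = 0" and R: "R \<ge> 0"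
    and y: "\<And>i. y $ i \<in> {0..1}" "\<And>i. (y + axis j 1) $ i \<in> {0..1}"
  defines "\<rho> \<equiv> R + real CARD('n)"
  shows "(\<Sum>\<omega>\<in>lattice_ball \<rho>. g (\<omega> + (y + axis j 1))) = (\<Sum>\<omega>\<in>lattice_ball \<rho>. g (\<omega> + y))"
proof -
  have fin: "finite (lattice_ball \<rho> :: (real^'n) set)" using R by (intro finite_card_lattice_ball) (simp add: \<rho>_def)
  have mem: "\<omega> \<in> lattice_ball \<rho>" if "g (\<omega> + z) \<noteq> 0" "\<And>i. z $ i \<in> {0..1}" "\<omega> \<in> integer_lattice" for \<omega> z
  proof -
    have "norm (\<omega> + z) \<le> R" using supp that(1) by force
    moreover have "norm z \<le> real CARD('n)" using norm_unit_cube_le that(2) .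
    ultimately have "norm \<omega> \<le> \<rho>" using norm_diff_ineq[of \<omega> z] unfolding \<rho>_def by linarith
    then show ?thesis using that(3) by (simp add: lattice_ball_def)
  qed
  have lat: "\<omega> \<in> lattice_ball \<rho> \<Longrightarrow> \<omega> \<in> integer_lattice" for \<omega> :: "real^'n" by (simp add: lattice_ball_def)
  have "(\<Sum>\<omega>\<in>lattice_ball \<rho>. g (\<omega> + (y + axis j 1)))
      = (\<Sum>\<omega>\<in>{\<omega>\<in>lattice_ball \<rho>. g (\<omega> + (y + axis j 1)) \<noteq> 0}. g (\<omega> + (y + axis j 1)))"
    by (rule sum.mono_neutral_right[OF fin]) auto
  also have "\<dots> = (\<Sum>\<omega>\<in>{\<omega>\<in>lattice_ball \<rho>. g (\<omega> + y) \<noteq> 0}. g (\<omega> + y))"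
  proof (rule sum.reindex_bij_witness[of _ "\<lambda>\<omega>. \<omega> - axis j 1" "\<lambda>\<omega>. \<omega> + axis j 1"])
    show "\<omega> + axis j 1 \<in> {\<omega>\<in>lattice_ball \<rho>. g (\<omega> + y) \<noteq> 0}"
      if "\<omega> \<in> {\<omega>\<in>lattice_ball \<rho>. g (\<omega> + (y + axis j 1)) \<noteq> 0}" for \<omega>
      using that lat integer_lattice_add[OF _ integer_lattice_axis(1)] mem[of "\<omega> + axis j 1" y] y(1)
      by (auto simp: algebra_simps)
    show "\<omega> - axis j 1 \<in> {\<omega>\<in>lattice_ball \<rho>. g (\<omega> + (y + axis j 1)) \<noteq> 0}"
      if "\<omega> \<in> {\<omega>\<in>lattice_ball \<rho>. g (\<omega> + y) \<noteq> 0}" for \<omega>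
      using that lat integer_lattice_add[OF _ integer_lattice_axis(2)] mem[of "\<omega> - axis j 1" "y + axis j 1"] y(2)
      by (auto simp: algebra_simps)
  qed (auto simp: algebra_simps)
  also have "\<dots> = (\<Sum>\<omega>\<in>lattice_ball \<rho>. g (\<omega> + y))"
    by (rule sum.mono_neutral_left[OF fin]) auto
  finally show ?thesis .
qed

text \<open>G is the periodisation of f o L: its value at 0 is the lattice sum and its mean over the
  unit cube is the integral, so the error is at most the oscillation of G. By
  \<open>periodic_oscillation\<close> this is controlled by p-th derivatives, each carrying the
  factor l^p, which is small when L contracts. The left inverse M only serves to bound the
  support.\<close>

lemma lattice_sum_core:
  fixes D :: "nat \<Rightarrow> real^'n \<Rightarrow> real^'n \<Rightarrow> real" and L M :: "real^'n^'n"
  assumes p: "p \<ge> 1" and R: "R > 0" and B: "B \<ge> 0" and l: "l \<ge> 0" and m: "m \<ge> 0"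
    and D0: "\<And>w x. D 0 w x = f x" and cont: "continuous_on UNIV f"
    and deriv: "\<And>k w x t. k < p \<Longrightarrow> norm w = 1 \<Longrightarrow>
      ((\<lambda>t. D k w (x + t *\<^sub>R w)) has_real_derivative D (Suc k) w (x + t *\<^sub>R w)) (at t)"
    and vanish: "\<And>k w x. k \<le> p \<Longrightarrow> norm w = 1 \<Longrightarrow> norm x > R \<Longrightarrow> D k w x = 0"
    and supp: "\<And>x. norm x > R \<Longrightarrow> f x = 0"
    and bound: "\<And>w x. norm w = 1 \<Longrightarrow> \<bar>D p w x\<bar> \<le> B"
    and LM: "\<And>x. M *v (L *v x) = x"
    and l_bound: "\<And>x. norm (L *v x) \<le> l * norm x" and m_bound: "\<And>x. norm (M *v x) \<le> m * norm x"
  shows "\<bar>(\<Sum>\<^sub>\<infinity>\<omega>\<in>integer_lattice. f (L *v \<omega>)) - integral UNIV (\<lambda>x. f (L *v x))\<bar>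
    \<le> real CARD('n) * (l ^ p * B * (2 * (m * R + real CARD('n)) + 1) ^ CARD('n))"
proof -
  define \<rho> where "\<rho> = m * R + real CARD('n)"
  define E where "E = l ^ p * B * (2 * \<rho> + 1) ^ CARD('n)"
  let ?W = "lattice_ball \<rho> :: (real^'n) set"
  have \<rho>: "\<rho> \<ge> 0" using m R by (simp add: \<rho>_def)
  note fin = finite_card_lattice_ball(1)[OF \<rho>, where 'n = 'n]
  note card_W = finite_card_lattice_ball(2)[OF \<rho>, where 'n = 'n]
  have far: "norm (L *v x) > R" if "norm x > m * R" for x
  proof (rule ccontr)
    assume "\<not> norm (L *v x) > R"
    then have "m * norm (L *v x) \<le> m * R" using m by (intro mult_left_mono) auto
    then show False using m_bound[of "L *v x"] that by (simp add: LM)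
  qed
  define G where "G = (\<lambda>y. \<Sum>\<omega>\<in>?W. f (L *v (\<omega> + y)))"
  have line: "\<bar>G (y + t *\<^sub>R axis j 1) - G y\<bar> \<le> E"
    if y: "\<And>i. y $ i \<in> {0..1}" "y $ j = 0" and t: "t \<in> {0..1}" for y t j
  proof (cases "L *v axis j 1 = 0")
    case True
    then have "L *v (\<omega> + (y + t *\<^sub>R axis j 1)) = L *v (\<omega> + y)" for \<omega>
      by (simp add: matrix_vector_right_distrib matrix_vector_mult_scaleR)
    then show ?thesis using l B \<rho> by (simp add: G_def E_def)
  next
    case False
    \<comment> \<open>The direction is normalised so that the single bound B over unit vectors
      applies; its length a reappears as the factor a^k in \<open>d\<close>.\<close>
    define a where "a = norm (L *v axis j 1)"
    define w where "w = (1 / a) *\<^sub>R (L *v axis j 1)"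
    have a: "a > 0" "a \<le> l" using False l_bound[of "axis j 1"] by (auto simp: a_def)
    have w: "norm w = 1" "a *\<^sub>R w = L *v axis j 1" using a by (auto simp: w_def a_def)
    define d where "d = (\<lambda>k t. \<Sum>\<omega>\<in>?W. a ^ k * D k w (L *v (\<omega> + y) + (a * t) *\<^sub>R w))"
    have arg: "L *v (\<omega> + y) + (a * t) *\<^sub>R w = L *v (\<omega> + (y + t *\<^sub>R axis j 1))" for \<omega> t
    proof -
      have "(a * t) *\<^sub>R w = t *\<^sub>R (L *v axis j 1)" by (simp add: w(2)[symmetric] mult.commute)
      then show ?thesis by (simp add: matrix_vector_right_distrib matrix_vector_mult_scaleR)
    qed
    have "\<bar>d 0 t - d 0 0\<bar> \<le> E"
    proof (rule periodic_oscillation[OF _ _ _ p t, where d = d])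
      fix k t assume k: "k < p"
      have "((\<lambda>t. D k w (L *v (\<omega> + y) + (a * t) *\<^sub>R w)) has_real_derivative
          D (Suc k) w (L *v (\<omega> + y) + (a * t) *\<^sub>R w) * a) (at t)" for \<omega>
        by (rule DERIV_chain2[OF deriv[OF k w(1)]]) (auto intro!: derivative_eq_intros)
      then show "(d k has_real_derivative d (Suc k) t) (at t)"
        unfolding d_def by (auto intro!: derivative_eq_intros sum.cong)
      have "d k 1 = (\<Sum>\<omega>\<in>?W. a ^ k * D k w (L *v (\<omega> + (y + axis j 1))))" by (simp only: d_def arg) simp
      also have "\<dots> = (\<Sum>\<omega>\<in>?W. a ^ k * D k w (L *v (\<omega> + y)))"
        unfolding \<rho>_def
      proof (rule lattice_sum_translate)
        show "a ^ k * D k w (L *v x) = 0" if "norm x > m * R" for x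
          using vanish[OF _ w(1) far[OF that]] k by simp
        show "m * R \<ge> 0" using m R by simp
        show "(y + axis j 1) $ i \<in> {0..1}" for i using y(1)[of i] y(2) by (auto simp: axis_def)
      qed (rule y(1))
      also have "\<dots> = d k 0" by (simp add: d_def)
      finally show "d k 1 = d k 0" .
    next
      fix t :: real
      have "\<bar>d p t\<bar> \<le> (\<Sum>\<omega>\<in>?W. a ^ p * B)"
        unfolding d_def using a bound[OF w(1)]
        by (intro order_trans[OF sum_abs] sum_mono) (auto simp: abs_mult intro!: mult_left_mono)
      also have "\<dots> = a ^ p * B * real (card ?W)" by simp
      also have "\<dots> \<le> E" unfolding E_def
        using a B l card_W by (intro mult_mono power_mono mult_nonneg_nonneg) auto
      finally show "\<bar>d p t\<bar> \<le> E" .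
    qed
    moreover have "d 0 t = G (y + t *\<^sub>R axis j 1)" for t unfolding d_def arg by (simp add: G_def D0)
    moreover have "d 0 0 = G y" by (simp add: d_def G_def D0)
    ultimately show ?thesis by simp
  qed
  \<comment> \<open>The point y is reached from 0 by switching on its coordinates one at a time, at
    the cost E each; this is why \<open>line\<close> starts at points with y $ j = 0.\<close>
  have osc: "\<bar>G y - G 0\<bar> \<le> real CARD('n) * E" if y: "\<And>i. y $ i \<in> {0..1}" for y
  proof -
    have "\<bar>G (\<chi> i. if i \<in> S then y $ i else 0) - G 0\<bar> \<le> real (card S) * E" if "finite S" for S
      using that
    proof (induction S rule: finite_induct)
      case empty
      have "(\<chi> i::'n. if i \<in> {} then y $ i else 0) = 0" by (simp add: vec_eq_iff)
      then show ?case by simp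
    next
      case (insert j S)
      let ?y = "\<chi> i. if i \<in> S then y $ i else 0"
      have "\<bar>G (?y + (y $ j) *\<^sub>R axis j 1) - G ?y\<bar> \<le> E"
        using insert y by (intro line) auto
      moreover have "(\<chi> i. if i \<in> insert j S then y $ i else 0) = ?y + (y $ j) *\<^sub>R axis j 1"
        using insert by (auto simp: vec_eq_iff axis_def)
      ultimately show ?case using insert by (simp add: algebra_simps)
    qed
    from this[of UNIV] show ?thesis by simp
  qed
  have contG: "continuous_on S G" for S unfolding G_def
    by (intro continuous_intros continuous_on_compose2[OF cont]
      bounded_linear.continuous_on[OF matrix_vector_mul_bounded_linear]) auto
  have vol: "measure lborel (cbox 0 (\<chi> i. 1) :: (real^'n) set) = 1"
  proof -
    have "0 \<in> cbox 0 ((\<chi> i. 1) :: real^'n)" by (simp add: mem_box_cart)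
    then show ?thesis by (subst content_cbox_cart) auto
  qed
  have "((\<lambda>y. G y - G 0) has_integral integral (cbox 0 (\<chi> i. 1)) G - measure lborel (cbox 0 (\<chi> i. 1) :: (real^'n) set) *\<^sub>R G 0)
      (cbox 0 (\<chi> i. 1))"
    by (intro has_integral_diff integrable_integral integrable_continuous contG has_integral_const)
  then have "norm (integral (cbox 0 (\<chi> i. 1)) G - measure lborel (cbox 0 (\<chi> i. 1) :: (real^'n) set) *\<^sub>R G 0)
      \<le> real CARD('n) * E * measure lborel (cbox 0 (\<chi> i. 1) :: (real^'n) set)"
    by (rule has_integral_bound[rotated]) (use osc l B \<rho> in \<open>auto simp: mem_box_cart E_def\<close>)
  then have "\<bar>integral (cbox 0 (\<chi> i. 1)) G - G 0\<bar> \<le> real CARD('n) * E" by (simp add: vol)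
  moreover have "integral (cbox 0 (\<chi> i. 1)) G = integral UNIV (\<lambda>x. f (L *v x))"
  proof -
    have "continuous_on UNIV (\<lambda>x. f (L *v x))"
      by (rule continuous_on_compose2[OF cont]) (auto intro!: linear_continuous_on)
    from integral_unfold[OF this, of "m * R"] far supp m R
    show ?thesis by (simp add: G_def \<rho>_def add.commute)
  qed
  moreover have "(\<Sum>\<^sub>\<infinity>\<omega>\<in>integer_lattice. f (L *v \<omega>)) = G 0"
  proof -
    have "f (L *v \<omega>) = 0" if "\<omega> \<in> integer_lattice - ?W" for \<omega>
    proof (rule supp[OF far])
      show "norm \<omega> > m * R" using that by (auto simp: lattice_ball_def \<rho>_def)
    qed
    then have "(\<Sum>\<^sub>\<infinity>\<omega>\<in>integer_lattice. f (L *v \<omega>)) = (\<Sum>\<^sub>\<infinity>\<omega>\<in>?W. f (L *v \<omega>))"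
      by (intro infsum_cong_neutral) (auto simp: lattice_ball_def)
    then show ?thesis by (simp add: infsum_finite[OF fin] G_def)
  qed
  ultimately show ?thesis unfolding E_def \<rho>_def by (simp add: abs_minus_commute)
qed

text \<open>The direction is the second component of the point itself. Iteration then differentiates
  along one and the same direction, and continuity in parameter, direction and position together
  gives bounds uniform over compact sets.\<close>

definition dir_deriv :: "('p::euclidean_space \<times> (real^'n) \<times> (real^'n) \<Rightarrow> real) \<Rightarrow> 'p \<times> (real^'n) \<times> (real^'n) \<Rightarrow> real"
  where "dir_deriv F z = frechet_derivative F (at z) (0, 0, fst (snd z))"

lemma Ck_on_dir_deriv:
  assumes "Ck_on (Suc k) F UNIV"
  shows "Ck_on k (dir_deriv F) UNIV"
proof -
  have "dir_deriv F = (\<lambda>z. \<Sum>i\<in>UNIV. fst (snd z) $ i * frechet_derivative F (at z) (0, 0, axis i 1))"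
  proof
    fix z :: "'a \<times> (real^'b) \<times> (real^'b)"
    have lin: "linear (frechet_derivative F (at z))"
      by (rule has_derivative_linear[OF Ck_on_Suc_has_derivative[OF assms UNIV_I]])
    have "(0, 0, fst (snd z)) = (\<Sum>i\<in>UNIV. fst (snd z) $ i *\<^sub>R (0 :: 'a, 0 :: real^'b, axis i 1 :: real^'b))"
      by (simp add: prod_eq_iff fst_sum snd_sum basis_expansion scalar_mult_eq_scaleR[symmetric])
    then show "dir_deriv F z = (\<Sum>i\<in>UNIV. fst (snd z) $ i * frechet_derivative F (at z) (0, 0, axis i 1))"
      unfolding dir_deriv_def by (simp only: linear_sum[OF lin] linear_scale[OF lin] real_scaleR_def)
  qed
  moreover have "Ck_on k (\<lambda>z. \<Sum>i\<in>UNIV. fst (snd z) $ i * frechet_derivative F (at z) (0, 0, axis i 1)) UNIV"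
  proof (intro Ck_on_sum Ck_on_mult open_UNIV)
    show "Ck_on k (\<lambda>z. fst (snd z) $ i) UNIV" for i
      by (intro Ck_on_bounded_linear bounded_linear_compose[OF bounded_linear_vec_nth]
          bounded_linear_compose[OF bounded_linear_fst] bounded_linear_snd)
    show "Ck_on k (\<lambda>z. frechet_derivative F (at z) (0, 0, axis i 1)) UNIV" for i
      using assms unfolding Ck_on.simps(2) by blast
  qed
  ultimately show ?thesis by (simp only:)
qed

lemma Ck_on_dir_deriv_funpow:
  "Ck_on (j + k) F UNIV \<Longrightarrow> Ck_on k ((dir_deriv ^^ j) F) UNIV"
proof (induction j arbitrary: k)
  case (Suc j)
  then have "Ck_on (Suc k) ((dir_deriv ^^ j) F) UNIV" by (simp add: Suc.IH del: Ck_on.simps)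
  then show ?case by (simp add: Ck_on_dir_deriv del: Ck_on.simps)
qed simp

lemma dir_deriv_line:
  assumes "Ck_on (Suc k) F UNIV"
  shows "((\<lambda>t. F (q, w, x + t *\<^sub>R w)) has_real_derivative dir_deriv F (q, w, x + t *\<^sub>R w)) (at t)"
proof -
  let ?z = "(q, w, x + t *\<^sub>R w)"
  have lin: "linear (frechet_derivative F (at ?z))"
    by (rule has_derivative_linear[OF Ck_on_Suc_has_derivative[OF assms UNIV_I]])
  have "((\<lambda>t. (q, w, x + t *\<^sub>R w)) has_derivative (\<lambda>h. (0, 0, h *\<^sub>R w))) (at t)"
    by (auto intro!: derivative_eq_intros has_derivative_Pair)
  from has_derivative_compose[OF this Ck_on_Suc_has_derivative[OF assms UNIV_I]]
  have "((\<lambda>t. F (q, w, x + t *\<^sub>R w)) has_derivative (\<lambda>h. frechet_derivative F (at ?z) (0, 0, h *\<^sub>R w))) (at t)" .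
  moreover have "frechet_derivative F (at ?z) (0, 0, h *\<^sub>R w) = h * dir_deriv F ?z" for h
    using linear_scale[OF lin, of h "(0, 0, w)"] by (simp add: dir_deriv_def)
  ultimately show ?thesis by (simp add: has_field_derivative_def mult_commute_abs)
qed

lemma dir_deriv_vanish:
  assumes "\<And>q w x. norm x > R \<Longrightarrow> F (q, w, x) = 0" "norm x > R"
  shows "dir_deriv F (q, w, x) = 0"
proof -
  have "((\<lambda>_. 0) has_derivative (\<lambda>_. 0)) (at (q, w, x))" by simp
  then have "(F has_derivative (\<lambda>_. 0)) (at (q, w, x))"
    by (rule has_derivative_transform_within_open[of _ _ _ _ "{z. norm (snd (snd z)) > R}"])
      (use assms in \<open>auto intro!: open_Collect_less continuous_intros\<close>)
  then show ?thesis unfolding dir_deriv_def by (simp add: frechet_derivative_at[symmetric])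
qed

lemma dir_deriv_funpow_vanish:
  assumes "\<And>q w x. norm x > R \<Longrightarrow> F (q, w, x) = 0" "norm x > R"
  shows "(dir_deriv ^^ k) F (q, w, x) = 0"
  using assms(2)
proof (induction k arbitrary: q w x)
  case 0 then show ?case using assms(1) by simp
next
  case (Suc k) then show ?case by (simp add: dir_deriv_vanish[of R])
qed

text \<open>Here L = flow A (- v). Each derivative gains e^(- c v), while the bound for the number
  of lattice points grows like e^(a n v); p is chosen with c p \<ge> |N| + a n. It depends on A and
  N alone, so cut-offs of class C^p can be picked afterwards.\<close>

lemma flow_lattice_sum:
  fixes A :: "real^'n^'n" and N :: real
  assumes A: "A \<in> M_plus"
  obtains p :: nat where "p \<ge> 1"
    "\<And>(F :: 'p::euclidean_space \<times> (real^'n) \<Rightarrow> real) R K. \<lbrakk>Ck_on p F UNIV; \<And>q x. norm x > R \<Longrightarrow> F (q, x) = 0;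
       R > 0; compact K\<rbrakk> \<Longrightarrow> \<exists>C. \<forall>q\<in>K. \<forall>v\<ge>0.
      \<bar>(\<Sum>\<^sub>\<infinity>\<omega>\<in>integer_lattice. F (q, flow A (- v) *v \<omega>)) - exp (v * trace A) * integral UNIV (\<lambda>x. F (q, x))\<bar>
        \<le> C * exp (- N * v)"
proof -
  obtain C c where C: "C > 0" and c: "c > 0" and
    decay: "\<And>u x. u \<ge> 0 \<Longrightarrow> norm (flow A (- u) *v x) \<le> C * exp (- c * u) * norm x"
    using flow_decay[OF A] by blast
  define a where "a = entry_bound A"
  have a: "a \<ge> 0" by (simp add: a_def entry_bound_nonneg)
  define n where "n = real CARD('n)"
  have n: "n \<ge> 1" by (simp add: n_def Suc_le_eq)
  define p where "p = nat \<lceil>(\<bar>N\<bar> + a * n) / c\<rceil> + 1"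
  have p: "p \<ge> 1" by (simp add: p_def)
  have "(\<bar>N\<bar> + a * n) / c \<le> real p" unfolding p_def by linarith
  then have cp: "\<bar>N\<bar> + a * n \<le> c * real p" using c by (simp add: field_simps)
  show ?thesis
  proof (rule that[OF p])
    fix F :: "'p \<times> (real^'n) \<Rightarrow> real" and R and K :: "'p set"
    assume F: "Ck_on p F UNIV" and supp: "\<And>q x. norm x > R \<Longrightarrow> F (q, x) = 0" and R: "R > 0" and K: "compact K"
    define H where "H = (\<lambda>z :: 'p \<times> (real^'n) \<times> (real^'n). F (fst z, snd (snd z)))"
    have H: "Ck_on p H UNIV" unfolding H_def
      by (rule Ck_on_compose_linear[OF open_UNIV _ F])
        (auto intro!: bounded_linear_Pair bounded_linear_fst bounded_linear_compose[OF bounded_linear_snd bounded_linear_snd])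
    have suppH: "norm x > R \<Longrightarrow> H (q, w, x) = 0" for q w x using supp by (simp add: H_def)
    have "continuous_on UNIV ((dir_deriv ^^ p) H)"
      using Ck_on_dir_deriv_funpow[of p 0 H] H by simp
    moreover have "compact (K \<times> sphere 0 1 \<times> cball 0 R :: ('p \<times> (real^'n) \<times> (real^'n)) set)"
      using K by (intro compact_Times) auto
    ultimately have "bounded ((dir_deriv ^^ p) H ` (K \<times> sphere 0 1 \<times> cball 0 R))"
      by (intro compact_imp_bounded compact_continuous_image) (auto intro: continuous_on_subset)
    then obtain B where B: "B > 0" and Bb: "\<And>z. z \<in> K \<times> sphere 0 1 \<times> cball 0 R \<Longrightarrow> \<bar>(dir_deriv ^^ p) H z\<bar> \<le> B"
      unfolding bounded_pos by auto
    let ?C = "n * C ^ p * B * (2 * (n ^ 2 * R + n) + 1) ^ CARD('n)"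
    have "\<bar>(\<Sum>\<^sub>\<infinity>\<omega>\<in>integer_lattice. F (q, flow A (- v) *v \<omega>)) - exp (v * trace A) * integral UNIV (\<lambda>x. F (q, x))\<bar>
        \<le> ?C * exp (- N * v)" if q: "q \<in> K" and v: "v \<ge> 0" for q v
    proof -
      define l where "l = C * exp (- c * v)"
      define m where "m = n ^ 2 * exp (a * v)"
      have fC: "Ck_on p (\<lambda>x. F (q, x)) UNIV"
      proof -
        have "Ck_on k (\<lambda>x. F (q, x)) UNIV" if "Ck_on k F UNIV" for k using that
        proof (induction k arbitrary: F)
          case 0 then show ?case by (auto intro!: continuous_on_compose2[of UNIV F] continuous_intros)
        next
          case (Suc k)
          show ?case
          proof (rule Ck_on_SucI[OF open_UNIV])
            have "((\<lambda>x. (q, x)) has_derivative (\<lambda>v. (0, v))) (at x)" for x :: "real^'n"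
              by (auto intro!: derivative_eq_intros)
            from has_derivative_compose[OF this Ck_on_Suc_has_derivative[OF Suc.prems UNIV_I]]
            show "((\<lambda>x. F (q, x)) has_derivative (\<lambda>v. frechet_derivative F (at (q, x)) (0, v))) (at x)" for x .
            show "Ck_on k (\<lambda>x. frechet_derivative F (at (q, x)) (0, v)) UNIV" for v
              using Suc.IH[of "\<lambda>z. frechet_derivative F (at z) (0, v)"] Suc.prems by simp
          qed
        qed
        then show ?thesis using F by blast
      qed
      have "\<bar>(\<Sum>\<^sub>\<infinity>\<omega>\<in>integer_lattice. F (q, flow A (- v) *v \<omega>)) - integral UNIV (\<lambda>x. F (q, flow A (- v) *v x))\<bar>
        \<le> real CARD('n) * (l ^ p * B * (2 * (m * R + real CARD('n)) + 1) ^ CARD('n))"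
      proof (rule lattice_sum_core[where D = "\<lambda>k w x. (dir_deriv ^^ k) H (q, w, x)" and M = "flow A v"
            and f = "\<lambda>x. F (q, x)" and p = p and R = R])
        show "continuous_on UNIV (\<lambda>x. F (q, x))" using fC by (rule Ck_on_imp_continuous_on)
        show "((\<lambda>t. (dir_deriv ^^ k) H (q, w, x + t *\<^sub>R w)) has_real_derivative
            (dir_deriv ^^ Suc k) H (q, w, x + t *\<^sub>R w)) (at t)" if "k < p" for k w x t
        proof -
          have "Ck_on (k + Suc 0) H UNIV" by (rule Ck_on_le[OF H]) (use that in simp)
          then have "Ck_on (Suc 0) ((dir_deriv ^^ k) H) UNIV" by (rule Ck_on_dir_deriv_funpow)
          from dir_deriv_line[OF this] show ?thesis by simp
        qed
        show "(dir_deriv ^^ k) H (q, w, x) = 0" if "norm x > R" for k w x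
          by (rule dir_deriv_funpow_vanish[of R H, OF suppH that])
        show "\<bar>(dir_deriv ^^ p) H (q, w, x)\<bar> \<le> B" if "norm w = 1" for w x
        proof (cases "norm x > R")
          case True then show ?thesis using dir_deriv_funpow_vanish[of R H, OF suppH True] B by simp
        next
          case False then show ?thesis using q that by (intro Bb) auto
        qed
        show "norm (flow A (- v) *v x) \<le> l * norm x" for x using decay[OF v] by (simp add: l_def)
        show "norm (flow A v *v x) \<le> m * norm x" for x
          using norm_flow_vector_le[of A v x] v by (simp add: m_def n_def a_def)
        show "F (q, x) = 0" if "norm x > R" for x by (rule supp[OF that])
      qed (use p R B C n in \<open>auto simp: H_def l_def m_def\<close>)
      also have "integral UNIV (\<lambda>x. F (q, flow A (- v) *v x)) = exp (v * trace A) * integral UNIV (\<lambda>x. F (q, x))"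
        using integral_flow[OF Ck_on_le[OF fC] supp R, where u = "- v" and A = A] p by simp
      also have "real CARD('n) * (l ^ p * B * (2 * (m * R + real CARD('n)) + 1) ^ CARD('n)) \<le> ?C * exp (- N * v)"
      proof -
        have e1: "1 \<le> exp (a * v)" using a v by simp
        have "2 * (m * R + n) + 1 \<le> (2 * (n ^ 2 * R + n) + 1) * exp (a * v)"
          using mult_left_mono[OF e1, of "2 * n + 1"] n by (simp add: m_def algebra_simps)
        then have "(2 * (m * R + n) + 1) ^ CARD('n) \<le> ((2 * (n ^ 2 * R + n) + 1) * exp (a * v)) ^ CARD('n)"
          using n R by (intro power_mono) (auto simp: m_def)
        also have "\<dots> = (2 * (n ^ 2 * R + n) + 1) ^ CARD('n) * exp (a * n * v)"
          by (simp add: power_mult_distrib n_def exp_of_nat_mult[symmetric] mult_ac)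
        finally have "n * (l ^ p * B * (2 * (m * R + n) + 1) ^ CARD('n))
            \<le> n * (l ^ p * B * ((2 * (n ^ 2 * R + n) + 1) ^ CARD('n) * exp (a * n * v)))"
          using n B C by (intro mult_left_mono) (auto simp: l_def)
        also have "\<dots> = ?C * exp ((a * n - c * real p) * v)"
        proof -
          have "l ^ p = C ^ p * exp (- c * real p * v)"
            by (simp add: l_def power_mult_distrib exp_of_nat_mult[symmetric] mult_ac)
          moreover have "exp ((a * n - c * real p) * v) = exp (a * n * v) * exp (- c * real p * v)"
            by (simp add: exp_add[symmetric] left_diff_distrib)
          ultimately show ?thesis by (simp only: mult_ac)
        qed
        also have "\<dots> \<le> ?C * exp (- N * v)"
        proof -
          have "(a * n - c * real p) * v \<le> - N * v" using cp v by (intro mult_right_mono) linarith+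
          then show ?thesis using n B C R by (intro mult_left_mono) auto
        qed
        finally show ?thesis by (simp add: n_def)
      qed
      finally show ?thesis by simp
    qed
    then show "\<exists>C. \<forall>q\<in>K. \<forall>v\<ge>0.
      \<bar>(\<Sum>\<^sub>\<infinity>\<omega>\<in>integer_lattice. F (q, flow A (- v) *v \<omega>)) - exp (v * trace A) * integral UNIV (\<lambda>x. F (q, x))\<bar>
        \<le> C * exp (- N * v)" by blast
  qed
qed

subsection \<open>Analytic continuation of the zeta function\<close>

context dilation
begin

abbreviation \<alpha> :: real where "\<alpha> \<equiv> trace A"

text \<open>The conclusion of \<open>flow_lattice_sum\<close> with a parameter in the plane, which
  will be (Re s, Im s): smoothness k secures the error e^(- N v), locally uniformly in s.\<close>

definition adequate :: "nat \<Rightarrow> real \<Rightarrow> bool" where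
  "adequate k N \<longleftrightarrow> k \<ge> 1 \<and>
    (\<forall>(F :: (real \<times> real) \<times> (real^'n) \<Rightarrow> real) R K. Ck_on k F UNIV \<longrightarrow> (\<forall>q x. norm x > R \<longrightarrow> F (q, x) = 0) \<longrightarrow>
       R > 0 \<longrightarrow> compact K \<longrightarrow> (\<exists>C. \<forall>q\<in>K. \<forall>v\<ge>0.
      \<bar>(\<Sum>\<^sub>\<infinity>\<omega>\<in>integer_lattice. F (q, flow A (- v) *v \<omega>)) - exp (v * \<alpha>) * integral UNIV (\<lambda>x. F (q, x))\<bar>
        \<le> C * exp (- N * v)))"

lemma adequate_exists: "\<exists>k. adequate k N"
proof -
  obtain p :: nat where "p \<ge> 1"
    "\<And>(F :: (real \<times> real) \<times> (real^'n) \<Rightarrow> real) R K. \<lbrakk>Ck_on p F UNIV; \<And>q x. norm x > R \<Longrightarrow> F (q, x) = 0;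
       R > 0; compact K\<rbrakk> \<Longrightarrow> \<exists>C. \<forall>q\<in>K. \<forall>v\<ge>0.
      \<bar>(\<Sum>\<^sub>\<infinity>\<omega>\<in>integer_lattice. F (q, flow A (- v) *v \<omega>)) - exp (v * trace A) * integral UNIV (\<lambda>x. F (q, x))\<bar>
        \<le> C * exp (- N * v)"
    by (rule flow_lattice_sum[OF A_M_plus, of N]) blast
  then show ?thesis unfolding adequate_def by blast
qed

lemma alpha_pos: "\<alpha> > 0"
  by (rule trace_pos[OF A_M_plus])

lemma finite_level_le: "finite {\<omega> \<in> integer_lattice - {0}. level \<omega> \<le> a}"
proof -
  obtain R where R: "R > 0" "\<And>x. x \<noteq> 0 \<Longrightarrow> \<bar>level x\<bar> \<le> a \<Longrightarrow> norm x \<le> R"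
    using level_strip_bounds[of a] by metis
  have "{\<omega> \<in> integer_lattice - {0}. level \<omega> \<le> a} \<subseteq> lattice_ball R"
    using R level_lattice_nonneg by (auto simp: lattice_ball_def)
  then show ?thesis by (rule finite_subset) (use R(1) in \<open>intro finite_card_lattice_ball; simp\<close>)
qed

end

locale zeta_function = dilation A P for A P :: "real^'n^'n" +
  fixes \<psi> :: "real^'n \<Rightarrow> real"
  assumes pos_hom: "positive_homogeneous A \<psi>" and smooth: "smooth_on \<psi> (UNIV - {0})"
begin

lemma psi_pos: "x \<noteq> 0 \<Longrightarrow> \<psi> x > 0"
  using pos_hom by (simp add: positive_homogeneous_def)

lemma psi_flow: "\<psi> (flow A u *v x) = exp u * \<psi> x"
  using pos_hom by (simp add: positive_homogeneous_def homogeneous_iff_flow)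

definition psi_powr :: "complex \<Rightarrow> real^'n \<Rightarrow> complex" where
  "psi_powr s x = complex_of_real (\<psi> x) powr (- s)"

lemma psi_powr_eq: "x \<noteq> 0 \<Longrightarrow> psi_powr s x = exp (- s * of_real (ln (\<psi> x)))"
  using psi_pos[of x] by (simp add: psi_powr_def powr_def Ln_of_real)

lemma norm_psi_powr: "x \<noteq> 0 \<Longrightarrow> norm (psi_powr s x) = \<psi> x powr (- Re s)"
  using psi_pos[of x] by (simp add: psi_powr_eq powr_def)

lemma psi_powr_real: "x \<noteq> 0 \<Longrightarrow> psi_powr (of_real a) x = of_real (\<psi> x powr (- a))"
  using psi_pos[of x] by (simp add: psi_powr_eq powr_def flip: exp_of_real)

lemma holomorphic_psi_powr: "x \<noteq> 0 \<Longrightarrow> (\<lambda>s. psi_powr s x) holomorphic_on S"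
  by (simp add: psi_powr_eq) (intro holomorphic_intros)

lemma psi_powr_flow: "x \<noteq> 0 \<Longrightarrow> psi_powr s (flow A u *v x) = exp (- s * of_real u) * psi_powr s x"
  using psi_pos[of x] by (simp add: psi_powr_eq psi_flow ln_mult exp_add[symmetric] algebra_simps)

text \<open>One piece of the partition along the flow, supported in |level| \<le> \<tau>; its shifts
  by multiples of \<tau> make up \<open>psi_powr\<close> on points of level \<ge> 0. The step \<tau>
  puts the spurious poles at distance 2 pi / \<tau> from each other.\<close>

definition window :: "nat \<Rightarrow> real \<Rightarrow> complex \<Rightarrow> real^'n \<Rightarrow> complex" where
  "window k \<tau> s x = (if x = 0 then 0 else psi_powr s x * of_real (bump k (level x / \<tau>)))"

definition window_sum :: "nat \<Rightarrow> real \<Rightarrow> complex \<Rightarrow> real \<Rightarrow> complex" where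
  "window_sum k \<tau> s v = (\<Sum>\<^sub>\<infinity>\<omega>\<in>integer_lattice. window k \<tau> s (flow A (- v) *v \<omega>))"

text \<open>Real and imaginary parts are integrated separately because the lattice estimates concern
  real functions.\<close>

definition window_int :: "nat \<Rightarrow> real \<Rightarrow> complex \<Rightarrow> complex" where
  "window_int k \<tau> s = Complex (integral UNIV (\<lambda>x. Re (window k \<tau> s x))) (integral UNIV (\<lambda>x. Im (window k \<tau> s x)))"

lemma bump_level_eq_0: "\<tau> > 0 \<Longrightarrow> \<bar>level x\<bar> \<ge> \<tau> \<Longrightarrow> bump k (level x / \<tau>) = 0"
  by (rule bump_eq_0) (simp add: abs_divide)

text \<open>The exponent s is part of the variable, as the estimates must be uniform in it. The
  window vanishes for small |x|, so smoothness extends across x = 0.\<close>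

lemma Ck_on_window:
  assumes \<tau>: "\<tau> > 0"
  shows "Ck_on k (\<lambda>z :: (real \<times> real) \<times> (real^'n). Re (window k \<tau> (Complex (fst (fst z)) (snd (fst z))) (snd z))) UNIV"
    and "Ck_on k (\<lambda>z :: (real \<times> real) \<times> (real^'n). Im (window k \<tau> (Complex (fst (fst z)) (snd (fst z))) (snd z))) UNIV"
proof -
  obtain r R where r: "r > 0" "\<And>x. x \<noteq> 0 \<Longrightarrow> \<bar>level x\<bar> \<le> \<tau> \<Longrightarrow> r \<le> norm x"
    using level_strip_bounds[of \<tau>] by metis
  let ?U = "{z :: (real \<times> real) \<times> (real^'n). snd z \<noteq> 0}"
  let ?V = "{z :: (real \<times> real) \<times> (real^'n). norm (snd z) < r}"
  have U: "open ?U" by (intro open_Collect_neq continuous_intros)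
  have V: "open ?V" by (intro open_Collect_less continuous_intros)
  have UV: "?U \<union> ?V = UNIV" using r by auto
  have lift: "Ck_on k (\<lambda>z. f (snd z)) ?U" if "Ck_on k f (UNIV - {0})" for f :: "real^'n \<Rightarrow> real"
    by (rule Ck_on_compose_linear[OF U bounded_linear_snd that]) auto
  let ?l = "\<lambda>z :: (real \<times> real) \<times> (real^'n). ln (\<psi> (snd z))"
  have l: "Ck_on k ?l ?U"
    by (rule Ck_on_compose[OF U _ lift Ck_on_ln]) (use smooth psi_pos in \<open>auto simp: smooth_on_def\<close>)
  have a: "Ck_on k (\<lambda>z. fst (fst z)) ?U" and b: "Ck_on k (\<lambda>z. snd (fst z)) ?U"
    by (auto intro!: Ck_on_bounded_linear bounded_linear_compose[OF bounded_linear_fst bounded_linear_fst]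
       bounded_linear_compose[OF bounded_linear_snd bounded_linear_fst])
  have e: "Ck_on k (\<lambda>z. exp (- (fst (fst z) * ?l z))) ?U"
    by (rule Ck_on_compose[OF U open_UNIV Ck_on_minus[OF U Ck_on_mult[OF U a l]] Ck_on_exp]) simp
  have c: "Ck_on k (\<lambda>z. cos (snd (fst z) * ?l z)) ?U"
    by (rule Ck_on_compose[OF U open_UNIV Ck_on_mult[OF U b l] Ck_on_sin_cos[THEN conjunct2]]) simp
  have s: "Ck_on k (\<lambda>z. - sin (snd (fst z) * ?l z)) ?U"
    by (intro Ck_on_minus U, rule Ck_on_compose[OF U open_UNIV Ck_on_mult[OF U b l] Ck_on_sin_cos[THEN conjunct1]]) simp
  have lv: "Ck_on k (\<lambda>z. level (snd z) / \<tau>) ?U"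
    unfolding divide_inverse by (intro Ck_on_mult U lift Ck_on_level Ck_on_const)
  have bmp: "Ck_on k (\<lambda>z. bump k (level (snd z) / \<tau>)) ?U"
    by (rule Ck_on_compose[OF U open_UNIV lv Ck_on_bump]) simp
  have V0: "window k \<tau> s (snd z) = 0" if "z \<in> ?V" for z s
  proof (cases "snd z = 0")
    case False
    then have "\<bar>level (snd z)\<bar> > \<tau>" using r(2)[of "snd z"] that by fastforce
    then show ?thesis using bump_level_eq_0[OF \<tau>, of "snd z" k] by (simp add: window_def)
  qed (simp add: window_def)
  have "Ck_on k (\<lambda>z. Re (window k \<tau> (Complex (fst (fst z)) (snd (fst z))) (snd z))) ?U"
    by (rule Ck_on_cong[OF U _ Ck_on_mult[OF U Ck_on_mult[OF U e c] bmp]])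
      (auto simp: window_def psi_powr_eq Re_exp)
  moreover have "Ck_on k (\<lambda>z. Re (window k \<tau> (Complex (fst (fst z)) (snd (fst z))) (snd z))) ?V"
    by (rule Ck_on_cong[OF V _ Ck_on_const[of _ 0]]) (simp only: V0 zero_complex.sel)
  ultimately show "Ck_on k (\<lambda>z. Re (window k \<tau> (Complex (fst (fst z)) (snd (fst z))) (snd z))) UNIV"
    using Ck_on_Un[OF U V] UV by simp
  have "Ck_on k (\<lambda>z. Im (window k \<tau> (Complex (fst (fst z)) (snd (fst z))) (snd z))) ?U"
    by (rule Ck_on_cong[OF U _ Ck_on_mult[OF U Ck_on_mult[OF U e s] bmp]])
      (auto simp: window_def psi_powr_eq Im_exp)
  moreover have "Ck_on k (\<lambda>z. Im (window k \<tau> (Complex (fst (fst z)) (snd (fst z))) (snd z))) ?V"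
    by (rule Ck_on_cong[OF V _ Ck_on_const[of _ 0]]) (simp only: V0 zero_complex.sel)
  ultimately show "Ck_on k (\<lambda>z. Im (window k \<tau> (Complex (fst (fst z)) (snd (fst z))) (snd z))) UNIV"
    using Ck_on_Un[OF U V] UV by simp
qed

lemma window_support:
  assumes "\<tau> > 0"
  obtains R where "R > 0" "\<And>k s x. norm x > R \<Longrightarrow> window k \<tau> s x = 0"
proof -
  obtain R where R: "R > 0" "\<And>x. x \<noteq> 0 \<Longrightarrow> \<bar>level x\<bar> \<le> \<tau> \<Longrightarrow> norm x \<le> R"
    using level_strip_bounds[of \<tau>] by metis
  have "window k \<tau> s x = 0" if "norm x > R" for k s x
  proof (cases "x = 0")
    case False
    then have "\<bar>level x\<bar> > \<tau>" using R(2)[of x] that by fastforce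
    then show ?thesis using bump_level_eq_0[OF assms, of x k] by (simp add: window_def)
  qed (simp add: window_def)
  then show ?thesis using that R(1) by blast
qed

lemma window_flow_nonzero:
  assumes "\<tau> > 0" "window k \<tau> s (flow A (- v) *v x) \<noteq> 0"
  shows "x \<noteq> 0" "level x \<le> v + \<tau>"
proof -
  show x: "x \<noteq> 0" using assms by (auto simp: window_def)
  have "\<bar>level (flow A (- v) *v x)\<bar> < \<tau>"
  proof (rule ccontr)
    assume "\<not> \<bar>level (flow A (- v) *v x)\<bar> < \<tau>"
    then have "bump k (level (flow A (- v) *v x) / \<tau>) = 0" by (intro bump_level_eq_0 assms) simp
    then show False using assms(2) by (simp add: window_def split: if_splits)
  qed
  then show "level x \<le> v + \<tau>" by (simp add: level_flow x)
qed

lemma window_sum_eq_finite: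
  assumes "\<tau> > 0"
  shows "window_sum k \<tau> s v = (\<Sum>\<omega> | \<omega> \<in> integer_lattice - {0} \<and> level \<omega> \<le> v + \<tau>. window k \<tau> s (flow A (- v) *v \<omega>))"
proof -
  have "window_sum k \<tau> s v = (\<Sum>\<^sub>\<infinity>\<omega> | \<omega> \<in> integer_lattice - {0} \<and> level \<omega> \<le> v + \<tau>. window k \<tau> s (flow A (- v) *v \<omega>))"
    unfolding window_sum_def
  proof (rule infsum_cong_neutral)
    show "window k \<tau> s (flow A (- v) *v \<omega>) = 0"
      if "\<omega> \<in> integer_lattice - {\<omega> \<in> integer_lattice - {0}. level \<omega> \<le> v + \<tau>}" for \<omega>
      by (rule ccontr) (use window_flow_nonzero[OF assms, of k s v \<omega>] that in auto)
  qed auto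
  also have "\<dots> = (\<Sum>\<omega> | \<omega> \<in> integer_lattice - {0} \<and> level \<omega> \<le> v + \<tau>. window k \<tau> s (flow A (- v) *v \<omega>))"
    by (rule infsum_finite[OF finite_level_le])
  finally show ?thesis .
qed

lemma window_summable:
  assumes "\<tau> > 0" "S \<subseteq> integer_lattice"
  shows "(\<lambda>\<omega>. window k \<tau> s (flow A (- v) *v \<omega>)) summable_on S"
proof (rule finite_nonzero_values_imp_summable_on)
  show "finite {\<omega> \<in> S. window k \<tau> s (flow A (- v) *v \<omega>) \<noteq> 0}"
    by (rule finite_subset[OF _ finite_level_le[of "v + \<tau>"]])
      (use window_flow_nonzero[OF assms(1)] assms(2) in auto)
qed

lemma window_sum_estimate:
  assumes k: "adequate k N" and \<tau>: "\<tau> > 0" and K: "compact K"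
  obtains C where "C \<ge> 0" "\<And>s v. s \<in> K \<Longrightarrow> v \<ge> 0 \<Longrightarrow>
    norm (window_sum k \<tau> s v - of_real (exp (v * \<alpha>)) * window_int k \<tau> s) \<le> C * exp (- N * v)"
proof -
  obtain R where R: "R > 0" "\<And>k s x. norm x > R \<Longrightarrow> window k \<tau> s x = 0" using window_support[OF \<tau>] by metis
  let ?K = "(\<lambda>s. (Re s, Im s)) ` K"
  have K': "compact ?K" by (intro compact_continuous_image K continuous_intros)
  let ?F = "\<lambda>z :: (real \<times> real) \<times> (real^'n). Re (window k \<tau> (Complex (fst (fst z)) (snd (fst z))) (snd z))"
  let ?G = "\<lambda>z :: (real \<times> real) \<times> (real^'n). Im (window k \<tau> (Complex (fst (fst z)) (snd (fst z))) (snd z))"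
  have "\<exists>C. \<forall>q\<in>?K. \<forall>v\<ge>0. \<bar>(\<Sum>\<^sub>\<infinity>\<omega>\<in>integer_lattice. ?F (q, flow A (- v) *v \<omega>)) - exp (v * \<alpha>) * integral UNIV (\<lambda>x. ?F (q, x))\<bar>
        \<le> C * exp (- N * v)"
    using k Ck_on_window(1)[OF \<tau>, of k] R K' unfolding adequate_def by (elim conjE allE[of _ ?F] allE[of _ R] allE[of _ ?K]) auto
  then obtain C1 where C1: "\<And>s v. s \<in> K \<Longrightarrow> v \<ge> 0 \<Longrightarrow>
     \<bar>(\<Sum>\<^sub>\<infinity>\<omega>\<in>integer_lattice. Re (window k \<tau> s (flow A (- v) *v \<omega>))) - exp (v * \<alpha>) * integral UNIV (\<lambda>x. Re (window k \<tau> s x))\<bar>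
        \<le> C1 * exp (- N * v)" by auto
  have "\<exists>C. \<forall>q\<in>?K. \<forall>v\<ge>0. \<bar>(\<Sum>\<^sub>\<infinity>\<omega>\<in>integer_lattice. ?G (q, flow A (- v) *v \<omega>)) - exp (v * \<alpha>) * integral UNIV (\<lambda>x. ?G (q, x))\<bar>
        \<le> C * exp (- N * v)"
    using k Ck_on_window(2)[OF \<tau>, of k] R K' unfolding adequate_def by (elim conjE allE[of _ ?G] allE[of _ R] allE[of _ ?K]) auto
  then obtain C2 where C2: "\<And>s v. s \<in> K \<Longrightarrow> v \<ge> 0 \<Longrightarrow>
     \<bar>(\<Sum>\<^sub>\<infinity>\<omega>\<in>integer_lattice. Im (window k \<tau> s (flow A (- v) *v \<omega>))) - exp (v * \<alpha>) * integral UNIV (\<lambda>x. Im (window k \<tau> s x))\<bar>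
        \<le> C2 * exp (- N * v)" by auto
  have "norm (window_sum k \<tau> s v - of_real (exp (v * \<alpha>)) * window_int k \<tau> s) \<le> (\<bar>C1\<bar> + \<bar>C2\<bar>) * exp (- N * v)"
    if "s \<in> K" "v \<ge> 0" for s v
  proof -
    let ?d = "window_sum k \<tau> s v - of_real (exp (v * \<alpha>)) * window_int k \<tau> s"
    note sm = window_summable[OF \<tau> order_refl, of k s v]
    have "\<bar>Re ?d\<bar> \<le> C1 * exp (- N * v)"
      using C1[OF that] infsum_Re[OF sm] by (simp add: window_sum_def window_int_def)
    moreover have "\<bar>Im ?d\<bar> \<le> C2 * exp (- N * v)"
      using C2[OF that] infsum_Im[OF sm] by (simp add: window_sum_def window_int_def)
    moreover have "C1 * exp (- N * v) \<le> \<bar>C1\<bar> * exp (- N * v)" "C2 * exp (- N * v) \<le> \<bar>C2\<bar> * exp (- N * v)"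
      by (auto intro: mult_right_mono)
    ultimately show ?thesis using cmod_le[of ?d] unfolding distrib_right by linarith
  qed
  then show ?thesis using that[of "\<bar>C1\<bar> + \<bar>C2\<bar>"] by auto
qed

lemma holomorphic_window_sum:
  assumes "\<tau> > 0"
  shows "(\<lambda>s. window_sum k \<tau> s v) holomorphic_on S"
  unfolding window_sum_eq_finite[OF assms] window_def
  by (intro holomorphic_on_sum) (auto intro!: holomorphic_intros holomorphic_psi_powr)

text \<open>By the lattice estimate, e^(- n \<alpha>) times the window sum at time n converges
  locally uniformly to the integral. These sums are finite and holomorphic, so the limit is
  too.\<close>

lemma holomorphic_window_int:
  assumes k: "adequate k N" and N: "N > 0" and \<tau>: "\<tau> > 0"
  shows "window_int k \<tau> holomorphic_on UNIV"
proof (rule holomorphic_uniform_sequence[OF open_UNIV])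
  let ?f = "\<lambda>n s. of_real (exp (- real n * \<alpha>)) * window_sum k \<tau> s (real n)"
  show "?f n holomorphic_on UNIV" for n
    by (intro holomorphic_intros holomorphic_window_sum[OF \<tau>])
  fix x :: complex
  have "compact (cball x 1)" by simp
  then obtain C where C: "C \<ge> 0" "\<And>s v. s \<in> cball x 1 \<Longrightarrow> v \<ge> 0 \<Longrightarrow>
    norm (window_sum k \<tau> s v - of_real (exp (v * \<alpha>)) * window_int k \<tau> s) \<le> C * exp (- N * v)"
    by (rule window_sum_estimate[OF k \<tau>]) blast
  have "uniform_limit (cball x 1) ?f (window_int k \<tau>) sequentially"
  proof (rule uniform_limitI)
    fix e :: real assume e: "e > 0"
    have "(\<lambda>n. exp (- N * real n)) = (\<lambda>n. exp (- N) ^ n)"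
      by (simp add: exp_of_nat_mult[symmetric] mult.commute)
    moreover have "(\<lambda>n. exp (- N) ^ n) \<longlonglongrightarrow> 0" using N by (intro LIMSEQ_realpow_zero) auto
    ultimately have "(\<lambda>n. C * exp (- N * real n)) \<longlonglongrightarrow> C * 0" by (intro tendsto_mult tendsto_const) simp
    then have "\<forall>\<^sub>F n in sequentially. C * exp (- N * real n) < e" using e by (intro order_tendstoD(2)[of _ "C * 0"]) auto
    then show "\<forall>\<^sub>F n in sequentially. \<forall>s\<in>cball x 1. dist (?f n s) (window_int k \<tau> s) < e"
    proof eventually_elim
      case (elim n)
      show ?case
      proof
        fix s assume s: "s \<in> cball x 1"
        have ee: "complex_of_real (exp (- real n * \<alpha>)) * of_real (exp (real n * \<alpha>)) = 1"
          by (simp flip: of_real_mult exp_add)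
        have "?f n s - window_int k \<tau> s
            = of_real (exp (- real n * \<alpha>)) * window_sum k \<tau> s (real n)
              - (complex_of_real (exp (- real n * \<alpha>)) * of_real (exp (real n * \<alpha>))) * window_int k \<tau> s"
          unfolding ee by simp
        also have "\<dots> = of_real (exp (- real n * \<alpha>)) *
            (window_sum k \<tau> s (real n) - of_real (exp (real n * \<alpha>)) * window_int k \<tau> s)"
          by (simp only: right_diff_distrib mult.assoc)
        finally have "norm (?f n s - window_int k \<tau> s) = exp (- real n * \<alpha>) *
            norm (window_sum k \<tau> s (real n) - of_real (exp (real n * \<alpha>)) * window_int k \<tau> s)"
          by (simp add: norm_mult)
        also have "\<dots> \<le> 1 * (C * exp (- N * real n))"
          using C(2)[OF s, of "real n"] alpha_pos by (intro mult_mono) auto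
        finally show "dist (?f n s) (window_int k \<tau> s) < e" using elim by (simp add: dist_norm)
      qed
    qed
  qed
  then show "\<exists>d>0. cball x d \<subseteq> UNIV \<and> uniform_limit (cball x d) ?f (window_int k \<tau>) sequentially"
    by (intro exI[of _ 1]) auto
qed

lemma window_flow_eq:
  assumes "\<tau> > 0" "x \<noteq> 0"
  shows "window k \<tau> s (flow A (- (real m * \<tau>)) *v x)
    = exp (s * of_real (real m * \<tau>)) * (psi_powr s x * of_real (bump k (level x / \<tau> - real m)))"
proof -
  have "level (flow A (- (real m * \<tau>)) *v x) / \<tau> = level x / \<tau> - real m"
    using assms by (simp add: level_flow diff_divide_distrib)
  then show ?thesis using assms by (simp add: window_def psi_powr_flow)
qed

lemma window_sum_upper:
  assumes k: "adequate k N" and N: "N > 0" and \<tau>: "\<tau> > 0"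
  obtains C where "C \<ge> 0" "\<And>v. v \<ge> 0 \<Longrightarrow> norm (window_sum k \<tau> s v) \<le> C * exp (v * \<alpha>)"
proof -
  have "compact {s}" by simp
  then obtain C where C0: "C \<ge> 0" and C1: "\<And>t v. t \<in> {s} \<Longrightarrow> v \<ge> 0 \<Longrightarrow>
    norm (window_sum k \<tau> t v - of_real (exp (v * \<alpha>)) * window_int k \<tau> t) \<le> C * exp (- N * v)"
    by (rule window_sum_estimate[OF k \<tau>]) blast
  note C = C0 C1[OF singletonI]
  have "norm (window_sum k \<tau> s v) \<le> (C + norm (window_int k \<tau> s)) * exp (v * \<alpha>)" if v: "v \<ge> 0" for v
  proof -
    have "norm (window_sum k \<tau> s v) \<le> norm (of_real (exp (v * \<alpha>)) * window_int k \<tau> s) + C * exp (- N * v)"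
      using C(2)[OF v] norm_triangle_sub[of "window_sum k \<tau> s v" "of_real (exp (v * \<alpha>)) * window_int k \<tau> s"] by linarith
    also have "C * exp (- N * v) \<le> C * exp (v * \<alpha>)"
    proof -
      have "- N * v \<le> 0" "0 \<le> v * \<alpha>" using N v alpha_pos by (auto simp: mult_nonpos_nonneg)
      then show ?thesis using C(1) by (intro mult_left_mono) auto
    qed
    finally show ?thesis by (simp add: norm_mult algebra_simps)
  qed
  then show ?thesis using that[of "C + norm (window_int k \<tau> s)"] C(1) by auto
qed

text \<open>The double family over shifts m and lattice points \<omega> is absolutely summable.
  Summed over m first, the bumps add up to 1 and leave the Dirichlet series; summed over \<omega>
  first, it is the series of window sums. Convergence for Re s > \<alpha> comes out as a
  by-product.\<close>

lemma zeta_has_sum_window_series: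
  assumes k: "adequate k N" and N: "N > 0" and \<tau>: "\<tau> > 0" and s: "Re s > \<alpha>"
  shows "\<exists>S. (psi_powr s has_sum S) (integer_lattice - {0}) \<and>
    (\<lambda>m. exp (- s * of_real (real m * \<tau>)) * window_sum k \<tau> s (real m * \<tau>)) sums S"
proof -
  let ?L = "integer_lattice - {0} :: (real^'n) set"
  define f where "f = (\<lambda>(m, \<omega>). psi_powr s \<omega> * of_real (bump k (level \<omega> / \<tau> - real m)))"
  have f_eq: "f (m, \<omega>) = exp (- s * of_real (real m * \<tau>)) * window k \<tau> s (flow A (- (real m * \<tau>)) *v \<omega>)"
    if "\<omega> \<noteq> 0" for m \<omega>
    using window_flow_eq[OF \<tau> that, of k s m] by (simp add: f_def exp_minus field_simps)
  have inf_L: "(\<Sum>\<^sub>\<infinity>\<omega>\<in>?L. window k \<tau> t (flow A (- v) *v \<omega>)) = window_sum k \<tau> t v" for t v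
    unfolding window_sum_def by (rule infsum_cong_neutral) (auto simp: window_def)
  have hs: "((\<lambda>\<omega>. f (m, \<omega>)) has_sum (exp (- s * of_real (real m * \<tau>)) * window_sum k \<tau> s (real m * \<tau>))) ?L" for m
  proof -
    have "((\<lambda>\<omega>. window k \<tau> s (flow A (- (real m * \<tau>)) *v \<omega>)) has_sum window_sum k \<tau> s (real m * \<tau>)) ?L"
      using has_sum_infsum[OF window_summable[OF \<tau>, of ?L k s "real m * \<tau>"]] inf_L by auto
    from has_sum_cmult_right[OF this, of "exp (- s * of_real (real m * \<tau>))"]
    show ?thesis by (rule has_sum_cong[THEN iffD1, rotated]) (auto simp: f_eq)
  qed
  \<comment> \<open>The absolute values of the terms are the terms for the real exponent Re s, so
    the upper bound for window sums applies and the rows are dominated by a geometric series of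
    ratio e^(- \<tau> (Re s - \<alpha>)).\<close>
  let ?\<sigma> = "complex_of_real (Re s)"
  have norm_f: "norm (f (m, \<omega>)) = Re (exp (- ?\<sigma> * of_real (real m * \<tau>)) * window k \<tau> ?\<sigma> (flow A (- (real m * \<tau>)) *v \<omega>))"
    if "\<omega> \<noteq> 0" for m \<omega>
  proof -
    have "exp (- ?\<sigma> * of_real (real m * \<tau>)) * window k \<tau> ?\<sigma> (flow A (- (real m * \<tau>)) *v \<omega>)
       = psi_powr ?\<sigma> \<omega> * of_real (bump k (level \<omega> / \<tau> - real m))"
      using window_flow_eq[OF \<tau> that, of k ?\<sigma> m] by (simp add: exp_minus field_simps)
    also have "\<dots> = of_real (\<psi> \<omega> powr (- Re s) * bump k (level \<omega> / \<tau> - real m))"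
      using psi_powr_real[OF that, of "Re s"] by simp
    finally show ?thesis
      using that by (simp add: f_def norm_mult norm_psi_powr bump_nonneg)
  qed
  have sums_norm: "((\<lambda>\<omega>. norm (f (m, \<omega>))) has_sum Re (exp (- ?\<sigma> * of_real (real m * \<tau>)) * window_sum k \<tau> ?\<sigma> (real m * \<tau>))) ?L" for m
  proof -
    have "((\<lambda>\<omega>. window k \<tau> ?\<sigma> (flow A (- (real m * \<tau>)) *v \<omega>)) has_sum window_sum k \<tau> ?\<sigma> (real m * \<tau>)) ?L"
      using has_sum_infsum[OF window_summable[OF \<tau>, of ?L k ?\<sigma> "real m * \<tau>"]] inf_L by auto
    from has_sum_Re[OF has_sum_cmult_right[OF this, of "exp (- ?\<sigma> * of_real (real m * \<tau>))"]]
    show ?thesis by (rule has_sum_cong[THEN iffD1, rotated]) (auto simp: norm_f)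
  qed
  obtain C where C: "C \<ge> 0" "\<And>v. v \<ge> 0 \<Longrightarrow> norm (window_sum k \<tau> ?\<sigma> v) \<le> C * exp (v * \<alpha>)"
    using window_sum_upper[OF k N \<tau>] by blast
  have row: "\<bar>infsum (\<lambda>\<omega>. norm (f (m, \<omega>))) ?L\<bar> \<le> C * exp (- \<tau> * (Re s - \<alpha>)) ^ m" for m
  proof -
    have "\<bar>infsum (\<lambda>\<omega>. norm (f (m, \<omega>))) ?L\<bar> = \<bar>Re (exp (- ?\<sigma> * of_real (real m * \<tau>)) * window_sum k \<tau> ?\<sigma> (real m * \<tau>))\<bar>"
      using infsumI[OF sums_norm] by simp
    also have "\<dots> \<le> norm (exp (- ?\<sigma> * of_real (real m * \<tau>)) * window_sum k \<tau> ?\<sigma> (real m * \<tau>))" by (rule abs_Re_le_cmod)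
    also have "\<dots> = exp (- Re s * (real m * \<tau>)) * norm (window_sum k \<tau> ?\<sigma> (real m * \<tau>))" by (simp add: norm_mult)
    also have "\<dots> \<le> exp (- Re s * (real m * \<tau>)) * (C * exp ((real m * \<tau>) * \<alpha>))"
      using C(2)[of "real m * \<tau>"] \<tau> by (intro mult_left_mono) auto
    also have "\<dots> = C * (exp (- Re s * (real m * \<tau>)) * exp ((real m * \<tau>) * \<alpha>))" by simp
    also have "exp (- Re s * (real m * \<tau>)) * exp ((real m * \<tau>) * \<alpha>) = exp (- \<tau> * (Re s - \<alpha>)) ^ m"
      unfolding exp_of_nat_mult[symmetric] exp_add[symmetric] by (simp add: algebra_simps)
    finally show ?thesis .
  qed
  have q: "0 \<le> exp (- \<tau> * (Re s - \<alpha>))" "exp (- \<tau> * (Re s - \<alpha>)) < 1" using \<tau> s by (auto simp: mult_pos_neg)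
  have "(\<lambda>z. norm (f z)) summable_on (UNIV \<times> ?L)"
  proof (subst Infinite_Sum.abs_summable_on_Sigma_iff, intro conjI ballI)
    show "(\<lambda>\<omega>. norm (f (m, \<omega>))) summable_on ?L" for m using sums_norm by (rule has_sum_imp_summable)
    have "summable (\<lambda>m. C * exp (- \<tau> * (Re s - \<alpha>)) ^ m)" using q by (intro summable_mult summable_geometric) auto
    then have "(\<lambda>m. C * exp (- \<tau> * (Re s - \<alpha>)) ^ m) summable_on UNIV"
      using C(1) q by (subst summable_on_UNIV_nonneg_real_iff) auto
    then show "(\<lambda>m. norm (infsum (\<lambda>\<omega>. norm (f (m, \<omega>))) ?L)) summable_on UNIV"
      by (rule Infinite_Sum.abs_summable_on_comparison_test') (use row in auto)
  qed
  then have "f summable_on (UNIV \<times> ?L)" by (rule abs_summable_summable)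
  then obtain S where S: "(f has_sum S) (UNIV \<times> ?L)" by (auto simp: summable_on_def)
  from has_sum_SigmaD[OF S hs] have 1: "((\<lambda>m. exp (- s * of_real (real m * \<tau>)) * window_sum k \<tau> s (real m * \<tau>)) has_sum S) UNIV" .
  have S': "((\<lambda>(\<omega>, m). f (m, \<omega>)) has_sum S) (?L \<times> UNIV)"
    using has_sum_swap[THEN iffD1, OF S] by simp
  have col: "((\<lambda>m. f (m, \<omega>)) has_sum psi_powr s \<omega>) UNIV" if "\<omega> \<in> ?L" for \<omega>
  proof -
    have "level \<omega> / \<tau> \<ge> 0" using level_lattice_nonneg[OF that] \<tau> by simp
    from has_sum_cmult_right[OF has_sum_of_real[OF bump_sums[OF this, of k]], of "psi_powr s \<omega>"]
    show ?thesis by (simp add: f_def)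
  qed
  have "(psi_powr s has_sum S) ?L"
    by (rule has_sum_SigmaD[OF S']) (use col in auto)
  then show ?thesis using 1 has_sum_imp_sums by blast
qed

definition remainder :: "nat \<Rightarrow> real \<Rightarrow> complex \<Rightarrow> nat \<Rightarrow> complex" where
  "remainder k \<tau> s m = exp (- s * of_real (real m * \<tau>)) *
     (window_sum k \<tau> s (real m * \<tau>) - of_real (exp ((real m * \<tau>) * \<alpha>)) * window_int k \<tau> s)"

text \<open>The main terms form a geometric series, written in closed form. Its denominator vanishes
  at \<alpha> + 2 pi i j / \<tau> for integers j.\<close>

definition continuation :: "nat \<Rightarrow> real \<Rightarrow> complex \<Rightarrow> complex" where
  "continuation k \<tau> s = (\<Sum>m. remainder k \<tau> s m) + window_int k \<tau> s / (1 - exp (of_real \<tau> * (of_real \<alpha> - s)))"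

lemma remainder_bound:
  assumes k: "adequate k N" and \<tau>: "\<tau> > 0" and K: "compact K" and e: "\<And>s. s \<in> K \<Longrightarrow> Re s + N \<ge> e"
  obtains C where "\<And>s m. s \<in> K \<Longrightarrow> norm (remainder k \<tau> s m) \<le> C * exp (- \<tau> * e) ^ m"
proof -
  obtain C where C: "C \<ge> 0" "\<And>s v. s \<in> K \<Longrightarrow> v \<ge> 0 \<Longrightarrow>
    norm (window_sum k \<tau> s v - of_real (exp (v * \<alpha>)) * window_int k \<tau> s) \<le> C * exp (- N * v)"
    using K by (rule window_sum_estimate[OF k \<tau>]) blast
  have "norm (remainder k \<tau> s m) \<le> C * exp (- \<tau> * e) ^ m" if s: "s \<in> K" for s m
  proof -
    let ?v = "real m * \<tau>"
    have v: "?v \<ge> 0" using \<tau> by simp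
    have "norm (remainder k \<tau> s m) = exp (- Re s * ?v) *
        norm (window_sum k \<tau> s ?v - of_real (exp (?v * \<alpha>)) * window_int k \<tau> s)"
      by (simp add: remainder_def norm_mult)
    also have "\<dots> \<le> exp (- Re s * ?v) * (C * exp (- N * ?v))" using C(2)[OF s v] by (intro mult_left_mono) auto
    also have "\<dots> = C * exp (- ((Re s + N) * ?v))" by (simp add: exp_add[symmetric] algebra_simps)
    also have "\<dots> \<le> C * exp (- (e * ?v))"
      using C(1) mult_right_mono[OF e[OF s] v] by (intro mult_left_mono) auto
    also have "\<dots> = C * exp (- \<tau> * e) ^ m" by (simp add: exp_of_nat_mult[symmetric] mult_ac)
    finally show ?thesis .
  qed
  then show ?thesis using that by blast
qed

lemma holomorphic_remainder_sum:
  assumes k: "adequate k N" and N: "N > 0" and \<tau>: "\<tau> > 0"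
  shows "(\<lambda>s. \<Sum>m. remainder k \<tau> s m) holomorphic_on {s. Re s > - N}"
proof (rule holomorphic_uniform_sequence[OF open_halfspace_Re_gt])
  show "(\<lambda>s. \<Sum>m<n. remainder k \<tau> s m) holomorphic_on {s. Re s > - N}" for n
    unfolding remainder_def
    by (intro holomorphic_intros holomorphic_window_sum[OF \<tau>]
        holomorphic_on_subset[OF holomorphic_window_int[OF k N \<tau>]]) auto
  fix x assume "x \<in> {s. Re s > - N}"
  \<comment> \<open>Half the distance from x to the line Re s = - N, so the ball of radius e around
    x keeps the distance e from that line.\<close>
  define e where "e = (Re x + N) / 2"
  have e: "e > 0" using \<open>x \<in> _\<close> by (simp add: e_def)
  have Re_le: "Re s + N \<ge> e" if "s \<in> cball x e" for s
  proof -
    have "Re x - Re s \<le> e" using that abs_Re_le_cmod[of "x - s"] by (simp add: dist_norm)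
    then show ?thesis by (simp add: e_def field_simps)
  qed
  obtain C where C: "\<And>s m. s \<in> cball x e \<Longrightarrow> norm (remainder k \<tau> s m) \<le> C * exp (- \<tau> * e) ^ m"
    using remainder_bound[OF k \<tau> compact_cball Re_le] by blast
  have "uniform_limit (cball x e) (\<lambda>n s. \<Sum>m<n. remainder k \<tau> s m) (\<lambda>s. \<Sum>m. remainder k \<tau> s m) sequentially"
    by (rule Weierstrass_m_test[where M = "\<lambda>m. C * exp (- \<tau> * e) ^ m"])
      (use C e \<tau> in \<open>auto intro!: summable_mult summable_geometric simp: mult_pos_pos\<close>)
  moreover have "cball x e \<subseteq> {s. Re s > - N}" using Re_le e by fastforce
  ultimately show "\<exists>d>0. cball x d \<subseteq> {s. Re s > - N} \<and>
      uniform_limit (cball x d) (\<lambda>n s. \<Sum>m<n. remainder k \<tau> s m) (\<lambda>s. \<Sum>m. remainder k \<tau> s m) sequentially"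
    using e by blast
qed

lemma continuation_has_sum:
  assumes k: "adequate k N" and N: "N > 0" and \<tau>: "\<tau> > 0" and s: "Re s > \<alpha>"
  shows "(psi_powr s has_sum continuation k \<tau> s) (integer_lattice - {0})"
proof -
  obtain S where S: "(psi_powr s has_sum S) (integer_lattice - {0})"
    and sums: "(\<lambda>m. exp (- s * of_real (real m * \<tau>)) * window_sum k \<tau> s (real m * \<tau>)) sums S"
    using zeta_has_sum_window_series[OF assms] by blast
  let ?q = "exp (of_real \<tau> * (of_real \<alpha> - s)) :: complex"
  have q: "norm ?q < 1" using \<tau> s by (simp add: mult_pos_neg)
  have "(\<lambda>m. ?q ^ m * window_int k \<tau> s) sums (1 / (1 - ?q) * window_int k \<tau> s)"
    by (intro sums_mult2 geometric_sums q)
  from sums_diff[OF sums this]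
  have "remainder k \<tau> s sums (S - 1 / (1 - ?q) * window_int k \<tau> s)"
  proof (rule sums_cong[THEN iffD1, rotated])
    fix m
    have "exp (- s * of_real (real m * \<tau>)) * of_real (exp (real m * \<tau> * \<alpha>)) = ?q ^ m"
      by (simp add: exp_of_nat_mult[symmetric] exp_of_real[symmetric] exp_add[symmetric] algebra_simps)
    then show "exp (- s * of_real (real m * \<tau>)) * window_sum k \<tau> s (real m * \<tau>) - ?q ^ m * window_int k \<tau> s = remainder k \<tau> s m"
      unfolding remainder_def right_diff_distrib mult.assoc[symmetric] by simp
  qed
  then have "continuation k \<tau> s = S"
    by (simp add: continuation_def sums_unique[symmetric, where f = "remainder k \<tau> s"])
  then show ?thesis using S by simp
qed

text \<open>The candidates are \<alpha> + 2 pi i n / \<tau>; the height 1 / \<tau> is below 2 pi /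
  \<tau> and leaves only n = 0.\<close>

lemma exp_period_eq_1_imp:
  assumes "exp (of_real \<tau> * (of_real \<alpha> - s)) = 1" "\<bar>Im s\<bar> < 1 / \<tau>" "\<tau> > 0"
  shows "s = of_real \<alpha>"
proof -
  from assms(1) obtain n :: int where n: "\<tau> * (\<alpha> - Re s) = 0" "- \<tau> * Im s = of_int (2 * n) * pi"
    unfolding exp_eq_1 by auto
  have "\<bar>\<tau> * Im s\<bar> < 1" using assms(2,3) by (simp add: abs_mult field_simps)
  then have "\<bar>of_int (2 * n) * pi\<bar> < 1" using n(2) by linarith
  then have "n = 0"
  proof (rule contrapos_pp)
    assume "n \<noteq> 0"
    then have "1 \<le> \<bar>real_of_int (2 * n)\<bar>" by linarith
    then have "1 * 1 \<le> \<bar>real_of_int (2 * n)\<bar> * pi" using pi_gt3 by (intro mult_mono) auto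
    then show "\<not> \<bar>of_int (2 * n) * pi\<bar> < 1" by (simp add: abs_mult)
  qed
  then show ?thesis using n assms(3) by (simp add: complex_eq_iff)
qed

lemma holomorphic_continuation:
  assumes k: "adequate k N" and N: "N > 0" and \<tau>: "\<tau> > 0"
  shows "continuation k \<tau> holomorphic_on {s. Re s > - N \<and> \<bar>Im s\<bar> < 1 / \<tau>} - {of_real \<alpha>}"
  unfolding continuation_def
proof (intro holomorphic_on_add holomorphic_on_divide)
  show "(\<lambda>s. \<Sum>m. remainder k \<tau> s m) holomorphic_on {s. Re s > - N \<and> \<bar>Im s\<bar> < 1 / \<tau>} - {of_real \<alpha>}"
    by (rule holomorphic_on_subset[OF holomorphic_remainder_sum[OF assms]]) auto
  show "window_int k \<tau> holomorphic_on {s. Re s > - N \<and> \<bar>Im s\<bar> < 1 / \<tau>} - {of_real \<alpha>}"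
    by (rule holomorphic_on_subset[OF holomorphic_window_int[OF assms]]) auto
  show "1 - exp (of_real \<tau> * (of_real \<alpha> - s)) \<noteq> 0" if "s \<in> {s. Re s > - N \<and> \<bar>Im s\<bar> < 1 / \<tau>} - {of_real \<alpha>}" for s
    using exp_period_eq_1_imp[of \<tau> s] that \<tau> by auto
qed (intro holomorphic_intros)

text \<open>The left edge corresponds to N = n + 1 and the height to \<tau> = 1 / (n + 1), so on the
  n-th strip \<open>continuation\<close> has no pole besides \<alpha>.\<close>

definition strip :: "nat \<Rightarrow> complex set" where
  "strip n = {s. Re s > - real (Suc n) \<and> \<bar>Im s\<bar> < real (Suc n)}"

lemma open_strip: "open (strip n)"
  unfolding strip_def by (intro open_Collect_conj open_Collect_less continuous_intros)

lemma convex_strip: "convex (strip n)"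
proof -
  have "strip n = {s. Re s > - real (Suc n)} \<inter> {s. Im s < real (Suc n)} \<inter> {s. Im s > - real (Suc n)}"
    by (auto simp: strip_def abs_less_iff)
  then show ?thesis
    by (simp only:) (intro convex_Int convex_halfspace_Re_gt convex_halfspace_Im_lt convex_halfspace_Im_gt)
qed

lemma strip_mono: "m \<le> n \<Longrightarrow> strip m \<subseteq> strip n"
  by (auto simp: strip_def)

lemma strip_exhausts: "\<exists>n. s \<in> strip n"
proof -
  obtain n where n: "real n > \<bar>Re s\<bar> + \<bar>Im s\<bar>" using reals_Archimedean2 by blast
  have "- real (Suc n) < Re s" "\<bar>Im s\<bar> < real (Suc n)"
    using n abs_ge_zero[of "Re s"] abs_ge_zero[of "Im s"] by (auto simp: abs_real_def split: if_splits)
  then show ?thesis unfolding strip_def by blast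
qed

lemma strip_identity:
  assumes "f holomorphic_on strip n - {of_real \<alpha>}" "g holomorphic_on strip n - {of_real \<alpha>}"
    and "\<And>s. Re s > \<alpha> \<Longrightarrow> f s = g s" and "s \<in> strip n - {of_real \<alpha>}"
  shows "f s = g s"
proof (rule analytic_continuation_open[where f = f and g = g and z = s
      and s = "strip n \<inter> {s. Re s > \<alpha>}" and s' = "strip n - {of_real \<alpha>}"])
  show "open (strip n \<inter> {s. Re s > \<alpha>})" by (intro open_Int open_strip open_halfspace_Re_gt)
  show "open (strip n - {of_real \<alpha>})" by (intro open_delete open_strip)
  have "of_real (\<alpha> + 1) \<in> strip n \<inter> {s. Re s > \<alpha>}" using alpha_pos by (auto simp: strip_def)
  then show "strip n \<inter> {s. Re s > \<alpha>} \<noteq> {}" by blast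
  show "connected (strip n - {of_real \<alpha>})"
    by (rule connected_open_delete[OF open_strip convex_connected[OF convex_strip]]) simp
qed (use assms in auto)

text \<open>Every strip has its own smoothness and step. All these continuations equal the Dirichlet
  series for Re s > \<alpha>, so they agree on common strips by the identity theorem and glue
  together.\<close>

lemma zeta_extension_exists:
  obtains Z where "is_zeta_extension \<alpha> \<psi> Z"
proof -
  define k where "k = (\<lambda>n. SOME k. adequate k (real (Suc n)))"
  have k: "adequate (k n) (real (Suc n))" for n
    unfolding k_def using adequate_exists by (rule someI_ex)
  define Zn where "Zn = (\<lambda>n. continuation (k n) (1 / real (Suc n)))"
  have hol: "Zn n holomorphic_on strip n - {of_real \<alpha>}" for n
    using holomorphic_continuation[OF k, of n "1 / real (Suc n)"] by (simp add: Zn_def strip_def)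
  have sum: "(psi_powr s has_sum Zn n s) (integer_lattice - {0})" if "Re s > \<alpha>" for n s
    unfolding Zn_def by (rule continuation_has_sum[OF k _ _ that]) auto
  have agree: "Zn m s = Zn n s" if "s \<in> strip m - {of_real \<alpha>}" "m \<le> n" for m n s
  proof (rule strip_identity[OF hol _ _ that(1)])
    show "Zn n holomorphic_on strip m - {of_real \<alpha>}"
      by (rule holomorphic_on_subset[OF hol]) (use strip_mono[OF that(2)] in blast)
    show "Zn m s = Zn n s" if "Re s > \<alpha>" for s using has_sum_unique[OF sum sum] that by blast
  qed
  define Z where "Z = (\<lambda>s. Zn (LEAST n. s \<in> strip n) s)"
  have Z: "Z s = Zn n s" if "s \<in> strip n - {of_real \<alpha>}" for s n
    unfolding Z_def
  proof (rule agree)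
    show "s \<in> strip (LEAST n. s \<in> strip n) - {of_real \<alpha>}" using that LeastI[of "\<lambda>n. s \<in> strip n" n] by auto
    show "(LEAST n. s \<in> strip n) \<le> n" using that by (intro Least_le) auto
  qed
  have "Z holomorphic_on - {of_real \<alpha>}"
  proof -
    have "- {of_real \<alpha>} = (\<Union>n. strip n - {of_real \<alpha>})" using strip_exhausts by auto
    moreover have "Z holomorphic_on strip n - {of_real \<alpha>}" for n
      using holomorphic_transform[OF hol] Z by metis
    ultimately show ?thesis
      by (simp only:) (intro holomorphic_on_UN_open, auto intro: open_delete open_strip)
  qed
  moreover have "(psi_powr s has_sum Z s) (integer_lattice - {0})" if "Re s > \<alpha>" for s
  proof -
    obtain n where "s \<in> strip n" using strip_exhausts by blast
    then have "Z s = Zn n s" using that by (intro Z) auto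
    then show ?thesis using sum[OF that] by simp
  qed
  ultimately have "is_zeta_extension \<alpha> \<psi> Z"
    by (simp add: is_zeta_extension_def psi_powr_def[abs_def])
  then show ?thesis by (rule that)
qed

lemma zeta_is_extension: "is_zeta_extension \<alpha> \<psi> (zeta \<alpha> \<psi>)"
  unfolding zeta_def using zeta_extension_exists by (metis someI)

lemma zeta_holomorphic: "zeta \<alpha> \<psi> holomorphic_on - {of_real \<alpha>}"
  using zeta_is_extension by (simp add: is_zeta_extension_def)

lemma zeta_has_sum: "Re s > \<alpha> \<Longrightarrow> (psi_powr s has_sum zeta \<alpha> \<psi> s) (integer_lattice - {0})"
  using zeta_is_extension by (simp add: is_zeta_extension_def psi_powr_def[abs_def])

text \<open>Near \<alpha> the continuation with \<tau> = 1 represents zeta. Its remainder series is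
  continuous there, and 1 - e^(\<alpha> - s) behaves like s - \<alpha>, so the residue is the window
  integral at \<alpha>.\<close>

lemma zeta_times_tendsto:
  assumes k: "adequate k 1"
  shows "((\<lambda>s. (s - of_real \<alpha>) * zeta \<alpha> \<psi> s) \<longlongrightarrow> window_int k 1 (of_real \<alpha>)) (at (of_real \<alpha>))"
proof -
  let ?a = "complex_of_real \<alpha>" and ?D = "\<lambda>s. \<Sum>m. remainder k 1 s m"
  have a: "?a \<in> strip 0" using alpha_pos by (simp add: strip_def)
  have eq: "zeta \<alpha> \<psi> s = continuation k 1 s" if "s \<in> strip 0 - {?a}" for s
  proof (rule strip_identity[OF _ _ _ that])
    show "zeta \<alpha> \<psi> holomorphic_on strip 0 - {?a}" by (rule holomorphic_on_subset[OF zeta_holomorphic]) auto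
    show "continuation k 1 holomorphic_on strip 0 - {?a}"
      using holomorphic_continuation[OF k, of 1] by (simp add: strip_def)
    show "zeta \<alpha> \<psi> s = continuation k 1 s" if "Re s > \<alpha>" for s
      using has_sum_unique[OF zeta_has_sum[OF that] continuation_has_sum[OF k _ _ that]] by simp
  qed
  have "isCont ?D ?a"
    using holomorphic_on_imp_continuous_on[OF holomorphic_remainder_sum[OF k, of 1]] alpha_pos
    by (auto simp: continuous_on_eq_continuous_at open_halfspace_Re_gt)
  then have D: "(?D \<longlongrightarrow> ?D ?a) (at ?a)" by (simp add: isCont_def)
  have "isCont (window_int k 1) ?a"
    using holomorphic_on_imp_continuous_on[OF holomorphic_window_int[OF k, of 1]]
    by (auto simp: continuous_on_eq_continuous_at)
  then have I: "(window_int k 1 \<longlongrightarrow> window_int k 1 ?a) (at ?a)" by (simp add: isCont_def)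
  have "((\<lambda>s. 1 - exp (?a - s)) has_field_derivative 1) (at ?a)" by (auto intro!: derivative_eq_intros)
  then have q: "((\<lambda>s. (1 - exp (?a - s)) / (s - ?a)) \<longlongrightarrow> 1) (at ?a)"
    by (simp add: has_field_derivative_iff)
  have "((\<lambda>s. (s - ?a) * ?D s + window_int k 1 s * inverse ((1 - exp (?a - s)) / (s - ?a)))
     \<longlongrightarrow> (?a - ?a) * ?D ?a + window_int k 1 ?a * inverse 1) (at ?a)"
    by (intro tendsto_intros D I q) auto
  then have "((\<lambda>s. (s - ?a) * ?D s + window_int k 1 s * inverse ((1 - exp (?a - s)) / (s - ?a)))
     \<longlongrightarrow> window_int k 1 ?a) (at ?a)" by simp
  then show ?thesis
  proof (rule Lim_transform_eventually)
    have "\<forall>\<^sub>F s in at ?a. s \<in> strip 0 - {?a}"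
      using eventually_at_in_open[OF open_strip a] by simp
    then show "\<forall>\<^sub>F s in at ?a. (s - ?a) * ?D s + window_int k 1 s * inverse ((1 - exp (?a - s)) / (s - ?a))
        = (s - ?a) * zeta \<alpha> \<psi> s"
      by eventually_elim (simp add: eq continuation_def field_simps)
  qed
qed

text \<open>The function g = (s - \<alpha>) zeta has a removable singularity with the residue as
  value; H is its difference quotient at \<alpha>.\<close>

lemma zeta_regular_part:
  assumes k: "adequate k 1"
  obtains H where "H holomorphic_on UNIV"
    "\<And>s. s \<noteq> of_real \<alpha> \<Longrightarrow> zeta \<alpha> \<psi> s = H s + window_int k 1 (of_real \<alpha>) / (s - of_real \<alpha>)"
proof -
  let ?a = "complex_of_real \<alpha>"
  define g where "g = (\<lambda>s. if s = ?a then window_int k 1 ?a else (s - ?a) * zeta \<alpha> \<psi> s)"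
  have "g holomorphic_on UNIV"
  proof (rule no_isolated_singularity'[where K = "{?a}"])
    show "(g \<longlongrightarrow> g z) (at z within UNIV)" if "z \<in> {?a}" for z
    proof -
      have "(g \<longlongrightarrow> window_int k 1 ?a) (at ?a)"
        by (rule Lim_transform_eventually[OF zeta_times_tendsto[OF k]])
          (auto simp: g_def eventually_at_filter)
      then show ?thesis using that by (simp add: g_def)
    qed
    have "(\<lambda>s. (s - ?a) * zeta \<alpha> \<psi> s) holomorphic_on UNIV - {?a}"
      by (intro holomorphic_intros holomorphic_on_subset[OF zeta_holomorphic]) auto
    then show "g holomorphic_on UNIV - {?a}"
      by (rule holomorphic_transform) (auto simp: g_def)
  qed auto
  then have "(\<lambda>z. if z = ?a then deriv g ?a else zeta \<alpha> \<psi> z - g ?a / (z - ?a)) holomorphic_on UNIV"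
    by (rule pole_theorem_open) (auto simp: g_def)
  then show ?thesis by (rule that) (simp add: g_def)
qed

end

subsection \<open>Residues and the disc\<close>

context dilation
begin

text \<open>Here \<psi> is an argument and not fixed by a locale, so that the residues of different
  functions can be compared.\<close>

definition residue_density :: "nat \<Rightarrow> (real^'n \<Rightarrow> real) \<Rightarrow> real^'n \<Rightarrow> real" where
  "residue_density k \<psi> x = (if x = 0 then 0 else \<psi> x powr (- \<alpha>) * bump k (level x))"

definition residue_integral :: "nat \<Rightarrow> (real^'n \<Rightarrow> real) \<Rightarrow> real" where
  "residue_integral k \<psi> = integral UNIV (residue_density k \<psi>)"

end

context zeta_function
begin

lemma window_residue_density: "window k 1 (of_real \<alpha>) x = of_real (residue_density k \<psi> x)"
  by (auto simp: window_def residue_density_def psi_powr_real)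

lemma window_int_residue: "window_int k 1 (of_real \<alpha>) = of_real (residue_integral k \<psi>)"
  by (simp add: window_int_def window_residue_density residue_integral_def complex_eq_iff)

lemma residue_density_nonneg: "residue_density k \<psi> x \<ge> 0"
  by (simp add: residue_density_def bump_nonneg)

lemma residue_density_continuous: "continuous_on S (residue_density k \<psi>)"
proof -
  have c: "continuous_on UNIV (\<lambda>z :: (real \<times> real) \<times> (real^'n). Re (window k 1 (Complex (fst (fst z)) (snd (fst z))) (snd z)))"
    using Ck_on_window(1)[of 1 k] by (intro Ck_on_imp_continuous_on[of k]) simp
  have "continuous_on S (\<lambda>x. Re (window k 1 (Complex (fst (fst ((\<alpha>, 0 :: real), x))) (snd (fst ((\<alpha>, 0 :: real), x)))) (snd ((\<alpha>, 0 :: real), x))))"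
    by (rule continuous_on_compose2[OF c, where f = "\<lambda>x. ((\<alpha>, 0), x)"]) (auto intro!: continuous_intros)
  then show ?thesis using window_residue_density by (simp add: complex_of_real_def)
qed

lemma residue_density_support:
  obtains R where "R > 0" "\<And>k x. norm x > R \<Longrightarrow> residue_density k \<psi> x = 0"
proof -
  obtain R where "R > 0" "\<And>k s x. norm x > R \<Longrightarrow> window k 1 s x = 0" using window_support[of 1] by auto
  then show ?thesis using that window_residue_density by (metis of_real_eq_0_iff)
qed

lemma residue_density_integrable: "residue_density k \<psi> integrable_on UNIV"
proof -
  obtain R where "R > 0" "\<And>k x. norm x > R \<Longrightarrow> residue_density k \<psi> x = 0"
    by (rule residue_density_support) blast
  then show ?thesis using compact_support_integrable[OF residue_density_continuous, of R] by blast
qed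

lemma residue_integral_nonneg: "residue_integral k \<psi> \<ge> 0"
  unfolding residue_integral_def
  by (rule integral_nonneg[OF residue_density_integrable]) (rule residue_density_nonneg)

text \<open>A continuous nonnegative density with integral 0 would vanish on its support cube, but
  on the ellipsoid the level is 0 and the cut-off is 1.\<close>

lemma residue_integral_pos: "residue_integral k \<psi> > 0"
proof (rule ccontr)
  assume "\<not> residue_integral k \<psi> > 0"
  then have zero: "residue_integral k \<psi> = 0" using residue_integral_nonneg[of k] by simp
  obtain R where R: "R > 0" "\<And>k x. norm x > R \<Longrightarrow> residue_density k \<psi> x = 0" by (rule residue_density_support) blast
  have "integral (cube R) (residue_density k \<psi>) = 0"
    using integral_UNIV_eq_cube[OF residue_density_continuous R(2)[where k = k] order_refl] zero
    by (simp add: residue_integral_def)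
  then have I: "(residue_density k \<psi> has_integral 0) (cbox (\<chi> i. - R) (\<chi> i. R))"
    using integrable_integral[OF integrable_continuous[OF residue_density_continuous]] unfolding cube_def by metis
  define y where "y = proj (axis undefined 1)"
  have y: "y \<noteq> 0" "quad y = 1" by (auto simp: y_def quad_proj axis_eq_0_iff)
  have pos: "residue_density k \<psi> y > 0"
    using y psi_pos[of y] by (simp add: residue_density_def level_quad_1 bump_0)
  then have "norm y \<le> R" using R(2)[of y k] by fastforce
  then have "y \<in> cbox (\<chi> i. - R) (\<chi> i. R)" using norm_le_imp_mem_cube unfolding cube_def by blast
  moreover have "0 \<in> box ((\<chi> i. - R) :: real^'n) (\<chi> i. R)" using R(1) by (simp add: mem_box_cart)
  ultimately have "residue_density k \<psi> y = 0"
    by (intro has_integral_0_cbox_imp_0[OF residue_density_continuous residue_density_nonneg I]) auto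
  then show False using pos by simp
qed

lemma zeta_real_has_sum:
  assumes "a > \<alpha>"
  shows "((\<lambda>\<omega>. \<psi> \<omega> powr (- a)) has_sum Re (zeta \<alpha> \<psi> (of_real a))) (integer_lattice - {0})"
proof -
  have "((\<lambda>\<omega>. Re (psi_powr (of_real a) \<omega>)) has_sum Re (zeta \<alpha> \<psi> (of_real a))) (integer_lattice - {0})"
    by (rule has_sum_Re[OF zeta_has_sum]) (use assms in simp)
  then show ?thesis by (rule has_sum_cong[THEN iffD1, rotated]) (simp add: psi_powr_real)
qed

text \<open>Makes the supremum over the circle a genuine one; only for a bounded set does the real
  \<open>SUP\<close> dominate the individual values.\<close>

lemma zeta_sphere_bounded:
  assumes "\<delta> > 0"
  shows "bdd_above ((\<lambda>s. cmod (zeta \<alpha> \<psi> s)) ` sphere (of_real \<alpha>) \<delta>)"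
proof -
  have "continuous_on (sphere (of_real \<alpha>) \<delta>) (zeta \<alpha> \<psi>)"
    by (rule continuous_on_subset[OF holomorphic_on_imp_continuous_on[OF zeta_holomorphic]]) (use assms in auto)
  then have "compact ((\<lambda>s. cmod (zeta \<alpha> \<psi> s)) ` sphere (of_real \<alpha>) \<delta>)"
    by (intro compact_continuous_image continuous_on_norm) auto
  then show ?thesis by (intro bounded_imp_bdd_above compact_imp_bounded)
qed

text \<open>The pole forbids the maximum principle for zeta itself. The polar part has constant
  modulus r / \<delta> on the circle, so the entire function H is bounded there by M + r / \<delta>,
  and hence inside.\<close>

lemma zeta_regular_part_bound:
  assumes k: "adequate k 1" and \<delta>: "\<delta> > 0"
    and less: "(SUP s\<in>sphere (complex_of_real \<alpha>) \<delta>. cmod (zeta \<alpha> \<psi> s)) < M"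
    and a: "\<alpha> < a" "a < \<alpha> + \<delta>"
  shows "\<bar>Re (zeta \<alpha> \<psi> (of_real a)) - residue_integral k \<psi> / (a - \<alpha>)\<bar> \<le> M + residue_integral k \<psi> / \<delta>"
proof -
  let ?a = "complex_of_real \<alpha>" and ?r = "residue_integral k \<psi>"
  obtain H where H: "H holomorphic_on UNIV" and
    eq: "\<And>s. s \<noteq> ?a \<Longrightarrow> zeta \<alpha> \<psi> s = H s + of_real ?r / (s - ?a)"
    using zeta_regular_part[OF k] window_int_residue[of k] by metis
  have "norm (H (of_real a)) \<le> M + ?r / \<delta>"
  proof (rule maximum_modulus_frontier[of H "cball ?a \<delta>"])
    show "H holomorphic_on interior (cball ?a \<delta>)" by (rule holomorphic_on_subset[OF H]) auto
    show "continuous_on (closure (cball ?a \<delta>)) H"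
      by (rule continuous_on_subset[OF holomorphic_on_imp_continuous_on[OF H]]) auto
    show "bounded (cball ?a \<delta>)" by simp
    show "norm (H z) \<le> M + ?r / \<delta>" if "z \<in> frontier (cball ?a \<delta>)" for z
    proof -
      have z: "z \<in> sphere ?a \<delta>" using that \<delta> by simp
      then have nz: "norm (z - ?a) = \<delta>" "z \<noteq> ?a" using \<delta> by (auto simp: dist_norm norm_minus_commute)
      have "norm (zeta \<alpha> \<psi> z) \<le> (SUP s\<in>sphere ?a \<delta>. cmod (zeta \<alpha> \<psi> s))"
        by (rule cSUP_upper[OF z zeta_sphere_bounded[OF \<delta>]])
      then have "norm (zeta \<alpha> \<psi> z) \<le> M" using less by linarith
      moreover have "norm (of_real ?r / (z - ?a)) = ?r / \<delta>"
        using nz residue_integral_nonneg[of k] by (simp add: norm_divide)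
      moreover have "H z = zeta \<alpha> \<psi> z - of_real ?r / (z - ?a)" using eq[OF nz(2)] by simp
      ultimately show ?thesis using norm_triangle_ineq4[of "zeta \<alpha> \<psi> z" "of_real ?r / (z - ?a)"] by simp
    qed
    show "complex_of_real a \<in> cball ?a \<delta>" using a by (simp add: dist_of_real dist_real_def)
  qed
  moreover have "Re (zeta \<alpha> \<psi> (of_real a)) - ?r / (a - \<alpha>) = Re (H (of_real a))"
  proof -
    have "complex_of_real ?r / (complex_of_real a - ?a) = of_real (?r / (a - \<alpha>))" by simp
    then show ?thesis using eq[of "of_real a"] a by (simp del: of_real_divide)
  qed
  ultimately show ?thesis using abs_Re_le_cmod[of "H (of_real a)"] by linarith
qed

end

subsection \<open>Homogeneous functions with prescribed values on the quadratic sphere\<close>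

context dilation
begin

definition extend_homogeneous :: "(real^'n \<Rightarrow> real) \<Rightarrow> real^'n \<Rightarrow> real" where
  "extend_homogeneous f x = (if x = 0 then 0 else exp (level x) * f (proj x))"

lemma positive_homogeneous_extend:
  assumes "\<And>y. quad y = 1 \<Longrightarrow> f y > 0"
  shows "positive_homogeneous A (extend_homogeneous f)"
proof -
  have "extend_homogeneous f (flow A u *v x) = exp u * extend_homogeneous f x" for u x
    by (simp add: extend_homogeneous_def level_flow proj_flow exp_add)
  moreover have "extend_homogeneous f x > 0" if "x \<noteq> 0" for x
    using assms[OF quad_proj[OF that]] that by (simp add: extend_homogeneous_def)
  moreover have "extend_homogeneous f x \<ge> 0" for x
    using calculation(2)[of x] by (cases "x = 0") (auto simp: extend_homogeneous_def less_imp_le)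
  ultimately show ?thesis by (simp add: positive_homogeneous_def homogeneous_iff_flow)
qed

lemma smooth_on_extend:
  assumes "\<And>k. Ck_on k (\<lambda>x. f (proj x)) (UNIV - {0})"
  shows "smooth_on (extend_homogeneous f) (UNIV - {0})"
  unfolding smooth_on_def
proof
  fix k
  have "Ck_on k (\<lambda>x. exp (level x)) (UNIV - {0})"
    by (rule Ck_on_compose[OF open_nonzero open_UNIV Ck_on_level Ck_on_exp]) simp
  from Ck_on_mult[OF open_nonzero this assms]
  show "Ck_on k (extend_homogeneous f) (UNIV - {0})"
    by (rule Ck_on_cong[OF open_nonzero, rotated]) (simp add: extend_homogeneous_def)
qed

lemma Ck_on_polynomial_proj:
  assumes "real_polynomial_function f"
  shows "Ck_on k (\<lambda>x. f (proj x)) (UNIV - {0})"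
  using assms
proof induction
  case (linear f)
  have "f y = (\<Sum>i\<in>UNIV. f (axis i 1) * y $ i)" for y
  proof -
    have lin: "linear f" using linear by (rule bounded_linear.linear)
    have "f y = f (\<Sum>i\<in>UNIV. y $ i *\<^sub>R axis i 1)"
      by (simp add: basis_expansion scalar_mult_eq_scaleR[symmetric])
    then show ?thesis by (simp add: linear_sum[OF lin] linear_scale[OF lin] mult.commute)
  qed
  then have "(\<lambda>x. f (proj x)) = (\<lambda>x. \<Sum>i\<in>UNIV. f (axis i 1) * proj x $ i)" by blast
  then show ?case by (simp only:) (intro Ck_on_sum Ck_on_cmult open_nonzero Ck_on_proj)
qed (auto intro: Ck_on_const Ck_on_add Ck_on_mult open_nonzero)

lemma homogeneous_0:
  assumes "homogeneous A \<phi>"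
  shows "\<phi> 0 = 0"
proof -
  have "\<phi> 0 = exp 1 * \<phi> 0"
    using assms[unfolded homogeneous_iff_flow] matrix_vector_mult_0_right by metis
  moreover have "exp 1 \<noteq> (1 :: real)" by simp
  ultimately show ?thesis by (metis mult_cancel_right1)
qed

text \<open>Only the origin needs an argument: there \<psi> is squeezed between 0 and c \<phi>,
  which tends to \<phi>(0) = 0.\<close>

lemma continuous_on_homogeneous:
  assumes \<phi>: "continuous_on UNIV \<phi>" "homogeneous A \<phi>" and \<psi>: "smooth_on \<psi> (UNIV - {0})"
    and le: "\<And>x. 0 \<le> \<psi> x" "\<And>x. \<psi> x \<le> c * \<phi> x"
  shows "continuous_on UNIV \<psi>"
proof -
  have "isCont \<psi> x" for x
  proof (cases "x = 0")
    case False
    have "continuous_on (UNIV - {0}) \<psi>" using \<psi> Ck_on_imp_continuous_on by (auto simp: smooth_on_def)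
    then show ?thesis using False by (simp add: continuous_on_eq_continuous_at open_delete)
  next
    case True
    have 0: "\<phi> 0 = 0" by (rule homogeneous_0[OF \<phi>(2)])
    have "(\<phi> \<longlongrightarrow> 0) (at 0)" using \<phi>(1) 0 by (simp add: continuous_on_def) (metis UNIV_I)
    then have "((\<lambda>x. c * \<phi> x) \<longlongrightarrow> 0) (at 0)" using tendsto_mult_right_zero by blast
    then have "(\<psi> \<longlongrightarrow> 0) (at 0)"
      by (rule Lim_null_comparison[rotated]) (use le in auto)
    moreover have "\<psi> 0 = 0" using le(1)[of 0] le(2)[of 0] 0 by simp
    ultimately show ?thesis using True by (simp add: isCont_def)
  qed
  then show ?thesis by (simp add: continuous_at_imp_continuous_on)
qed

text \<open>A polynomial that on the ellipsoid takes values in [0, 1] and the value 1 exactly on F,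
  so its powers decrease to the indicator of F. The ellipsoid lies in the unit ball, hence each
  squared distance is at most 4.\<close>

definition spike :: "(real^'n) set \<Rightarrow> real^'n \<Rightarrow> real" where
  "spike F y = 1 - (\<Prod>a\<in>F. (y - a) \<bullet> (y - a)) / 4 ^ card F"

lemma spike_range:
  assumes "finite F" "\<And>a. a \<in> F \<Longrightarrow> quad a = 1" "quad y = 1"
  shows "0 \<le> spike F y" "spike F y \<le> 1" "y \<in> F \<Longrightarrow> spike F y = 1" "y \<notin> F \<Longrightarrow> spike F y < 1"
proof -
  have n1: "norm z \<le> 1" if "quad z = 1" for z
    using quad_lower[of z] that power2_le_imp_le[of "norm z" 1] by (simp add: quad_def)
  have "(y - a) \<bullet> (y - a) \<le> 4" if "a \<in> F" for a
  proof -
    have "norm (y - a) \<le> 2" using n1[OF assms(3)] n1[OF assms(2)[OF that]] norm_triangle_ineq4[of y a] by linarith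
    then have "(norm (y - a))\<^sup>2 \<le> 2\<^sup>2" by (intro power_mono) auto
    then show ?thesis by (simp add: power2_norm_eq_inner)
  qed
  then have "(\<Prod>a\<in>F. (y - a) \<bullet> (y - a)) \<le> (\<Prod>a\<in>F. 4)" by (intro prod_mono) auto
  then have le: "(\<Prod>a\<in>F. (y - a) \<bullet> (y - a)) \<le> 4 ^ card F" by simp
  have ge: "0 \<le> (\<Prod>a\<in>F. (y - a) \<bullet> (y - a))" by (intro prod_nonneg) auto
  show "0 \<le> spike F y" using le by (simp add: spike_def)
  show "spike F y \<le> 1" using ge by (simp add: spike_def)
  show "spike F y = 1" if "y \<in> F" using that assms(1) by (auto simp: spike_def)
  show "spike F y < 1" if "y \<notin> F"
  proof -
    have "0 < (\<Prod>a\<in>F. (y - a) \<bullet> (y - a))" using that by (intro prod_pos) auto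
    then show ?thesis by (simp add: spike_def)
  qed
qed

lemma Ck_on_spike_proj: "Ck_on k (\<lambda>x. spike F (proj x)) (UNIV - {0})"
  unfolding spike_def divide_inverse
  by (intro Ck_on_diff Ck_on_mult Ck_on_const Ck_on_prod Ck_on_inner open_nonzero)
    (simp_all add: Ck_on_diff Ck_on_proj Ck_on_const open_nonzero del: Ck_on.simps)

text \<open>An orbit is a differentiable image of the line, hence a null set in dimension at least
  2. This is where \<open>CARD('n) \<ge> 2\<close> enters.\<close>

lemma negligible_orbits:
  assumes "CARD('n) \<ge> 2" "finite F"
  shows "negligible (insert 0 {x. proj x \<in> F})"
proof -
  have "negligible (range (\<lambda>u. flow A u *v a))" for a
  proof (rule negligible_differentiable_image_lowdim)
    show "DIM(real) < DIM(real^'n)" using assms by simp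
    show "(\<lambda>u. flow A u *v a) differentiable_on UNIV"
      unfolding differentiable_on_def
      by (intro ballI differentiableI_vector[OF flow_has_vector_derivative_vec])
  qed
  then have "negligible (insert 0 (\<Union>a\<in>F. range (\<lambda>u. flow A u *v a)))"
    using assms(2) by auto
  then show ?thesis
  proof (rule negligible_subset)
    show "insert 0 {x. proj x \<in> F} \<subseteq> insert 0 (\<Union>a\<in>F. range (\<lambda>u. flow A u *v a))"
    proof
      fix x assume "x \<in> insert 0 {x. proj x \<in> F}"
      moreover have "x \<in> range (\<lambda>u. flow A u *v proj x)"
        by (rule image_eqI[of _ _ "level x"]) auto
      ultimately show "x \<in> insert 0 (\<Union>a\<in>F. range (\<lambda>u. flow A u *v a))" by blast
    qed
  qed
qed

lemma zeta_functionI: "positive_homogeneous A \<psi> \<Longrightarrow> smooth_on \<psi> (UNIV - {0}) \<Longrightarrow> zeta_function A P \<psi>"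
  by (intro zeta_function.intro dilation_axioms zeta_function_axioms.intro)

lemma zeta_large_on_circle:
  assumes n: "CARD('n) \<ge> 2"
    and \<phi>: "continuous_on UNIV \<phi>" "positive_homogeneous A \<phi>"
    and pos: "\<delta> > 0" "\<epsilon> > 0" "M > 0"
  shows "\<exists>\<psi> :: real^'n \<Rightarrow> real.
           positive_homogeneous A \<psi> \<and> continuous_on UNIV \<psi> \<and> smooth_on \<psi> (UNIV - {0}) \<and>
           (\<forall>x. \<phi> x \<le> \<psi> x \<and> \<psi> x \<le> (1 + \<epsilon>) * \<phi> x) \<and>
           (SUP s\<in>sphere (complex_of_real \<alpha>) \<delta>. cmod (zeta \<alpha> \<psi> s)) \<ge> M"
proof (rule ccontr)
  assume contra: "\<not> ?thesis"
  have hom: "homogeneous A \<phi>" using \<phi>(2) by (simp add: positive_homogeneous_def)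
  have \<phi>_pos: "\<phi> x > 0" if "x \<noteq> 0" for x using \<phi>(2) that by (simp add: positive_homogeneous_def)
  have \<phi>_sphere: "\<phi> y > 0" if "quad y = 1" for y
  proof (rule \<phi>_pos)
    show "y \<noteq> 0" using that by auto
  qed
  \<comment> \<open>The negated claim becomes a bound for every smooth choice f of values on the
    ellipsoid within the allowed range; the base function and all its perturbations are
    instances.\<close>
  have small: "(SUP s\<in>sphere (complex_of_real \<alpha>) \<delta>. cmod (zeta \<alpha> (extend_homogeneous f) s)) < M"
    and zf: "zeta_function A P (extend_homogeneous f)"
    if f: "\<And>y. quad y = 1 \<Longrightarrow> \<phi> y \<le> f y \<and> f y \<le> (1 + \<epsilon>) * \<phi> y"
      "\<And>k. Ck_on k (\<lambda>x. f (proj x)) (UNIV - {0})" for f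
  proof -
    let ?\<psi> = "extend_homogeneous f"
    have ph: "positive_homogeneous A ?\<psi>"
      by (rule positive_homogeneous_extend) (use f(1) \<phi>_sphere in \<open>force intro: less_le_trans\<close>)
    have sm: "smooth_on ?\<psi> (UNIV - {0})" by (rule smooth_on_extend[OF f(2)])
    have bounds: "\<phi> x \<le> ?\<psi> x \<and> ?\<psi> x \<le> (1 + \<epsilon>) * \<phi> x" for x
    proof (cases "x = 0")
      case True then show ?thesis by (simp add: extend_homogeneous_def homogeneous_0[OF hom])
    next
      case False
      then show ?thesis
        using f(1)[OF quad_proj[OF False]] homogeneous_eq_proj[OF hom, of x]
        by (simp add: extend_homogeneous_def mult.left_commute)
    qed
    have "continuous_on UNIV ?\<psi>"
      by (rule continuous_on_homogeneous[OF \<phi>(1) hom sm, of "1 + \<epsilon>"])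
        (use bounds ph in \<open>auto simp: positive_homogeneous_def\<close>)
    then show "(SUP s\<in>sphere (complex_of_real \<alpha>) \<delta>. cmod (zeta \<alpha> ?\<psi> s)) < M"
      using contra ph sm bounds not_le by blast
    show "zeta_function A P ?\<psi>" by (rule zeta_functionI[OF ph sm])
  qed
  have sphere_ne: "{y. quad y = 1} \<noteq> {}"
  proof -
    have "quad (proj (axis undefined 1)) = 1" by (rule quad_proj) (simp add: axis_eq_0_iff)
    then show ?thesis by blast
  qed
  \<comment> \<open>The minimum of \<phi> on the compact ellipsoid turns the additive error of
    Weierstrass approximation into a relative one.\<close>
  obtain m where m: "m > 0" "\<And>y. quad y = 1 \<Longrightarrow> m \<le> \<phi> y"
    using continuous_attains_inf[OF compact_quad_sphere sphere_ne continuous_on_subset[OF \<phi>(1)]] \<phi>_sphere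
    by auto
  \<comment> \<open>Aiming at the middle of the range with relative error \<epsilon> / 4 keeps p
    above \<phi> and leaves room above p for the perturbations.\<close>
  have "continuous_on {y. quad y = 1} (\<lambda>y. (1 + \<epsilon> / 2) * \<phi> y)"
    by (intro continuous_intros continuous_on_subset[OF \<phi>(1)]) auto
  moreover have "\<epsilon> / 4 * m > 0" using pos m by simp
  ultimately obtain p where p: "real_polynomial_function p"
    "\<And>y. y \<in> {y. quad y = 1} \<Longrightarrow> \<bar>(1 + \<epsilon> / 2) * \<phi> y - p y\<bar> < \<epsilon> / 4 * m"
    by (rule Stone_Weierstrass_real_polynomial_function[OF compact_quad_sphere]) blast
  have p_bounds: "(1 + \<epsilon> / 4) * \<phi> y \<le> p y" "p y \<le> (1 + 3 * \<epsilon> / 4) * \<phi> y" if "quad y = 1" for y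
  proof -
    have "\<epsilon> / 4 * m \<le> \<epsilon> / 4 * \<phi> y" using pos m(2)[OF that] by (intro mult_left_mono) auto
    then have "\<bar>(1 + \<epsilon> / 2) * \<phi> y - p y\<bar> \<le> \<epsilon> / 4 * \<phi> y" using p(2)[of y] that by simp
    moreover define X where "X = \<epsilon> * \<phi> y"
    moreover have X: "(1 + \<epsilon> / 2) * \<phi> y = \<phi> y + X / 2" "\<epsilon> / 4 * \<phi> y = X / 4"
      "(1 + \<epsilon> / 4) * \<phi> y = \<phi> y + X / 4" "(1 + 3 * \<epsilon> / 4) * \<phi> y = \<phi> y + 3 * X / 4"
      by (auto simp: X_def field_simps)
    ultimately have "\<bar>\<phi> y + X / 2 - p y\<bar> \<le> X / 4" by (simp only: X)
    then show "(1 + \<epsilon> / 4) * \<phi> y \<le> p y" "p y \<le> (1 + 3 * \<epsilon> / 4) * \<phi> y"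
      unfolding X abs_le_iff by linarith+
  qed
  \<comment> \<open>The solution of (1 + 3 \<epsilon> / 4) (1 + \<eta>) = 1 + \<epsilon>: the
    largest factor that the upper bound on p guarantees.\<close>
  define \<eta> where "\<eta> = \<epsilon> / (4 + 3 * \<epsilon>)"
  have \<eta>: "\<eta> > 0" "(1 + 3 * \<epsilon> / 4) * (1 + \<eta>) = 1 + \<epsilon>" using pos by (auto simp: \<eta>_def field_simps)
  define g where "g = (\<lambda>F j y. p y * (1 + \<eta> * spike F y ^ j))"
  have p_pos: "p y > 0" if "quad y = 1" for y
    using p_bounds(1)[OF that] mult_pos_pos[OF _ \<phi>_sphere[OF that], of "1 + \<epsilon> / 4"] pos by linarith
  have g_ok: "\<phi> y \<le> g F j y \<and> g F j y \<le> (1 + \<epsilon>) * \<phi> y" and g_ge: "p y \<le> g F j y"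
    if F: "finite F" "\<And>a. a \<in> F \<Longrightarrow> quad a = 1" and y: "quad y = 1" for F j y
  proof -
    have b: "0 \<le> spike F y ^ j" "spike F y ^ j \<le> 1" using spike_range(1,2)[OF F y] by (auto intro: power_le_one)
    have e: "1 \<le> 1 + \<eta> * spike F y ^ j" "1 + \<eta> * spike F y ^ j \<le> 1 + \<eta>"
      using b \<eta>(1) mult_left_mono[OF b(2), of \<eta>] by auto
    show ge: "p y \<le> g F j y" using mult_left_mono[OF e(1), of "p y"] p_pos[OF y] by (simp add: g_def)
    have "\<phi> y \<le> (1 + \<epsilon> / 4) * \<phi> y" using pos \<phi>_sphere[OF y] by (simp add: algebra_simps)
    then have "\<phi> y \<le> g F j y" using ge p_bounds(1)[OF y] by linarith
    moreover have "g F j y \<le> ((1 + 3 * \<epsilon> / 4) * \<phi> y) * (1 + \<eta>)"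
      unfolding g_def using p_bounds(2)[OF y] p_pos[OF y] e \<phi>_sphere[OF y] pos by (intro mult_mono) auto
    ultimately show "\<phi> y \<le> g F j y \<and> g F j y \<le> (1 + \<epsilon>) * \<phi> y"
      using \<eta>(2) by (simp add: mult.commute mult.left_commute)
  qed
  have p_ok: "\<phi> y \<le> p y \<and> p y \<le> (1 + \<epsilon>) * \<phi> y" if y: "quad y = 1" for y
    using g_ok[of "{}" y 0] g_ge[of "{}" y 0] p_bounds(1)[OF y] \<phi>_sphere[OF y] pos y
    by (auto simp: algebra_simps intro: order_trans)
  have p_smooth: "Ck_on k (\<lambda>x. p (proj x)) (UNIV - {0})" for k by (rule Ck_on_polynomial_proj[OF p(1)])
  have g_smooth: "Ck_on k (\<lambda>x. g F j (proj x)) (UNIV - {0})" for k F j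
    unfolding g_def
    by (intro Ck_on_mult Ck_on_add Ck_on_const Ck_on_power Ck_on_spike_proj p_smooth open_nonzero)
  obtain k where k: "adequate k 1" using adequate_exists by blast
  let ?base = "extend_homogeneous p"
  interpret z0: zeta_function A P ?base by (rule zf[OF p_ok p_smooth])
  define r0 where "r0 = residue_integral k ?base"
  \<comment> \<open>Bounds the regular part of the base function and of every perturbation alike,
    since enlarging the function can only lower its residue.\<close>
  define M' where "M' = M + r0 / \<delta>"
  have r0: "r0 > 0" unfolding r0_def by (rule z0.residue_integral_pos)
  \<comment> \<open>The least fraction that a term loses when its function value is multiplied by 1
    + \<eta>; computed at \<alpha>, it is valid for all a > \<alpha>.\<close>
  define \<kappa> where "\<kappa> = 1 - (1 + \<eta>) powr (- \<alpha>)"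
  have \<kappa>: "\<kappa> > 0" using \<eta>(1) alpha_pos powr_less_mono[of "- \<alpha>" 0 "1 + \<eta>"] by (simp add: \<kappa>_def)
  have partial: "\<kappa> * (\<Sum>\<omega>\<in>W. ?base \<omega> powr (- a)) \<le> 2 * M'"
    if W: "finite W" "W \<subseteq> integer_lattice - {0}" and a: "\<alpha> < a" "a < \<alpha> + \<delta>" for W a
  proof -
    define F where "F = proj ` W"
    have F: "finite F" "\<And>a. a \<in> F \<Longrightarrow> quad a = 1" using W by (auto simp: F_def intro!: quad_proj)
    let ?\<psi> = "\<lambda>j. extend_homogeneous (g F j)"
    have zj: "zeta_function A P (?\<psi> j)" for j by (rule zf[OF g_ok[OF F] g_smooth])
    have \<psi>_ge: "?base x \<le> ?\<psi> j x" for j x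
      using g_ge[OF F quad_proj[of x]] by (auto simp: extend_homogeneous_def)
    have \<psi>0_pos: "?base x > 0" if "x \<noteq> 0" for x using z0.psi_pos[OF that] .
    have powr_le: "?\<psi> j x powr (- b) \<le> ?base x powr (- b)" if "x \<noteq> 0" "b > 0" for j x b
      using \<psi>_ge[of x j] \<psi>0_pos[OF that(1)] that(2) by (intro powr_mono2') auto
    have dens_le: "norm (residue_density k (?\<psi> j) x) \<le> residue_density k ?base x" for j x
      using zeta_function.residue_density_nonneg[OF zj] powr_le[of x \<alpha> j] alpha_pos bump_nonneg[of k "level x"]
      by (auto simp: residue_density_def intro!: mult_right_mono)
    \<comment> \<open>On the orbits through F the perturbed functions stay at 1 + \<eta> times the
      base function for every j. Setting the densities to 0 there gives convergence at every point
      and changes no integral.\<close>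
    let ?N = "insert 0 {x. proj x \<in> F}"
    have neg: "negligible ?N" by (rule negligible_orbits[OF n F(1)])
    let ?d = "\<lambda>j x. if x \<in> ?N then 0 else residue_density k (?\<psi> j) x"
    have int_d: "integral UNIV (?d j) = residue_integral k (?\<psi> j)" for j
      unfolding residue_integral_def by (rule integral_spike[OF neg]) auto
    have d_int: "?d j integrable_on UNIV" for j
      by (rule integrable_spike[OF zeta_function.residue_density_integrable[OF zj] neg]) auto
    have "(\<lambda>j. integral UNIV (?d j)) \<longlonglongrightarrow> integral UNIV (\<lambda>x. if x \<in> ?N then 0 else residue_density k ?base x)"
    proof (rule dominated_convergence(2)[OF d_int z0.residue_density_integrable[of k]])
      show "norm (?d j x) \<le> residue_density k ?base x" for j x
        using dens_le[of j x] z0.residue_density_nonneg[of k x] by auto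
      show "(\<lambda>j. ?d j x) \<longlonglongrightarrow> (if x \<in> ?N then 0 else residue_density k ?base x)" for x
      proof (cases "x \<in> ?N")
        case False
        then have x: "x \<noteq> 0" "proj x \<notin> F" by auto
        have "spike F (proj x) \<ge> 0" "spike F (proj x) < 1" using spike_range(1,4)[OF F quad_proj[OF x(1)]] x(2) by auto
        then have lim: "(\<lambda>j. spike F (proj x) ^ j) \<longlonglongrightarrow> 0" by (rule LIMSEQ_realpow_zero)
        have "(\<lambda>j. exp (level x) * (p (proj x) * (1 + \<eta> * spike F (proj x) ^ j))) \<longlonglongrightarrow>
            exp (level x) * (p (proj x) * (1 + \<eta> * 0))"
          by (intro tendsto_mult tendsto_add tendsto_const lim)
        then have "(\<lambda>j. ?\<psi> j x) \<longlonglongrightarrow> ?base x" using x by (simp add: extend_homogeneous_def g_def)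
        then have "(\<lambda>j. ?\<psi> j x powr (- \<alpha>) * bump k (level x)) \<longlonglongrightarrow> ?base x powr (- \<alpha>) * bump k (level x)"
          using \<psi>0_pos[OF x(1)] by (intro tendsto_intros) auto
        then show ?thesis using False x by (simp add: residue_density_def)
      qed simp
    qed
    moreover have "integral UNIV (\<lambda>x. if x \<in> ?N then 0 else residue_density k ?base x) = r0"
      unfolding r0_def residue_integral_def by (rule integral_spike[OF neg]) auto
    ultimately have r_lim: "(\<lambda>j. residue_integral k (?\<psi> j)) \<longlonglongrightarrow> r0"
      by (simp only: int_d)
    have r_le: "residue_integral k (?\<psi> j) \<le> r0" for j
      unfolding residue_integral_def r0_def
      by (rule integral_le[OF zeta_function.residue_density_integrable[OF zj] z0.residue_density_integrable])
        (use dens_le abs_le_D1 in \<open>auto simp: real_norm_def\<close>)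
    \<comment> \<open>The difference of the two zeta values at a is at least the left side. Each
      value is within M' of its polar part, and the polar parts differ by the last term, which
      vanishes as j grows because a is fixed.\<close>
    have step: "\<kappa> * (\<Sum>\<omega>\<in>W. ?base \<omega> powr (- a)) \<le> 2 * M' + (r0 - residue_integral k (?\<psi> j)) / (a - \<alpha>)" for j
    proof -
      let ?r = "residue_integral k (?\<psi> j)"
      let ?Z0 = "Re (zeta \<alpha> ?base (of_real a))" and ?Zj = "Re (zeta \<alpha> (?\<psi> j) (of_real a))"
      have a0: "a > 0" using a alpha_pos by linarith
      have drop: "\<kappa> * ?base \<omega> powr (- a) \<le> ?base \<omega> powr (- a) - ?\<psi> j \<omega> powr (- a)" if "\<omega> \<in> W" for \<omega>
      proof -
        have w: "\<omega> \<noteq> 0" "proj \<omega> \<in> F" using that W by (auto simp: F_def)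
        have "spike F (proj \<omega>) = 1" by (rule spike_range(3)[OF F quad_proj[OF w(1)] w(2)])
        then have "?\<psi> j \<omega> = (1 + \<eta>) * ?base \<omega>" using w by (simp add: extend_homogeneous_def g_def)
        then have "?\<psi> j \<omega> powr (- a) = (1 + \<eta>) powr (- a) * ?base \<omega> powr (- a)"
          using \<eta>(1) \<psi>0_pos[OF w(1)] by (simp add: powr_mult)
        also have "\<dots> \<le> (1 + \<eta>) powr (- \<alpha>) * ?base \<omega> powr (- a)"
          using \<eta>(1) a by (intro mult_right_mono powr_mono) auto
        finally show ?thesis by (simp add: \<kappa>_def algebra_simps)
      qed
      have "((\<lambda>\<omega>. if \<omega> \<in> W then ?base \<omega> powr (- a) - ?\<psi> j \<omega> powr (- a) else 0) has_sum
          (\<Sum>\<omega>\<in>W. ?base \<omega> powr (- a) - ?\<psi> j \<omega> powr (- a))) (integer_lattice - {0})"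
        by (rule has_sum_finite_neutralI) (use W in auto)
      from has_sum_add[OF zeta_function.zeta_real_has_sum[OF zj a(1)] this]
      have "?Zj + (\<Sum>\<omega>\<in>W. ?base \<omega> powr (- a) - ?\<psi> j \<omega> powr (- a)) \<le> ?Z0"
        by (rule has_sum_mono[OF _ z0.zeta_real_has_sum[OF a(1)]]) (use powr_le[OF _ a0] in auto)
      moreover have "\<kappa> * (\<Sum>\<omega>\<in>W. ?base \<omega> powr (- a)) \<le> (\<Sum>\<omega>\<in>W. ?base \<omega> powr (- a) - ?\<psi> j \<omega> powr (- a))"
        unfolding sum_distrib_left by (rule sum_mono[OF drop])
      moreover have "\<bar>?Z0 - r0 / (a - \<alpha>)\<bar> \<le> M'"
        unfolding r0_def M'_def
        by (rule z0.zeta_regular_part_bound[OF k pos(1) small[OF p_ok p_smooth] a])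
      moreover have "\<bar>?Zj - ?r / (a - \<alpha>)\<bar> \<le> M + ?r / \<delta>"
        by (rule zeta_function.zeta_regular_part_bound[OF zj k pos(1) small[OF g_ok[OF F] g_smooth] a])
      moreover have "M + ?r / \<delta> \<le> M'" using r_le[of j] pos by (simp add: M'_def divide_right_mono)
      moreover have "(r0 - ?r) / (a - \<alpha>) = r0 / (a - \<alpha>) - ?r / (a - \<alpha>)" by (rule diff_divide_distrib)
      ultimately show ?thesis by linarith
    qed
    have "(\<lambda>j. 2 * M' + (r0 - residue_integral k (?\<psi> j)) / (a - \<alpha>)) \<longlonglongrightarrow> 2 * M' + (r0 - r0) / (a - \<alpha>)"
      using a by (intro tendsto_intros r_lim) auto
    then have "(\<lambda>j. 2 * M' + (r0 - residue_integral k (?\<psi> j)) / (a - \<alpha>)) \<longlonglongrightarrow> 2 * M'" by simp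
    then show ?thesis by (rule LIMSEQ_le_const) (use step in blast)
  qed
  define B where "B = 2 * M' / \<kappa>"
  have M'_pos: "M' > 0" using pos r0 by (simp add: M'_def add_pos_pos)
  then have B: "B > 0" using \<kappa> by (simp add: B_def)
  \<comment> \<open>At \<alpha> + t the polar part r0 / t is at least B + M' + 1, while zeta is at
    most B and within M' of it. The bound \<delta> / 2 keeps the point inside the disc.\<close>
  define t where "t = min (\<delta> / 2) (r0 / (B + M' + 1))"
  have "t > 0" using pos r0 B M'_pos by (simp add: t_def)
  moreover have "t \<le> \<delta> / 2" "t \<le> r0 / (B + M' + 1)" by (simp_all only: t_def min.cobounded1 min.cobounded2)
  ultimately have t: "t > 0" "t < \<delta>" "t \<le> r0 / (B + M' + 1)" using pos by linarith+
  let ?a = "\<alpha> + t"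
  have a: "\<alpha> < ?a" "?a < \<alpha> + \<delta>" using t by auto
  have "Re (zeta \<alpha> ?base (of_real ?a)) \<le> B"
  proof (rule has_sum_le_finite_sums[OF z0.zeta_real_has_sum[OF a(1)]])
    fix W :: "(real^'n) set" assume "finite W" "W \<subseteq> integer_lattice - {0}"
    from partial[OF this a] show "(\<Sum>\<omega>\<in>W. ?base \<omega> powr (- ?a)) \<le> B"
      using \<kappa> by (simp add: B_def field_simps)
  qed
  moreover have "\<bar>Re (zeta \<alpha> ?base (of_real ?a)) - r0 / (?a - \<alpha>)\<bar> \<le> M'"
    unfolding r0_def M'_def
    by (rule z0.zeta_regular_part_bound[OF k pos(1) small[OF p_ok p_smooth] a])
  moreover have "B + M' + 1 \<le> r0 / t"
    using t B M'_pos by (simp add: field_simps)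
  ultimately show False by simp
qed

end

theorem theorem1p3:
  fixes A :: "real^'n^'n" and \<phi> :: "real^'n \<Rightarrow> real" and \<alpha> \<delta> \<epsilon> M :: real
  assumes "CARD('n) \<ge> 2" and "A \<in> M_plus" and "trace A = \<alpha>"
    and "continuous_on UNIV \<phi>" and "positive_homogeneous A \<phi>"
    and "\<delta> > 0" and "\<epsilon> > 0" and "M > 0"
  shows "\<exists>\<psi> :: real^'n \<Rightarrow> real.
           positive_homogeneous A \<psi> \<and> continuous_on UNIV \<psi> \<and> smooth_on \<psi> (UNIV - {0}) \<and>
           (\<forall>x. \<phi> x \<le> \<psi> x \<and> \<psi> x \<le> (1 + \<epsilon>) * \<phi> x) \<and>
           (SUP s\<in>sphere (complex_of_real \<alpha>) \<delta>. cmod (zeta \<alpha> \<psi> s)) \<ge> M"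
proof -
  obtain P :: "real^'n^'n" where "\<forall>x. (norm x)\<^sup>2 \<le> x \<bullet> (P *v x)"
    "\<forall>x. x \<noteq> 0 \<longrightarrow> (A *v x) \<bullet> (P *v x) + x \<bullet> (P *v (A *v x)) > 0"
    using lyapunov_form[OF assms(2)] by blast
  then interpret dilation A P using assms(2) by unfold_locales auto
  show ?thesis using zeta_large_on_circle[OF assms(1,4,5,6,7,8)] assms(3) by simp
qed

end
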